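(* Let $d_1,d_2,r>0$, $0<b<1$ and $a>\dfrac{(b+1)^2}{2(1-b)}$. If $l>\sqrt{d_1/A_0}$ and $l\notin L_{TT}\cup L_{TH}$, then the diffusive Holling–Tanner system (HT) undergoes a steady state (Turing) bifurcation (at the constant steady state $(u_0,v_0)$) when $r=r_n^T(l)$ $(1\le n\le N_2)$. Moreover, the bifurcation solutions can be stable only when $a,b,d_1,d_2,l$ also satisfy condition (A6$''$) listed in the context and $r=r_*$.
   Context: $\mathbb N=\{0,1,2,\dots\}$. The system (HT) is $$u_t-d_1\Delta u=u(1-u)-\frac{auv}{u+b},\qquad v_t-d_2\Delta v=rv\Big(1-\frac{v}{u}\Big),\qquad x\in(0,l\pi),\ t>0,$$ with $u_x=v_x=0$ at $x=0$ and $x=l\pi$ for $t>0$, and initial data $u(x,0)=u_0(x)$, $v(x,0)=v_0(x)$. Its positive constant steady state is $(u_0,v_0)$ with $u_0=v_0=\frac12[(1-a-b)+\sqrt{(a+b-1)^2+4b}]$. The bifurcation is with respect to the parameter $r$. Set $A_0=\frac{u_0}{b+u_0}(1-b-2u_0)$, $B_0=-\frac{au_0}{b+u_0}=u_0-1$. The eigenvalues of the linearization at $(u_0,v_0)$ are the roots of $\lambda^2-T_n(r,l)\lambda+D_n(r,l)=0$, $n\in\mathbb N$, where $T_n(r,l)=A_0-(d_1+d_2)\frac{n^2}{l^2}-r$ and $D_n(r,l)=d_2\frac{n^2}{l^2}(d_1\frac{n^2}{l^2}-A_0)+r(d_1\frac{n^2}{l^2}-A_0-B_0)$. Define $$r_n^H(l)=A_0-(d_1+d_2)\frac{n^2}{l^2},\qquad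 r_n^T(l)=-\frac{d_2\frac{n^2}{l^2}(d_1\frac{n^2}{l^2}-A_0)}{d_1\frac{n^2}{l^2}-A_0-B_0}.$$ Let $\bar x=\frac{1}{2d_1^2}\big[2d_1A_0+(d_1+d_2)B_0+\sqrt{(d_1+d_2)^2B_0^2+4d_1d_2A_0B_0}\big]$, $l_n^H=n/\sqrt{\bar x}$, $l_n^T=n\sqrt{d_1/A_0}$. For given $l$, $N_1=N_1(l)$ and $N_2=N_2(l)$ are the non-negative integers with $l_{N_1}^H<l\le l_{N_1+1}^H$ and $l_{N_2}^T<l\le l_{N_2+1}^T$. With $N_2\ge1$, $S_1=(l_{N_2}^T,l_{N_2+1}^T]$ and $S_2=(l_{N_1}^H,l_{N_1+1}^H]\cap(l_{N_2}^T,l_{N_2+1}^T]$, $$L_{TT}=\{l\in S_1:\ r_i^T(l)=r_j^T(l)\text{ for some }1\le i<j\le N_2\},$$ $$L_{TH}=\{l\in S_2:\ r_i^H(l)=r_j^T(l)\text{ for some }0\le i\le N_1<j\le N_2\}.$$ For $l>\sqrt{d_1/A_0}$ let $r_*=\max_{1\le n\le N_2}r_n^T(l)$. For $d_1\neq d_2$ let $$b_*=\frac{[(d_1+d_2)^2-\sqrt{(d_1+d_2)^4-(d_1-d_2)^4}]^2}{(d_1-d_2)^4},$$ $$a_\pm=\frac{(1-b)(d_1+d_2)^4\pm(d_1+d_2)^2\sqrt{(b+1)^2(d_1-d_2)^4-4b(d_1+d_2)^4}}{(d_1+d_2)^4-(d_1-d_2)^4},$$ $$x_\pm=\frac{1}{2d_1d_2}\big[(d_2-d_1)A_0\pm\sqrt{(d_1+d_2)^2A_0^2+4d_1d_2A_0B_0}\big],\quad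 l_n^\pm=n/\sqrt{x_\pm},$$ and let $M_1,M_2\in\mathbb N$ be such that $l_{M_1-1}^-\le l<l_{M_1}^-$ and $l_{M_2}^+<l\le l_{M_2+1}^+$ ($a_\pm$ are used only when $d_2>d_1$, $0<b\le b_*$; $x_\pm,M_1,M_2$ only when moreover $a_-<a<a_+$). (A6$''$): $d_2>d_1$, $0<b<b_*$, $a_-<a<a_+$, $M_1(l)\le M_2(l)$. *)

theory Defs
  imports "HOL-Analysis.Analysis"
begin

section \<open>The diffusive Holling--Tanner system on the interval from 0 to \<open>l\<pi>\<close>\<close>

definition HT_f :: "real \<Rightarrow> real \<Rightarrow> real \<Rightarrow> real \<Rightarrow> real" where
  "HT_f a b u v = u * (1 - u) - a * u * v / (u + b)"

definition HT_g :: "real \<Rightarrow> real \<Rightarrow> real \<Rightarrow> real" where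
  "HT_g r u v = r * v * (1 - v / u)"

text \<open>The spatial derivative, one-sided at the two end points; only meaningful for \<open>l > 0\<close>.\<close>

definition ddx :: "real \<Rightarrow> (real \<Rightarrow> real) \<Rightarrow> real \<Rightarrow> real" where
  "ddx l w x = vector_derivative w (at x within {0..l * pi})"

definition neumann_C2 :: "real \<Rightarrow> (real \<Rightarrow> real) \<Rightarrow> bool" where
  "neumann_C2 l w \<longleftrightarrow>
     w differentiable_on {0..l * pi} \<and>
     ddx l w differentiable_on {0..l * pi} \<and>
     continuous_on {0..l * pi} (ddx l (ddx l w)) \<and>
     ddx l w 0 = 0 \<and> ddx l w (l * pi) = 0"

text \<open>Positive classical solutions on the time interval \<open>[0,T)\<close>: continuous up to \<open>t = 0\<close>,
  twice continuously differentiable in space up to the boundary for \<open>t > 0\<close>.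
  The arguments of \<open>u\<close> and \<open>v\<close> are space first, then time.\<close>

definition HT_solution ::
  "real \<Rightarrow> real \<Rightarrow> real \<Rightarrow> real \<Rightarrow> real \<Rightarrow> real \<Rightarrow> real \<Rightarrow>
     (real \<Rightarrow> real \<Rightarrow> real) \<Rightarrow> (real \<Rightarrow> real \<Rightarrow> real) \<Rightarrow> bool" where
  "HT_solution a b d1 d2 r l T u v \<longleftrightarrow>
     continuous_on ({0..l * pi} \<times> {0..<T}) (\<lambda>(x, t). u x t) \<and>
     continuous_on ({0..l * pi} \<times> {0..<T}) (\<lambda>(x, t). v x t) \<and>
     (\<forall>x\<in>{0..l * pi}. \<forall>t\<in>{0..<T}. u x t > 0 \<and> v x t > 0) \<and>
     (\<forall>t\<in>{0<..<T}. neumann_C2 l (\<lambda>x. u x t) \<and> neumann_C2 l (\<lambda>x. v x t)) \<and>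
     continuous_on ({0..l * pi} \<times> {0<..<T}) (\<lambda>(x, t). ddx l (ddx l (\<lambda>y. u y t)) x) \<and>
     continuous_on ({0..l * pi} \<times> {0<..<T}) (\<lambda>(x, t). ddx l (ddx l (\<lambda>y. v y t)) x) \<and>
     (\<forall>x\<in>{0<..<l * pi}. \<forall>t\<in>{0<..<T}.
        ((\<lambda>s. u x s) has_real_derivative
           (d1 * ddx l (ddx l (\<lambda>y. u y t)) x + HT_f a b (u x t) (v x t))) (at t) \<and>
        ((\<lambda>s. v x s) has_real_derivative
           (d2 * ddx l (ddx l (\<lambda>y. v y t)) x + HT_g r (u x t) (v x t))) (at t))"

definition HT_steady_state ::
  "real \<Rightarrow> real \<Rightarrow> real \<Rightarrow> real \<Rightarrow> real \<Rightarrow> real \<Rightarrow>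
     (real \<Rightarrow> real) \<Rightarrow> (real \<Rightarrow> real) \<Rightarrow> bool" where
  "HT_steady_state a b d1 d2 r l U V \<longleftrightarrow>
     neumann_C2 l U \<and> neumann_C2 l V \<and>
     (\<forall>x\<in>{0..l * pi}. U x > 0 \<and> V x > 0) \<and>
     (\<forall>x\<in>{0<..<l * pi}.
        d1 * ddx l (ddx l U) x + HT_f a b (U x) (V x) = 0 \<and>
        d2 * ddx l (ddx l V) x + HT_g r (U x) (V x) = 0)"

text \<open>Lyapunov stability in the uniform norm. Every local classical solution is tested
  on its whole interval of existence; solutions that stay near a positive steady state
  can be continued for all times.\<close>

definition HT_stable ::
  "real \<Rightarrow> real \<Rightarrow> real \<Rightarrow> real \<Rightarrow> real \<Rightarrow> real \<Rightarrow>
     (real \<Rightarrow> real) \<Rightarrow> (real \<Rightarrow> real) \<Rightarrow> bool" where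
  "HT_stable a b d1 d2 r l U V \<longleftrightarrow>
     (\<forall>\<epsilon>>0. \<exists>\<delta>>0. \<forall>T>0. \<forall>u v.
        HT_solution a b d1 d2 r l T u v \<longrightarrow>
        (\<forall>x\<in>{0..l * pi}. \<bar>u x 0 - U x\<bar> < \<delta> \<and> \<bar>v x 0 - V x\<bar> < \<delta>) \<longrightarrow>
        (\<forall>t\<in>{0..<T}. \<forall>x\<in>{0..l * pi}. \<bar>u x t - U x\<bar> < \<epsilon> \<and> \<bar>v x t - V x\<bar> < \<epsilon>))"


section \<open>Steady state (Turing) bifurcation from the constant steady state\<close>

definition HT_u0 :: "real \<Rightarrow> real \<Rightarrow> real" where
  "HT_u0 a b = ((1 - a - b) + sqrt ((a + b - 1)^2 + 4 * b)) / 2"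

definition HT_v0 :: "real \<Rightarrow> real \<Rightarrow> real" where
  "HT_v0 a b = HT_u0 a b"

definition C2_near :: "real \<Rightarrow> real \<Rightarrow> (real \<Rightarrow> real) \<Rightarrow> real \<Rightarrow> bool" where
  "C2_near l \<epsilon> w c \<longleftrightarrow>
     (\<forall>x\<in>{0..l * pi}. \<bar>w x - c\<bar> < \<epsilon> \<and> \<bar>ddx l w x\<bar> < \<epsilon> \<and> \<bar>ddx l (ddx l w) x\<bar> < \<epsilon>)"

text \<open>Spatially nonhomogeneous steady states for the parameter value \<open>r\<close>
  in the \<open>\<epsilon>\<close>-neighbourhood of \<open>(r0, (u0, v0))\<close>.\<close>

definition HT_bif_solution ::
  "real \<Rightarrow> real \<Rightarrow> real \<Rightarrow> real \<Rightarrow> real \<Rightarrow> real \<Rightarrow> real \<Rightarrow> real \<Rightarrow>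
     (real \<Rightarrow> real) \<Rightarrow> (real \<Rightarrow> real) \<Rightarrow> bool" where
  "HT_bif_solution a b d1 d2 l r0 \<epsilon> r U V \<longleftrightarrow>
     r > 0 \<and> \<bar>r - r0\<bar> < \<epsilon> \<and>
     HT_steady_state a b d1 d2 r l U V \<and>
     \<not> (U constant_on {0..l * pi} \<and> V constant_on {0..l * pi}) \<and>
     C2_near l \<epsilon> U (HT_u0 a b) \<and> C2_near l \<epsilon> V (HT_v0 a b)"

definition HT_steady_state_bifurcation ::
  "real \<Rightarrow> real \<Rightarrow> real \<Rightarrow> real \<Rightarrow> real \<Rightarrow> real \<Rightarrow> bool" where
  "HT_steady_state_bifurcation a b d1 d2 l r0 \<longleftrightarrow>
     r0 > 0 \<and>
     (\<forall>r>0. HT_steady_state a b d1 d2 r l (\<lambda>_. HT_u0 a b) (\<lambda>_. HT_v0 a b)) \<and>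
     (\<forall>\<epsilon>>0. \<exists>r U V. HT_bif_solution a b d1 d2 l r0 \<epsilon> r U V)"

text \<open>Stable bifurcating solutions occur arbitrarily close to the bifurcation point.\<close>

definition HT_stable_bif_solutions ::
  "real \<Rightarrow> real \<Rightarrow> real \<Rightarrow> real \<Rightarrow> real \<Rightarrow> real \<Rightarrow> bool" where
  "HT_stable_bif_solutions a b d1 d2 l r0 \<longleftrightarrow>
     (\<forall>\<epsilon>>0. \<exists>r U V. HT_bif_solution a b d1 d2 l r0 \<epsilon> r U V \<and> HT_stable a b d1 d2 r l U V)"


section \<open>Critical values\<close>

definition HT_A0 :: "real \<Rightarrow> real \<Rightarrow> real" where
  "HT_A0 a b = HT_u0 a b / (b + HT_u0 a b) * (1 - b - 2 * HT_u0 a b)"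

definition HT_B0 :: "real \<Rightarrow> real \<Rightarrow> real" where
  "HT_B0 a b = - (a * HT_u0 a b / (b + HT_u0 a b))"

definition HT_rH :: "real \<Rightarrow> real \<Rightarrow> real \<Rightarrow> real \<Rightarrow> nat \<Rightarrow> real \<Rightarrow> real" where
  "HT_rH a b d1 d2 n l = HT_A0 a b - (d1 + d2) * ((real n)^2 / l^2)"

definition HT_rT :: "real \<Rightarrow> real \<Rightarrow> real \<Rightarrow> real \<Rightarrow> nat \<Rightarrow> real \<Rightarrow> real" where
  "HT_rT a b d1 d2 n l =
     - (d2 * ((real n)^2 / l^2) * (d1 * ((real n)^2 / l^2) - HT_A0 a b)
        / (d1 * ((real n)^2 / l^2) - HT_A0 a b - HT_B0 a b))"

definition HT_xbar :: "real \<Rightarrow> real \<Rightarrow> real \<Rightarrow> real \<Rightarrow> real" where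
  "HT_xbar a b d1 d2 =
     1 / (2 * d1^2) *
       (2 * d1 * HT_A0 a b + (d1 + d2) * HT_B0 a b
        + sqrt ((d1 + d2)^2 * (HT_B0 a b)^2 + 4 * d1 * d2 * HT_A0 a b * HT_B0 a b))"

definition HT_lH :: "real \<Rightarrow> real \<Rightarrow> real \<Rightarrow> real \<Rightarrow> nat \<Rightarrow> real" where
  "HT_lH a b d1 d2 n = real n / sqrt (HT_xbar a b d1 d2)"

definition HT_lT :: "real \<Rightarrow> real \<Rightarrow> real \<Rightarrow> nat \<Rightarrow> real" where
  "HT_lT a b d1 n = real n * sqrt (d1 / HT_A0 a b)"

definition HT_N1 :: "real \<Rightarrow> real \<Rightarrow> real \<Rightarrow> real \<Rightarrow> real \<Rightarrow> nat" where
  "HT_N1 a b d1 d2 l = (THE N. HT_lH a b d1 d2 N < l \<and> l \<le> HT_lH a b d1 d2 (N + 1))"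

definition HT_N2 :: "real \<Rightarrow> real \<Rightarrow> real \<Rightarrow> real \<Rightarrow> nat" where
  "HT_N2 a b d1 l = (THE N. HT_lT a b d1 N < l \<and> l \<le> HT_lT a b d1 (N + 1))"

text \<open>\<open>HT_LTT\<close> and \<open>HT_LTH\<close> collect the exceptional lengths for all \<open>N1\<close> and all \<open>N2 \<ge> 1\<close>:
  each \<open>l\<close> is tested with its own \<open>N1(l)\<close> and \<open>N2(l)\<close>.\<close>

definition HT_LTT :: "real \<Rightarrow> real \<Rightarrow> real \<Rightarrow> real \<Rightarrow> real set" where
  "HT_LTT a b d1 d2 =
     {l. HT_N2 a b d1 l \<ge> 1 \<and>
         l \<in> {HT_lT a b d1 (HT_N2 a b d1 l) <.. HT_lT a b d1 (HT_N2 a b d1 l + 1)} \<and>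
         (\<exists>i j. 1 \<le> i \<and> i < j \<and> j \<le> HT_N2 a b d1 l \<and>
            HT_rT a b d1 d2 i l = HT_rT a b d1 d2 j l)}"

definition HT_LTH :: "real \<Rightarrow> real \<Rightarrow> real \<Rightarrow> real \<Rightarrow> real set" where
  "HT_LTH a b d1 d2 =
     {l. HT_N2 a b d1 l \<ge> 1 \<and>
         l \<in> {HT_lH a b d1 d2 (HT_N1 a b d1 d2 l) <.. HT_lH a b d1 d2 (HT_N1 a b d1 d2 l + 1)} \<inter>
             {HT_lT a b d1 (HT_N2 a b d1 l) <.. HT_lT a b d1 (HT_N2 a b d1 l + 1)} \<and>
         (\<exists>i j. i \<le> HT_N1 a b d1 d2 l \<and> HT_N1 a b d1 d2 l < j \<and> j \<le> HT_N2 a b d1 l \<and>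
            HT_rH a b d1 d2 i l = HT_rT a b d1 d2 j l)}"

definition HT_rstar :: "real \<Rightarrow> real \<Rightarrow> real \<Rightarrow> real \<Rightarrow> real \<Rightarrow> real" where
  "HT_rstar a b d1 d2 l = Max ((\<lambda>n. HT_rT a b d1 d2 n l) ` {1..HT_N2 a b d1 l})"


section \<open>The parameter condition for stable bifurcating solutions\<close>

definition HT_bstar :: "real \<Rightarrow> real \<Rightarrow> real" where
  "HT_bstar d1 d2 =
     ((d1 + d2)^2 - sqrt ((d1 + d2)^4 - (d1 - d2)^4))^2 / (d1 - d2)^4"

text \<open>In \<open>HT_apm\<close> and \<open>HT_xpm\<close> the first argument \<open>\<sigma>\<close> is the sign, 1 or \<open>-1\<close>.\<close>

definition HT_apm :: "real \<Rightarrow> real \<Rightarrow> real \<Rightarrow> real \<Rightarrow> real" where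
  "HT_apm \<sigma> b d1 d2 =
     ((1 - b) * (d1 + d2)^4
      + \<sigma> * ((d1 + d2)^2 * sqrt ((b + 1)^2 * (d1 - d2)^4 - 4 * b * (d1 + d2)^4)))
     / ((d1 + d2)^4 - (d1 - d2)^4)"

definition HT_xpm :: "real \<Rightarrow> real \<Rightarrow> real \<Rightarrow> real \<Rightarrow> real \<Rightarrow> real" where
  "HT_xpm \<sigma> a b d1 d2 =
     1 / (2 * d1 * d2) *
       ((d2 - d1) * HT_A0 a b
        + \<sigma> * sqrt ((d1 + d2)^2 * (HT_A0 a b)^2 + 4 * d1 * d2 * HT_A0 a b * HT_B0 a b))"

definition HT_lpm :: "real \<Rightarrow> real \<Rightarrow> real \<Rightarrow> real \<Rightarrow> real \<Rightarrow> nat \<Rightarrow> real" where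
  "HT_lpm \<sigma> a b d1 d2 n = real n / sqrt (HT_xpm \<sigma> a b d1 d2)"

text \<open>No \<open>M\<close> equal to 0 satisfies the description of \<open>HT_M1\<close>, so the truncated
  subtraction is harmless.\<close>

definition HT_M1 :: "real \<Rightarrow> real \<Rightarrow> real \<Rightarrow> real \<Rightarrow> real \<Rightarrow> nat" where
  "HT_M1 a b d1 d2 l =
     (THE M. HT_lpm (-1) a b d1 d2 (M - 1) \<le> l \<and> l < HT_lpm (-1) a b d1 d2 M)"

definition HT_M2 :: "real \<Rightarrow> real \<Rightarrow> real \<Rightarrow> real \<Rightarrow> real \<Rightarrow> nat" where
  "HT_M2 a b d1 d2 l =
     (THE M. HT_lpm 1 a b d1 d2 M < l \<and> l \<le> HT_lpm 1 a b d1 d2 (M + 1))"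

definition HT_A6'' :: "real \<Rightarrow> real \<Rightarrow> real \<Rightarrow> real \<Rightarrow> real \<Rightarrow> bool" where
  "HT_A6'' a b d1 d2 l \<longleftrightarrow>
     d2 > d1 \<and> 0 < b \<and> b < HT_bstar d1 d2 \<and>
     HT_apm (-1) b d1 d2 < a \<and> a < HT_apm 1 b d1 d2 \<and>
     HT_M1 a b d1 d2 l \<le> HT_M2 a b d1 d2 l"

end

theory Submission
  imports Defs
begin

text \<open>
With Neumann conditions on \<open>[0, l\<pi>]\<close>, functions are cosine series, and the linearization of the system at the
constant steady state acts on the \<open>n\<close>-th mode by a \<open>2 \<times> 2\<close> matrix with trace \<open>T\<close> and determinant \<open>D\<close>. The
proof works in the algebra of absolutely convergent cosine series. Products are bounded there, so that the
rational kinetics, expanded exactly to second order, act by Neumann series for \<open>1 / (\<kappa> + p)\<close>. Inverting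
the linear operator mode by mode gains two derivatives, so that fixed points are classical solutions without
further regularity theory. Both halves of the theorem are contraction arguments of this kind.

Bifurcation. At \<open>r = r_n^T\<close> the determinant of the \<open>n\<close>-th mode vanishes. The hypothesis that \<open>l\<close> is not in
\<open>L_TT\<close> makes the other determinants with index between \<open>1\<close> and \<open>N2\<close> nonzero, all remaining ones are
positive, and each determinant is strictly increasing in \<open>r\<close>. Hence the kernel is one-dimensional and transversality holds. Dividing the equation by the amplitude \<open>s\<close>
leaves a fixed point problem for the correction of the eigenfunction and of the parameter, which is a
contraction for small \<open>s\<close> (\<open>turing_solver\<close>, \<open>turing_branch\<close>).

Instability. Suppose that at \<open>r_n^T\<close> some mode has an eigenvalue with positive real part. Then every steady state
near the constant one is unstable (\<open>lyapunov_perron\<close>). Stability is tested on solutions of the evolution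
problem, so such solutions have to be produced: a solution that exists for all negative times, decays like
\<open>exp (\<beta> t)\<close> as \<open>t \<rightarrow> -\<infinity>\<close> and is not zero is obtained as a fixed point, with coefficients in the bounded
functions of time (\<open>hyperbolic_solver\<close>). The given steady state, which may be any small solution, enters
through its cosine expansion (\<open>C2_near_weval\<close>).

Parameters. If stable bifurcating solutions occur at \<open>r_n^T\<close>, no mode can be unstable there. A larger
\<open>r_k^T\<close> would make the determinant of mode \<open>k\<close> negative, so \<open>r_n^T = r_*\<close>. The trace of the homogeneous
mode is \<open>A0 - r\<close>, so \<open>r_n^T \<ge> A0\<close>. Equality would put \<open>l\<close> into \<open>L_TH\<close>, because \<open>r_j^T < r_j^H \<le> A0\<close> for
\<open>j \<le> N1\<close> (\<open>hopf_above_turing\<close>). Finally \<open>r_n^T > A0\<close> is a quadratic inequality for \<open>n\<^sup>2/l\<^sup>2\<close>, and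
its consequences for \<open>d1\<close>, \<open>d2\<close>, \<open>a\<close>, \<open>b\<close> and \<open>l\<close> are condition (A6'') (\<open>A6_from_mode\<close>).
\<close>

section \<open>The even Wiener algebra\<close>

text \<open>A cosine series \<open>f 0 + 2 (f 1 cos x + f 2 cos 2x + \<dots>)\<close> is stored as an even two-sided sequence, because
multiplication of the series is then plain convolution over the integers. The coefficients may lie in any
Banach algebra: real numbers give steady states, bounded functions of time give solutions of the evolution
problem with the norm \<open>\<Sum>n. sup t. \<bar>f n t\<bar>\<close>. Taking the supremum inside the sum is what makes
the inverse of the linearized parabolic operator gain two full space derivatives.\<close>

typedef (overloaded) 'a wiener =
  "{f :: int \<Rightarrow> 'a::real_normed_vector. f abs_summable_on UNIV \<and> (\<forall>n. f (- n) = f n)}"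
  morphisms coef Wiener
  by (rule exI[of _ "\<lambda>_. 0"]) simp

lemma coef_summable: "(\<lambda>n. norm (coef f n)) summable_on UNIV"
  using coef[of f] by simp

lemma coef_minus [simp]: "coef f (- n) = coef f n"
  using coef[of f] by simp

lemma coef_Wiener:
  assumes "(\<lambda>n. norm (f n)) summable_on UNIV" and "\<And>n. f (- n) = f n"
  shows "coef (Wiener f) = f"
  using assms by (simp add: Wiener_inverse)

lemma wiener_eqI: "(\<And>n. coef f n = coef g n) \<Longrightarrow> f = g"
  by (metis coef_inject ext)

instantiation wiener :: (real_normed_vector) real_vector
begin

definition zero_wiener where "zero_wiener = Wiener (\<lambda>n. 0)"
definition plus_wiener where "plus_wiener f g = Wiener (\<lambda>n. coef f n + coef g n)"
definition minus_wiener where "minus_wiener f g = Wiener (\<lambda>n. coef f n - coef g n)"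
definition uminus_wiener where "uminus_wiener f = Wiener (\<lambda>n. - coef f n)"
definition scaleR_wiener where "scaleR_wiener c f = Wiener (\<lambda>n. c *\<^sub>R coef f n)"

lemma summable_norm_add:
  fixes f g :: "int \<Rightarrow> 'a"
  assumes "(\<lambda>n. norm (f n)) summable_on UNIV" "(\<lambda>n. norm (g n)) summable_on UNIV"
  shows "(\<lambda>n. norm (f n + g n)) summable_on UNIV"
proof -
  have "(\<lambda>n. norm (f n) + norm (g n)) summable_on UNIV"
    using assms by (rule summable_on_add)
  then show ?thesis
    by (rule summable_on_comparison_test) (auto intro: norm_triangle_ineq)
qed

lemma coef_zero [simp]: "coef 0 n = (0::'a)"
  unfolding zero_wiener_def by (subst coef_Wiener) auto
lemma coef_add [simp]: "coef (f + g) n = coef f n + (coef g n :: 'a)"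
  unfolding plus_wiener_def
  by (subst coef_Wiener) (auto intro!: summable_norm_add coef_summable)
lemma coef_uminus [simp]: "coef (- f) n = - (coef f n :: 'a)"
  unfolding uminus_wiener_def by (subst coef_Wiener) (auto intro!: coef_summable)
lemma coef_diff [simp]: "coef (f - g) n = coef f n - (coef g n :: 'a)"
  unfolding minus_wiener_def
  using summable_norm_add[OF coef_summable[of f], of "\<lambda>n. - coef g n"] coef_summable[of g]
  by (subst coef_Wiener) auto
lemma coef_scaleR [simp]: "coef (c *\<^sub>R f) n = c *\<^sub>R (coef f n :: 'a)"
  unfolding scaleR_wiener_def
  by (subst coef_Wiener) (auto intro!: coef_summable summable_on_cmult_right)

instance
  by standard (auto intro!: wiener_eqI simp: algebra_simps)

end

instantiation wiener :: (real_normed_vector) real_normed_vector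
begin

definition norm_wiener where "norm_wiener f = (\<Sum>\<^sub>\<infinity>n. norm (coef f n))"
definition dist_wiener where "dist_wiener f g = norm (f - g :: 'a wiener)"
definition sgn_wiener where "sgn_wiener f = inverse (norm f) *\<^sub>R (f :: 'a wiener)"
definition uniformity_wiener :: "('a wiener \<times> 'a wiener) filter"
  where "uniformity_wiener = (INF e\<in>{0 <..}. principal {(x, y). dist x y < e})"
definition open_wiener :: "'a wiener set \<Rightarrow> bool"
  where "open_wiener S = (\<forall>x\<in>S. \<forall>\<^sub>F (x', y) in uniformity. x' = x \<longrightarrow> y \<in> S)"

lemma norm_coef_le: "norm (coef f n) \<le> norm (f :: 'a wiener)"
proof -
  have "infsum (\<lambda>n. norm (coef f n)) {n} \<le> infsum (\<lambda>n. norm (coef f n)) UNIV"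
    by (rule infsum_mono2) (auto intro: coef_summable)
  then show ?thesis by (simp add: norm_wiener_def)
qed

instance
proof
  fix f g :: "'a wiener" and c :: real
  show "norm f = 0 \<longleftrightarrow> f = 0"
    using norm_coef_le[of f] by (auto intro!: wiener_eqI simp: norm_wiener_def)
  have "norm (f + g) \<le> (\<Sum>\<^sub>\<infinity>n. norm (coef f n) + norm (coef g n))"
    unfolding norm_wiener_def
    by (rule infsum_mono)
       (auto intro!: coef_summable summable_on_add norm_triangle_ineq summable_norm_add)
  also have "\<dots> = norm f + norm g"
    unfolding norm_wiener_def by (intro infsum_add coef_summable)
  finally show "norm (f + g) \<le> norm f + norm g" .
  show "norm (c *\<^sub>R f) = \<bar>c\<bar> * norm f"
    unfolding norm_wiener_def
    by (simp add: infsum_cmult_right coef_summable)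
qed (simp_all add: dist_wiener_def sgn_wiener_def uniformity_wiener_def open_wiener_def)

end

lemma sum_norm_coef_le:
  assumes "finite F" shows "(\<Sum>n\<in>F. norm (coef f n)) \<le> norm f"
  unfolding norm_wiener_def
  by (rule finite_sum_le_infsum) (auto intro: coef_summable assms)

text \<open>A uniform bound on the finite partial sums gives membership and the norm estimate at once.\<close>

lemma wiener_of_finite_bounds:
  fixes f :: "int \<Rightarrow> 'a::real_normed_vector"
  assumes "\<And>F. finite F \<Longrightarrow> (\<Sum>n\<in>F. norm (f n)) \<le> C" and "\<And>n. f (- n) = f n"
  shows "coef (Wiener f) = f" and "norm (Wiener f) \<le> C"
proof -
  have s: "(\<lambda>n. norm (f n)) summable_on UNIV"
    by (rule nonneg_bdd_above_summable_on) (auto intro!: bdd_aboveI[of _ C] assms)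
  then show c: "coef (Wiener f) = f"
    by (rule coef_Wiener) (rule assms)
  show "norm (Wiener f) \<le> C"
    unfolding norm_wiener_def c
    by (rule infsum_le_finite_sums) (auto intro: s assms)
qed

instance wiener :: (banach) banach
proof
  fix X :: "nat \<Rightarrow> 'a wiener"
  assume X: "Cauchy X"
  have "Cauchy (\<lambda>i. coef (X i) n)" for n
  proof (rule metric_CauchyI)
    fix e :: real assume "e > 0"
    with X obtain M where "\<forall>i\<ge>M. \<forall>j\<ge>M. dist (X i) (X j) < e"
      using metric_CauchyD by blast
    moreover have "dist (coef (X i) n) (coef (X j) n) < e" if "dist (X i) (X j) < e" for i j
      using norm_coef_le[of "X i - X j" n] that by (simp add: dist_norm)
    ultimately have "\<forall>i\<ge>M. \<forall>j\<ge>M. dist (coef (X i) n) (coef (X j) n) < e"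
      by simp
    then show "\<exists>M. \<forall>i\<ge>M. \<forall>j\<ge>M. dist (coef (X i) n) (coef (X j) n) < e" ..
  qed
  moreover define g where "g n = lim (\<lambda>i. coef (X i) n)" for n
  ultimately have g: "(\<lambda>i. coef (X i) n) \<longlonglongrightarrow> g n" for n
    by (simp add: Cauchy_convergent_iff convergent_LIMSEQ_iff)
  have *: "\<exists>M. \<forall>i\<ge>M. \<forall>F. finite F \<longrightarrow> (\<Sum>n\<in>F. norm (coef (X i) n - g n)) \<le> e" if "e > 0" for e
  proof -
    from X \<open>e > 0\<close> obtain M where M: "\<forall>i\<ge>M. \<forall>j\<ge>M. dist (X i) (X j) < e"
      by (meson metric_CauchyD)
    have "(\<Sum>n\<in>F. norm (coef (X i) n - g n)) \<le> e" if "i \<ge> M" "finite F" for i F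
    proof (rule LIMSEQ_le_const2)
      show "(\<lambda>j. \<Sum>n\<in>F. norm (coef (X i) n - coef (X j) n)) \<longlonglongrightarrow> (\<Sum>n\<in>F. norm (coef (X i) n - g n))"
        by (intro tendsto_intros g)
      have "(\<Sum>n\<in>F. norm (coef (X i) n - coef (X j) n)) \<le> e" if "j \<ge> M" for j
        using sum_norm_coef_le[OF \<open>finite F\<close>, of "X i - X j"] M \<open>i \<ge> M\<close> that
        by (force simp: dist_norm)
      then show "\<exists>N. \<forall>j\<ge>N. (\<Sum>n\<in>F. norm (coef (X i) n - coef (X j) n)) \<le> e" by blast
    qed
    then show ?thesis by blast
  qed
  obtain M where M: "\<And>F. finite F \<Longrightarrow> (\<Sum>n\<in>F. norm (coef (X M) n - g n)) \<le> 1"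
    using *[of 1] by (metis order_refl zero_less_one)
  have even: "g (- n) = g n" for n
    using g[of n] g[of "- n"] LIMSEQ_unique by force
  have "(\<Sum>n\<in>F. norm (g n)) \<le> norm (X M) + 1" if F: "finite F" for F
  proof -
    have "(\<Sum>n\<in>F. norm (g n)) \<le> (\<Sum>n\<in>F. norm (coef (X M) n) + norm (coef (X M) n - g n))"
      by (rule sum_mono) (metis norm_triangle_sub norm_minus_commute)
    also have "\<dots> \<le> norm (X M) + 1"
      using M[OF F] sum_norm_coef_le[OF F, of "X M"] by (simp add: sum.distrib)
    finally show ?thesis .
  qed
  note G = wiener_of_finite_bounds(1)[OF this even]
  have "X \<longlonglongrightarrow> Wiener g"
  proof (rule metric_LIMSEQ_I)
    fix e :: real assume "e > 0"
    then obtain M where M: "\<And>i F. i \<ge> M \<Longrightarrow> finite F \<Longrightarrow> (\<Sum>n\<in>F. norm (coef (X i) n - g n)) \<le> e/2"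
      using *[of "e/2"] by auto
    have "dist (X i) (Wiener g) < e" if "i \<ge> M" for i
    proof -
      have "norm (X i - Wiener g) \<le> e/2"
        unfolding norm_wiener_def
        by (rule infsum_le_finite_sums)
           (use coef_summable[of "X i - Wiener g"] M[OF that] in \<open>auto simp: G\<close>)
      then show ?thesis using \<open>e > 0\<close> by (simp add: dist_norm)
    qed
    then show "\<exists>M. \<forall>i\<ge>M. dist (X i) (Wiener g) < e" by blast
  qed
  then show "convergent X" by (rule convergentI)
qed

lemma bij_int_diff: "bij_betw (\<lambda>n::int. n - m) UNIV UNIV"
  by (rule bij_betwI[of _ _ _ "\<lambda>n. n + m"]) auto

lemma bij_int_minus: "bij_betw (\<lambda>n::int. - n) UNIV UNIV"
  by (rule bij_betwI[of _ _ _ "\<lambda>n. - n"]) auto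

lemma bij_int_diff': "bij_betw (\<lambda>n::int. m - n) UNIV UNIV"
  by (rule bij_betwI[of _ _ _ "\<lambda>n. m - n"]) auto

text \<open>The shear \<open>(m, n) \<mapsto> (m, n - m)\<close> turns the double series of the convolution into a product of two
absolutely convergent series; every rearrangement below rests on this.\<close>

lemma convolution_summable:
  fixes f g :: "int \<Rightarrow> 'a::real_normed_algebra"
  assumes f: "(\<lambda>n. norm (f n)) summable_on UNIV" and g: "(\<lambda>n. norm (g n)) summable_on UNIV"
  shows "(\<lambda>(m, n). norm (f m * g (n - m))) summable_on UNIV \<times> UNIV"
    and "(\<Sum>\<^sub>\<infinity>(m, n)\<in>UNIV \<times> UNIV. norm (f m) * norm (g (n - m)))
       = (\<Sum>\<^sub>\<infinity>n. norm (f n)) * (\<Sum>\<^sub>\<infinity>n. norm (g n))"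
proof -
  have g': "(\<lambda>n. norm (g (n - m))) summable_on UNIV"
      "(\<Sum>\<^sub>\<infinity>n. norm (g (n - m))) = (\<Sum>\<^sub>\<infinity>n. norm (g n))" for m
    using summable_on_reindex_bij_betw[OF bij_int_diff[of m], of "\<lambda>n. norm (g n)"]
      infsum_reindex_bij_betw[OF bij_int_diff[of m], of "\<lambda>n. norm (g n)"] g by auto
  have s: "(\<lambda>(m, n). norm (f m) * norm (g (n - m))) summable_on UNIV \<times> UNIV"
  proof (rule summable_on_SigmaI)
    show "((\<lambda>n. case (m, n) of (m, n) \<Rightarrow> norm (f m) * norm (g (n - m))) has_sum
          norm (f m) * (\<Sum>\<^sub>\<infinity>n. norm (g n))) UNIV" for m
    proof -
      have "((\<lambda>n. norm (g (n - m))) has_sum (\<Sum>\<^sub>\<infinity>n. norm (g n))) UNIV"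
        using has_sum_infsum[OF g'(1)[of m]] unfolding g'(2) .
      from has_sum_cmult_right[OF this, of "norm (f m)"] show ?thesis by simp
    qed
    show "(\<lambda>m. norm (f m) * (\<Sum>\<^sub>\<infinity>n. norm (g n))) summable_on UNIV"
      by (intro summable_on_cmult_left f)
  qed auto
  show "(\<lambda>(m, n). norm (f m * g (n - m))) summable_on UNIV \<times> UNIV"
    by (rule summable_on_comparison_test[OF s]) (auto intro: norm_mult_ineq)
  have "(\<Sum>\<^sub>\<infinity>(m, n)\<in>UNIV \<times> UNIV. norm (f m) * norm (g (n - m)))
      = (\<Sum>\<^sub>\<infinity>m. \<Sum>\<^sub>\<infinity>n. norm (f m) * norm (g (n - m)))"
    using infsum_Sigma'_banach[OF s] by simp
  also have "\<dots> = (\<Sum>\<^sub>\<infinity>m. norm (f m) * (\<Sum>\<^sub>\<infinity>n. norm (g n)))"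
    by (simp add: infsum_cmult_right g')
  also have "\<dots> = (\<Sum>\<^sub>\<infinity>n. norm (f n)) * (\<Sum>\<^sub>\<infinity>n. norm (g n))"
    by (simp add: infsum_cmult_left f)
  finally show "(\<Sum>\<^sub>\<infinity>(m, n)\<in>UNIV \<times> UNIV. norm (f m) * norm (g (n - m)))
       = (\<Sum>\<^sub>\<infinity>n. norm (f n)) * (\<Sum>\<^sub>\<infinity>n. norm (g n))" .
qed

definition conv :: "(int \<Rightarrow> 'a::real_normed_algebra) \<Rightarrow> (int \<Rightarrow> 'a) \<Rightarrow> int \<Rightarrow> 'a" where
  "conv f g n = (\<Sum>\<^sub>\<infinity>m. f m * g (n - m))"

lemma conv_summable:
  fixes f g :: "int \<Rightarrow> 'a::{real_normed_algebra,banach}"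
  assumes f: "(\<lambda>n. norm (f n)) summable_on UNIV" and g: "(\<lambda>n. norm (g n)) summable_on UNIV"
  shows "(\<lambda>m. norm (f m * g (n - m))) summable_on UNIV"
    and "(\<lambda>m. f m * g (n - m)) summable_on UNIV"
    and "(\<lambda>n. norm (conv f g n)) summable_on UNIV"
    and "(\<Sum>\<^sub>\<infinity>n. norm (conv f g n)) \<le> (\<Sum>\<^sub>\<infinity>n. norm (f n)) * (\<Sum>\<^sub>\<infinity>n. norm (g n))"
proof -
  have s: "(\<lambda>(n, m). norm (f m * g (n - m))) summable_on UNIV \<times> UNIV"
    using summable_on_swap[of "\<lambda>(m, n). norm (f m * g (n - m))" UNIV UNIV]
      convolution_summable(1)[OF f g] by simp
  show s1: "(\<lambda>m. norm (f m * g (n - m))) summable_on UNIV" for n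
    using summable_on_SigmaD1[of "\<lambda>n m. norm (f m * g (n - m))" UNIV "\<lambda>_. UNIV" n] s by auto
  show "(\<lambda>m. f m * g (n - m)) summable_on UNIV"
    using abs_summable_summable[OF s1] .
  have s2: "(\<lambda>n. \<Sum>\<^sub>\<infinity>m. norm (f m * g (n - m))) summable_on UNIV"
    using summable_on_Sigma_banach[OF s] by simp
  have le: "norm (conv f g n) \<le> (\<Sum>\<^sub>\<infinity>m. norm (f m * g (n - m)))" for n
    unfolding conv_def by (rule norm_infsum_bound) (rule s1)
  show s3: "(\<lambda>n. norm (conv f g n)) summable_on UNIV"
    by (rule summable_on_comparison_test[OF s2]) (auto intro: le)
  have "(\<Sum>\<^sub>\<infinity>n. norm (conv f g n)) \<le> (\<Sum>\<^sub>\<infinity>n. \<Sum>\<^sub>\<infinity>m. norm (f m * g (n - m)))"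
    by (rule infsum_mono[OF s3 s2]) (rule le)
  also have "\<dots> = (\<Sum>\<^sub>\<infinity>m. \<Sum>\<^sub>\<infinity>n. norm (f m * g (n - m)))"
    by (rule infsum_swap_banach) (use s in simp)
  also have "\<dots> = (\<Sum>\<^sub>\<infinity>(m, n)\<in>UNIV \<times> UNIV. norm (f m * g (n - m)))"
    using infsum_Sigma'_banach[OF convolution_summable(1)[OF f g]] by simp
  also have "\<dots> \<le> (\<Sum>\<^sub>\<infinity>(m, n)\<in>UNIV \<times> UNIV. norm (f m) * norm (g (n - m)))"
  proof (rule infsum_mono)
    show "(\<lambda>(m, n). norm (f m) * norm (g (n - m))) summable_on UNIV \<times> UNIV"
      using convolution_summable(1)[of "\<lambda>n. norm (f n)" "\<lambda>n. norm (g n)"] f g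
      by (simp add: norm_mult)
    show "(\<lambda>(m, n). norm (f m * g (n - m))) summable_on UNIV \<times> UNIV"
      by (rule convolution_summable(1)[OF f g])
    show "(case x of (m, n) \<Rightarrow> norm (f m * g (n - m))) \<le> (case x of (m, n) \<Rightarrow> norm (f m) * norm (g (n - m)))"
      for x by (cases x) (simp add: norm_mult_ineq)
  qed
  also have "\<dots> = (\<Sum>\<^sub>\<infinity>n. norm (f n)) * (\<Sum>\<^sub>\<infinity>n. norm (g n))"
    by (rule convolution_summable(2)[OF f g])
  finally show "(\<Sum>\<^sub>\<infinity>n. norm (conv f g n)) \<le> (\<Sum>\<^sub>\<infinity>n. norm (f n)) * (\<Sum>\<^sub>\<infinity>n. norm (g n))" .
qed

lemma conv_commute:
  fixes f g :: "int \<Rightarrow> 'a::{real_normed_algebra,banach,comm_ring}"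
  shows "conv f g n = conv g f n"
  unfolding conv_def
  using infsum_reindex_bij_betw[OF bij_int_diff'[of n], of "\<lambda>m. f m * g (n - m)"]
  by (simp add: mult.commute)

lemma conv_even:
  fixes f g :: "int \<Rightarrow> 'a::{real_normed_algebra,banach}"
  assumes "\<And>n. f (- n) = f n" "\<And>n. g (- n) = g n"
  shows "conv f g (- n) = conv f g n"
proof -
  have "conv f g (- n) = (\<Sum>\<^sub>\<infinity>m. f (- m) * g (- n - (- m)))"
    unfolding conv_def
    using infsum_reindex_bij_betw[OF bij_int_minus, of "\<lambda>m. f m * g (- n - m)"] by simp
  also have "\<dots> = (\<Sum>\<^sub>\<infinity>m. f m * g (n - m))"
    using assms(2)[of "n - m" for m] by (simp add: assms(1))
  finally show ?thesis by (simp add: conv_def)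
qed

lemma conv_assoc:
  fixes f g h :: "int \<Rightarrow> 'a::{real_normed_algebra,banach}"
  assumes f: "(\<lambda>n. norm (f n)) summable_on UNIV" and g: "(\<lambda>n. norm (g n)) summable_on UNIV"
    and h: "(\<lambda>n. norm (h n)) summable_on UNIV"
  shows "conv (conv f g) h n = conv f (conv g h) n"
proof -
  let ?F = "\<lambda>m k. f k * g (m - k) * h (n - m)"
  have s: "(\<lambda>(m, k). norm (?F m k)) summable_on UNIV \<times> UNIV"
  proof -
    have s1: "(\<lambda>(m, k). norm (f k * g (m - k))) summable_on UNIV \<times> UNIV"
      using summable_on_swap[of "\<lambda>(m, n). norm (f m * g (n - m))" UNIV UNIV]
        convolution_summable(1)[OF f g] by simp
    define H where "H = (\<Sum>\<^sub>\<infinity>n. norm (h n))"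
    have H: "norm (h n) \<le> H" for n
      using finite_sum_le_infsum[OF h, of "{n}"] by (simp add: H_def)
    have "(\<lambda>x. (case x of (m, k) \<Rightarrow> norm (f k * g (m - k))) * H) summable_on UNIV \<times> UNIV"
      by (rule summable_on_cmult_left[OF s1])
    then show ?thesis
    proof (rule summable_on_comparison_test)
      fix x :: "int \<times> int"
      obtain m k where [simp]: "x = (m, k)" by force
      have "norm (?F m k) \<le> norm (f k * g (m - k)) * norm (h (n - m))" by (rule norm_mult_ineq)
      also have "\<dots> \<le> norm (f k * g (m - k)) * H" by (intro mult_left_mono H) auto
      finally show "(case x of (m, k) \<Rightarrow> norm (?F m k)) \<le> (case x of (m, k) \<Rightarrow> norm (f k * g (m - k))) * H"
        by simp
    qed auto
  qed
  have "conv (conv f g) h n = (\<Sum>\<^sub>\<infinity>m. \<Sum>\<^sub>\<infinity>k. ?F m k)"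
    unfolding conv_def by (intro infsum_cong infsum_cmult_left[symmetric] conv_summable(2) f g)
  also have "\<dots> = (\<Sum>\<^sub>\<infinity>k. \<Sum>\<^sub>\<infinity>m. ?F m k)"
    by (rule infsum_swap_banach, rule abs_summable_summable)
       (use s in \<open>simp add: case_prod_unfold\<close>)
  also have "\<dots> = (\<Sum>\<^sub>\<infinity>k. \<Sum>\<^sub>\<infinity>m. f k * (g m * h (n - k - m)))"
  proof (rule infsum_cong)
    fix k
    show "(\<Sum>\<^sub>\<infinity>m. ?F m k) = (\<Sum>\<^sub>\<infinity>m. f k * (g m * h (n - k - m)))"
      using infsum_reindex_bij_betw[OF bij_int_diff[of k], of "\<lambda>m. f k * (g m * h (n - k - m))"]
      by (simp add: mult.assoc)
  qed
  also have "\<dots> = conv f (conv g h) n"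
    unfolding conv_def by (intro infsum_cong infsum_cmult_right conv_summable(2) g h)
  finally show ?thesis .
qed

instantiation wiener :: ("{real_normed_algebra_1,banach,comm_ring_1}") comm_ring_1
begin

definition times_wiener :: "'a wiener \<Rightarrow> 'a wiener \<Rightarrow> 'a wiener" where
  "times_wiener f g = Wiener (conv (coef f) (coef g))"
definition one_wiener :: "'a wiener" where
  "one_wiener = Wiener (\<lambda>n. if n = 0 then 1 else 0)"

lemma coef_mult: "coef (f * g) = conv (coef f) (coef (g :: 'a wiener))"
  unfolding times_wiener_def
  by (rule coef_Wiener) (intro conv_summable coef_summable conv_even coef_minus)+

lemma coef_one: "coef 1 n = (if n = 0 then 1 else (0::'a))"
proof -
  have "(\<lambda>n::int. norm (if n = 0 then 1 else (0::'a))) summable_on UNIV"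
    by (subst summable_on_cong_neutral[of "{0}" UNIV]) auto
  then show ?thesis unfolding one_wiener_def by (subst coef_Wiener) auto
qed

instance
proof
  fix f g h :: "'a wiener"
  show "f * g * h = f * (g * h)"
    by (intro wiener_eqI) (simp add: coef_mult conv_assoc coef_summable)
  show "f * g = g * f"
    by (intro wiener_eqI) (simp add: coef_mult conv_commute)
  show "1 * f = f"
  proof (rule wiener_eqI)
    fix n
    have "conv (coef 1) (coef f) n = (\<Sum>\<^sub>\<infinity>m\<in>{0}. coef 1 m * coef f (n - m))"
      unfolding conv_def by (rule infsum_cong_neutral) (auto simp: coef_one)
    then show "coef (1 * f) n = coef f n" by (simp add: coef_mult coef_one)
  qed
  show "(f + g) * h = f * h + g * h"
    by (intro wiener_eqI)
       (simp add: coef_mult conv_def ring_distribs infsum_add conv_summable(2) coef_summable)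
  have "coef (0 :: 'a wiener) 0 \<noteq> coef 1 0" by (simp add: coef_one)
  then show "(0 :: 'a wiener) \<noteq> 1" by metis
qed

end

instance wiener :: ("{real_normed_algebra_1,banach,comm_ring_1}") real_normed_algebra_1
proof
  fix f g :: "'a wiener" and c :: real
  show "c *\<^sub>R f * g = c *\<^sub>R (f * g)"
    by (intro wiener_eqI)
       (simp add: coef_mult conv_def infsum_scaleR_right conv_summable(2) coef_summable)
  then show "f * c *\<^sub>R g = c *\<^sub>R (f * g)"
    by (intro wiener_eqI)
       (simp add: coef_mult conv_def infsum_scaleR_right conv_summable(2) coef_summable)
  show "norm (f * g) \<le> norm f * norm g"
    unfolding norm_wiener_def coef_mult by (intro conv_summable coef_summable)
  have "norm (1 :: 'a wiener) = (\<Sum>\<^sub>\<infinity>n\<in>{0::int}. norm (1::'a))"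
    unfolding norm_wiener_def by (rule infsum_cong_neutral) (auto simp: coef_one)
  then show "norm (1 :: 'a wiener) = 1" by simp
qed

section \<open>Evaluation of cosine series\<close>

lemma infsum_continuous_on:
  fixes F :: "'i \<Rightarrow> 'b::topological_space \<Rightarrow> 'c::banach"
  assumes "\<And>n. continuous_on S (F n)" and "\<And>n x. x \<in> S \<Longrightarrow> norm (F n x) \<le> M n"
    and "M summable_on UNIV"
  shows "continuous_on S (\<lambda>x. \<Sum>\<^sub>\<infinity>n. F n x)"
proof (rule uniform_limit_theorem)
  show "uniform_limit S (\<lambda>X x. \<Sum>n\<in>X. F n x) (\<lambda>x. \<Sum>\<^sub>\<infinity>n. F n x) (finite_subsets_at_top UNIV)"
    by (rule Weierstrass_m_test_general) (use assms in auto)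
qed (auto intro!: always_eventually continuous_on_sum assms)

lemma infsum_int_sums:
  fixes f :: "int \<Rightarrow> real"
  assumes "f summable_on UNIV"
  shows "(\<lambda>k. f (int_decode k)) sums (\<Sum>\<^sub>\<infinity>n. f n)"
proof -
  have "(f has_sum (\<Sum>\<^sub>\<infinity>n. f n)) UNIV" by (rule has_sum_infsum[OF assms])
  then have "((\<lambda>k. f (int_decode k)) has_sum (\<Sum>\<^sub>\<infinity>n. f n)) UNIV"
    using has_sum_reindex_bij_betw[OF bij_int_decode, of f] by simp
  then show ?thesis by (rule has_sum_imp_sums)
qed

lemma summable_int_decode:
  fixes f :: "int \<Rightarrow> real"
  assumes "f summable_on UNIV"
  shows "summable (\<lambda>k. f (int_decode k))"
  using infsum_int_sums[OF assms] by (rule sums_summable)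

text \<open>Termwise differentiation is available for sequences; the integers are enumerated by \<open>int_decode\<close>,
which is harmless since all series converge absolutely.\<close>

lemma infsum_has_real_derivative:
  fixes F F' :: "int \<Rightarrow> real \<Rightarrow> real"
  assumes S: "convex S" "open S" and x: "x \<in> S"
    and F: "\<And>n x. x \<in> S \<Longrightarrow> (F n has_real_derivative F' n x) (at x)"
    and F': "\<And>n x. x \<in> S \<Longrightarrow> \<bar>F' n x\<bar> \<le> M n" and M: "M summable_on UNIV"
    and sF: "\<And>x. x \<in> S \<Longrightarrow> (\<lambda>n. F n x) summable_on UNIV"
  shows "((\<lambda>x. \<Sum>\<^sub>\<infinity>n. F n x) has_real_derivative (\<Sum>\<^sub>\<infinity>n. F' n x)) (at x)"
proof -
  have sF': "(\<lambda>n. F' n x) summable_on UNIV" if "x \<in> S" for x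
    by (rule abs_summable_summable, rule summable_on_comparison_test[OF M]) (use F' that in auto)
  have *: "((\<lambda>x. \<Sum>k. F (int_decode k) x) has_real_derivative (\<Sum>k. F' (int_decode k) x)) (at x)"
  proof (rule has_field_derivative_series'(2)[OF S(1) _ _ x])
    show "(F (int_decode k) has_real_derivative F' (int_decode k) x) (at x within S)" if "x \<in> S" for k x
      using F[OF that] by (rule has_field_derivative_at_within)
    show "uniformly_convergent_on S (\<lambda>n x. \<Sum>i<n. F' (int_decode i) x)"
      by (rule Weierstrass_m_test'[OF _ summable_int_decode[OF M]]) (use F' in auto)
    show "summable (\<lambda>k. F (int_decode k) x)"
      by (rule summable_int_decode[OF sF[OF x]])
    show "x \<in> interior S" using S x by (simp add: interior_open)
  qed
  have "((\<lambda>x. \<Sum>\<^sub>\<infinity>n. F n x) has_real_derivative (\<Sum>k. F' (int_decode k) x)) (at x)"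
    by (rule has_field_derivative_transform_within_open[OF * S(2) x])
       (use infsum_int_sums[OF sF] in \<open>auto simp: sums_iff\<close>)
  then show ?thesis
    using infsum_int_sums[OF sF'[OF x]] by (simp add: sums_iff)
qed

definition weval :: "'a::banach wiener \<Rightarrow> real \<Rightarrow> 'a" where
  "weval f x = (\<Sum>\<^sub>\<infinity>n. cos (of_int n * x) *\<^sub>R coef f n)"

lemma norm_bounded_scaleR: "\<bar>c\<bar> \<le> 1 \<Longrightarrow> norm (c *\<^sub>R a) \<le> norm (a::'a::real_normed_vector)"
  by (simp add: mult_left_le_one_le)

lemma bounded_scaleR_summable:
  fixes f :: "int \<Rightarrow> 'a::banach"
  assumes "(\<lambda>n. norm (f n)) summable_on UNIV" "\<And>n. \<bar>c n\<bar> \<le> 1"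
  shows "(\<lambda>n. norm (c n *\<^sub>R f n)) summable_on UNIV" "(\<lambda>n. c n *\<^sub>R f n) summable_on UNIV"
proof -
  show "(\<lambda>n. norm (c n *\<^sub>R f n)) summable_on UNIV"
    by (rule summable_on_comparison_test[OF assms(1)])
       (auto intro: norm_bounded_scaleR assms simp del: norm_scaleR)
  then show "(\<lambda>n. c n *\<^sub>R f n) summable_on UNIV" by (rule abs_summable_summable)
qed

lemmas weval_summable = bounded_scaleR_summable[OF coef_summable abs_cos_le_one]

lemma norm_weval_le: "norm (weval f x) \<le> norm f"
proof -
  have "norm (weval f x) \<le> (\<Sum>\<^sub>\<infinity>n. norm (cos (of_int n * x) *\<^sub>R coef f n))"
    unfolding weval_def by (rule norm_infsum_bound) (rule weval_summable)
  also have "\<dots> \<le> norm f"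
    unfolding norm_wiener_def
    by (rule infsum_mono[OF weval_summable(1) coef_summable])
       (auto intro: norm_bounded_scaleR simp del: norm_scaleR)
  finally show ?thesis .
qed

lemma weval_add: "weval (f + g) x = weval f x + weval g x"
  unfolding weval_def by (simp add: scaleR_add_right infsum_add weval_summable)

lemma weval_scaleR: "weval (c *\<^sub>R f) x = c *\<^sub>R weval f x"
proof -
  have "weval (c *\<^sub>R f) x = (\<Sum>\<^sub>\<infinity>n. c *\<^sub>R (cos (of_int n * x) *\<^sub>R coef f n))"
    unfolding weval_def by (simp add: mult.commute)
  also have "\<dots> = c *\<^sub>R weval f x"
    unfolding weval_def by (rule infsum_scaleR_right)
  finally show ?thesis .
qed

lemma weval_zero [simp]: "weval 0 x = 0"
  unfolding weval_def by simp

lemma weval_minus: "weval (- f) x = - weval f x"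
  using weval_scaleR[of "-1" f x] by simp

lemma weval_diff: "weval (f - g) x = weval f x - weval g x"
  using weval_add[of f "- g" x] by (simp add: weval_minus)

lemma weval_one: "weval (1 :: 'a::{real_normed_algebra_1,banach,comm_ring_1} wiener) x = 1"
proof -
  have "weval (1 :: 'a wiener) x = (\<Sum>\<^sub>\<infinity>n\<in>{0::int}. 1)"
    unfolding weval_def by (rule infsum_cong_neutral) (auto simp: coef_one)
  then show ?thesis by simp
qed

lemma infsum_odd:
  fixes f :: "int \<Rightarrow> 'a::banach"
  assumes "\<And>n. f (- n) = - f n"
  shows "(\<Sum>\<^sub>\<infinity>n. f n) = 0"
proof -
  have "(\<Sum>\<^sub>\<infinity>n. f n) = (\<Sum>\<^sub>\<infinity>n. f (- n))"
    using infsum_reindex_bij_betw[OF bij_int_minus, of f] by simp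
  also have "\<dots> = - (\<Sum>\<^sub>\<infinity>n. f n)" by (simp add: assms infsum_uminus)
  finally have "(2::real) *\<^sub>R (\<Sum>\<^sub>\<infinity>n. f n) = 0"
    by (simp add: scaleR_2 eq_neg_iff_add_eq_0)
  then show ?thesis by simp
qed

text \<open>Evaluation at a point is multiplicative: \<open>cos ((m + k) x) = cos (m x) cos (k x) - sin (m x) sin (k x)\<close>,
and the sine part sums to zero over \<open>k\<close> because the coefficients are even. This is how identities
in the algebra become pointwise identities.\<close>

lemma weval_mult:
  fixes f g :: "'a::{real_normed_algebra_1,banach,comm_ring_1} wiener"
  shows "weval (f * g) x = weval f x * weval g x"
proof -
  let ?c = "\<lambda>n::int. cos (of_int n * x)" and ?s = "\<lambda>n::int. sin (of_int n * x)"
  have "(\<lambda>(m, n). norm (coef f m * coef g (n - m))) summable_on UNIV \<times> UNIV"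
    by (intro convolution_summable coef_summable)
  then have "(\<lambda>(n, m). norm (coef f m * coef g (n - m))) summable_on UNIV \<times> UNIV"
    using summable_on_swap[of "\<lambda>(m, n). norm (coef f m * coef g (n - m))" UNIV UNIV] by simp
  then have s0: "(\<lambda>(n, m). norm (?c n *\<^sub>R (coef f m * coef g (n - m)))) summable_on UNIV \<times> UNIV"
    by (rule summable_on_comparison_test)
       (clarsimp simp del: norm_scaleR, intro norm_bounded_scaleR, auto)
  have s: "(\<lambda>(n, m). ?c n *\<^sub>R (coef f m * coef g (n - m))) summable_on UNIV \<times> UNIV"
    by (rule abs_summable_summable) (use s0 in \<open>simp add: case_prod_unfold\<close>)
  have "weval (f * g) x = (\<Sum>\<^sub>\<infinity>n. \<Sum>\<^sub>\<infinity>m. ?c n *\<^sub>R (coef f m * coef g (n - m)))"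
    unfolding weval_def coef_mult conv_def
    by (intro infsum_cong infsum_scaleR_right[symmetric] disjI1 conv_summable(2) coef_summable)
  also have "\<dots> = (\<Sum>\<^sub>\<infinity>m. \<Sum>\<^sub>\<infinity>n. ?c n *\<^sub>R (coef f m * coef g (n - m)))"
    by (rule infsum_swap_banach[OF s])
  also have "\<dots> = (\<Sum>\<^sub>\<infinity>m. (?c m *\<^sub>R coef f m) * weval g x)"
  proof (rule infsum_cong)
    fix m
    have "(\<Sum>\<^sub>\<infinity>n. ?c n *\<^sub>R (coef f m * coef g (n - m)))
        = (\<Sum>\<^sub>\<infinity>k. ?c (k + m) *\<^sub>R (coef f m * coef g k))"
      using infsum_reindex_bij_betw[OF bij_int_diff[of m], of "\<lambda>k. ?c (k + m) *\<^sub>R (coef f m * coef g k)"]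
      by simp
    also have "\<dots> = (\<Sum>\<^sub>\<infinity>k. (?c m *\<^sub>R coef f m) * (?c k *\<^sub>R coef g k)
                      - (?s m *\<^sub>R coef f m) * (?s k *\<^sub>R coef g k))"
    proof (rule infsum_cong)
      fix k
      have "?c (k + m) = ?c m * ?c k - ?s m * ?s k"
        by (simp add: cos_add distrib_right)
      then show "?c (k + m) *\<^sub>R (coef f m * coef g k) = (?c m *\<^sub>R coef f m) * (?c k *\<^sub>R coef g k)
                      - (?s m *\<^sub>R coef f m) * (?s k *\<^sub>R coef g k)"
        by (simp only: scaleR_diff_left mult_scaleR_left mult_scaleR_right scaleR_scaleR)
           (simp add: mult.commute)
    qed
    also have "\<dots> = (\<Sum>\<^sub>\<infinity>k. (?c m *\<^sub>R coef f m) * (?c k *\<^sub>R coef g k))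
                   - (\<Sum>\<^sub>\<infinity>k. (?s m *\<^sub>R coef f m) * (?s k *\<^sub>R coef g k))"
      unfolding diff_conv_add_uminus infsum_uminus[symmetric]
      by (intro infsum_add summable_on_uminus[THEN iffD2] summable_on_cmult_right weval_summable
          bounded_scaleR_summable[OF coef_summable abs_sin_le_one])
    also have "(\<Sum>\<^sub>\<infinity>k. (?s m *\<^sub>R coef f m) * (?s k *\<^sub>R coef g k)) = 0"
      by (rule infsum_odd) simp
    also have "(\<Sum>\<^sub>\<infinity>k. (?c m *\<^sub>R coef f m) * (?c k *\<^sub>R coef g k)) = (?c m *\<^sub>R coef f m) * weval g x"
      unfolding weval_def by (intro infsum_cmult_right weval_summable)
    finally show "(\<Sum>\<^sub>\<infinity>n. ?c n *\<^sub>R (coef f m * coef g (n - m))) = (?c m *\<^sub>R coef f m) * weval g x"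
      by simp
  qed
  also have "\<dots> = weval f x * weval g x"
    unfolding weval_def by (intro infsum_cmult_left weval_summable)
  finally show ?thesis .
qed

lemma continuous_on_weval: "continuous_on S (weval f)"
  unfolding weval_def
  by (rule infsum_continuous_on[where M = "\<lambda>n. norm (coef f n)"])
     (auto intro!: continuous_intros coef_summable norm_bounded_scaleR simp del: norm_scaleR)

text \<open>Summability of \<open>n\<^sup>2 \<bar>f n\<bar>\<close> suffices for a classical second derivative.\<close>

definition C2coef :: "'a::banach wiener \<Rightarrow> bool" where
  "C2coef f \<longleftrightarrow> (\<lambda>n. (of_int n)\<^sup>2 * norm (coef f n)) summable_on UNIV"

definition laplace :: "'a::banach wiener \<Rightarrow> 'a wiener" where
  "laplace f = Wiener (\<lambda>n. - (of_int n)\<^sup>2 *\<^sub>R coef f n)"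

lemma coef_laplace: "C2coef f \<Longrightarrow> coef (laplace f) n = - (of_int n)\<^sup>2 *\<^sub>R coef f n"
  unfolding laplace_def C2coef_def by (subst coef_Wiener) auto

definition wsin :: "real wiener \<Rightarrow> real \<Rightarrow> real" where
  "wsin f x = (\<Sum>\<^sub>\<infinity>n. - (of_int n * sin (of_int n * x)) * coef f n)"

lemma abs_int_le_square: "\<bar>of_int n :: real\<bar> \<le> (of_int n)\<^sup>2"
proof (cases "n = 0")
  case False
  then have "1 \<le> \<bar>of_int n :: real\<bar>" by linarith
  then have "\<bar>of_int n :: real\<bar> * 1 \<le> \<bar>of_int n\<bar> * \<bar>of_int n\<bar>" by (intro mult_left_mono) auto
  then show ?thesis by (simp add: power2_eq_square)
qed auto

lemma wsin_term_le: "\<bar>- (of_int n * sin (of_int n * x)) * c\<bar> \<le> (of_int n)\<^sup>2 * \<bar>c::real\<bar>"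
proof -
  have "\<bar>of_int n :: real\<bar> * \<bar>sin (of_int n * x)\<bar> \<le> (of_int n)\<^sup>2 * 1"
    by (intro mult_mono abs_int_le_square) auto
  then show ?thesis by (simp add: abs_mult mult_right_mono)
qed

lemma weval_derivatives:
  fixes f :: "real wiener"
  assumes "C2coef f"
  shows "(weval f has_real_derivative wsin f x) (at x)"
    and "(wsin f has_real_derivative weval (laplace f) x) (at x)"
    and "\<bar>wsin f x\<bar> \<le> norm (laplace f)"
    and "wsin f 0 = 0" and "wsin f pi = 0"
proof -
  have s: "(\<lambda>n. (of_int n)\<^sup>2 * \<bar>coef f n\<bar>) summable_on UNIV"
    using assms by (simp add: C2coef_def)
  have s1: "(\<lambda>n. \<bar>- (of_int n * sin (of_int n * x)) * coef f n\<bar>) summable_on UNIV" for x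
    by (rule summable_on_comparison_test[OF s]) (use wsin_term_le in auto)
  have s2: "(\<lambda>n. - (of_int n * sin (of_int n * x)) * coef f n) summable_on UNIV" for x
    by (rule abs_summable_summable) (use s1[of x] in simp)
  show "(weval f has_real_derivative wsin f x) (at x)"
    unfolding weval_def[abs_def] wsin_def[abs_def]
  proof (rule infsum_has_real_derivative[where S = UNIV and M = "\<lambda>n. (of_int n)\<^sup>2 * \<bar>coef f n\<bar>"])
    fix n y
    show "((\<lambda>x. cos (of_int n * x) *\<^sub>R coef f n) has_real_derivative
       - (of_int n * sin (of_int n * y)) * coef f n) (at y)"
      by (auto intro!: derivative_eq_intros)
  qed (simp_all only: wsin_term_le weval_summable(2) s convex_UNIV open_UNIV UNIV_I)
  have "((\<lambda>x. \<Sum>\<^sub>\<infinity>n. - (of_int n * sin (of_int n * x)) * coef f n) has_real_derivative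
      (\<Sum>\<^sub>\<infinity>n. cos (of_int n * x) *\<^sub>R coef (laplace f) n)) (at x)"
  proof (rule infsum_has_real_derivative[where S = UNIV and M = "\<lambda>n. (of_int n)\<^sup>2 * \<bar>coef f n\<bar>"])
    fix n y
    show "((\<lambda>x. - (of_int n * sin (of_int n * x)) * coef f n) has_real_derivative
       cos (of_int n * y) *\<^sub>R coef (laplace f) n) (at y)"
      by (auto intro!: derivative_eq_intros simp: coef_laplace[OF assms] power2_eq_square)
    have "\<bar>cos (of_int n * y)\<bar> * ((of_int n)\<^sup>2 * \<bar>coef f n\<bar>) \<le> 1 * ((of_int n)\<^sup>2 * \<bar>coef f n\<bar>)"
      by (intro mult_right_mono) auto
    then show "\<bar>cos (of_int n * y) *\<^sub>R coef (laplace f) n\<bar> \<le> (of_int n)\<^sup>2 * \<bar>coef f n\<bar>"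
      by (simp add: coef_laplace[OF assms] abs_mult)
  qed (use s s2 in auto)
  then show "(wsin f has_real_derivative weval (laplace f) x) (at x)"
    unfolding weval_def wsin_def[abs_def] .
  have "\<bar>wsin f x\<bar> \<le> (\<Sum>\<^sub>\<infinity>n. \<bar>- (of_int n * sin (of_int n * x)) * coef f n\<bar>)"
    unfolding wsin_def real_norm_def[symmetric] by (rule norm_infsum_bound) (use s1 in simp)
  also have "\<dots> \<le> norm (laplace f)"
    unfolding norm_wiener_def
    by (rule infsum_mono[OF s1 coef_summable])
       (use wsin_term_le in \<open>auto simp: coef_laplace[OF assms] abs_mult\<close>)
  finally show "\<bar>wsin f x\<bar> \<le> norm (laplace f)" .
  show "wsin f 0 = 0" by (simp add: wsin_def)
  have "sin (of_int n * pi) = 0" for n :: int by (simp add: sin_zero_iff_int2)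
  then show "wsin f pi = 0" by (simp add: wsin_def)
qed

lemma ddx_eqI:
  assumes "l > 0" "x \<in> {0..l * pi}" "(f has_real_derivative D) (at x within {0..l * pi})"
  shows "ddx l f x = D"
  unfolding ddx_def
  by (rule vector_derivative_within_closed_interval[of 0 "l * pi"])
     (use assms in \<open>auto simp: has_real_derivative_iff_has_vector_derivative\<close>)

lemma neumann_C2I:
  assumes l: "l > 0"
    and 1: "\<And>x. x \<in> {0..l * pi} \<Longrightarrow> (f has_real_derivative f' x) (at x within {0..l * pi})"
    and 2: "\<And>x. x \<in> {0..l * pi} \<Longrightarrow> (f' has_real_derivative f'' x) (at x within {0..l * pi})"
    and 3: "continuous_on {0..l * pi} f''" "f' 0 = 0" "f' (l * pi) = 0"
  shows "neumann_C2 l f" and "\<And>x. x \<in> {0..l * pi} \<Longrightarrow> ddx l f x = f' x"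
    and "\<And>x. x \<in> {0..l * pi} \<Longrightarrow> ddx l (ddx l f) x = f'' x"
proof -
  show d1: "ddx l f x = f' x" if "x \<in> {0..l * pi}" for x
    using ddx_eqI[OF l that 1[OF that]] .
  have D2: "(ddx l f has_real_derivative f'' x) (at x within {0..l * pi})" if "x \<in> {0..l * pi}" for x
    by (rule has_field_derivative_transform_within[OF 2[OF that] zero_less_one that]) (simp add: d1)
  show d2: "ddx l (ddx l f) x = f'' x" if "x \<in> {0..l * pi}" for x
    using ddx_eqI[OF l that D2[OF that]] .
  have "continuous_on {0..l * pi} (ddx l (ddx l f))"
    using 3(1) by (subst continuous_on_cong[OF refl d2]) auto
  moreover have "ddx l f 0 = 0" "ddx l f (l * pi) = 0" using d1 3 l by auto
  moreover have "f differentiable_on {0..l * pi}" "ddx l f differentiable_on {0..l * pi}"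
    unfolding differentiable_on_def real_differentiable_def using 1 D2 by blast+
  ultimately show "neumann_C2 l f"
    unfolding neumann_C2_def by blast
qed

lemma neumann_C2D:
  assumes "l > 0" "neumann_C2 l f" "x \<in> {0..l * pi}"
  shows "(f has_real_derivative ddx l f x) (at x within {0..l * pi})"
    and "(ddx l f has_real_derivative ddx l (ddx l f) x) (at x within {0..l * pi})"
proof -
  have *: "(g has_real_derivative ddx l g x) (at x within {0..l * pi})"
    if "g differentiable_on {0..l * pi}" for g
  proof -
    have "g differentiable (at x within {0..l * pi})"
      using that assms(3) by (simp add: differentiable_on_def)
    then obtain D where "(g has_real_derivative D) (at x within {0..l * pi})"
      by (auto simp: real_differentiable_def)
    with ddx_eqI[OF assms(1,3) this] show ?thesis by simp
  qed
  show "(f has_real_derivative ddx l f x) (at x within {0..l * pi})"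
       "(ddx l f has_real_derivative ddx l (ddx l f) x) (at x within {0..l * pi})"
    using assms(2) by (auto intro!: * simp: neumann_C2_def)
qed

lemma neumann_C2_add:
  assumes l: "l > 0" and f: "neumann_C2 l f" and g: "neumann_C2 l g"
  shows "neumann_C2 l (\<lambda>x. f x + g x)"
    and "\<And>x. x \<in> {0..l * pi} \<Longrightarrow> ddx l (\<lambda>x. f x + g x) x = ddx l f x + ddx l g x"
    and "\<And>x. x \<in> {0..l * pi} \<Longrightarrow>
      ddx l (ddx l (\<lambda>x. f x + g x)) x = ddx l (ddx l f) x + ddx l (ddx l g) x"
proof -
  have *: "continuous_on {0..l * pi} (\<lambda>x. ddx l (ddx l f) x + ddx l (ddx l g) x)"
     "ddx l f 0 + ddx l g 0 = 0" "ddx l f (l * pi) + ddx l g (l * pi) = 0"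
    using f g unfolding neumann_C2_def by (auto intro!: continuous_intros)
  note D = neumann_C2I[OF l, of "\<lambda>x. f x + g x" "\<lambda>x. ddx l f x + ddx l g x",
      OF DERIV_add[OF neumann_C2D(1)[OF l f] neumann_C2D(1)[OF l g]]
         DERIV_add[OF neumann_C2D(2)[OF l f] neumann_C2D(2)[OF l g]] *]
  show "neumann_C2 l (\<lambda>x. f x + g x)" by (rule D(1))
  show "ddx l (\<lambda>x. f x + g x) x = ddx l f x + ddx l g x" if "x \<in> {0..l * pi}" for x
    by (rule D(2)) (use that in auto)
  show "ddx l (ddx l (\<lambda>x. f x + g x)) x = ddx l (ddx l f) x + ddx l (ddx l g) x"
    if "x \<in> {0..l * pi}" for x
    by (rule D(3)) (use that in auto)
qed

lemma neumann_C2_const: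
  assumes l: "l > 0"
  shows "neumann_C2 l (\<lambda>_. c)" and "\<And>x. x \<in> {0..l * pi} \<Longrightarrow> ddx l (\<lambda>_. c) x = 0"
    and "\<And>x. x \<in> {0..l * pi} \<Longrightarrow> ddx l (ddx l (\<lambda>_. c)) x = 0"
  using neumann_C2I[OF l, of "\<lambda>_. c" "\<lambda>_. 0" "\<lambda>_. 0"] by auto

text \<open>A cosine series satisfies the Neumann conditions automatically.\<close>

lemma neumann_C2_weval:
  assumes l: "l > 0" and f: "C2coef f"
  shows "neumann_C2 l (\<lambda>x. weval f (x / l))"
    and "\<And>x. x \<in> {0..l * pi} \<Longrightarrow> ddx l (\<lambda>x. weval f (x / l)) x = wsin f (x / l) / l"
    and "\<And>x. x \<in> {0..l * pi} \<Longrightarrow>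
      ddx l (ddx l (\<lambda>x. weval f (x / l))) x = weval (laplace f) (x / l) / l\<^sup>2"
proof -
  have 0: "((\<lambda>x. x / l) has_real_derivative 1 / l) (at x within {0..l * pi})" for x
    using l by (auto intro!: derivative_eq_intros)
  have 1: "((\<lambda>x. weval f (x / l)) has_real_derivative wsin f (x / l) / l) (at x within {0..l * pi})" for x
    using DERIV_chain2[OF weval_derivatives(1)[OF f] 0] by simp
  have 2: "((\<lambda>x. wsin f (x / l) / l) has_real_derivative weval (laplace f) (x / l) / l\<^sup>2) (at x within {0..l * pi})" for x
    using DERIV_cdivide[OF DERIV_chain2[OF weval_derivatives(2)[OF f] 0], of l]
    by (simp add: power2_eq_square)
  have 3: "continuous_on {0..l * pi} (\<lambda>x. weval (laplace f) (x / l) / l\<^sup>2)"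
    using l by (intro continuous_intros continuous_on_compose2[OF continuous_on_weval[of UNIV "laplace f"]]) auto
  note D = neumann_C2I[OF l, of "\<lambda>x. weval f (x / l)" "\<lambda>x. wsin f (x / l) / l", OF 1 2 3]
  show "neumann_C2 l (\<lambda>x. weval f (x / l))"
    using l weval_derivatives(4,5)[OF f] by (intro D(1)) auto
  show "ddx l (\<lambda>x. weval f (x / l)) x = wsin f (x / l) / l" if "x \<in> {0..l * pi}" for x
    using l weval_derivatives(4,5)[OF f] by (intro D(2) that) auto
  show "ddx l (ddx l (\<lambda>x. weval f (x / l))) x = weval (laplace f) (x / l) / l\<^sup>2"
    if "x \<in> {0..l * pi}" for x
    using l weval_derivatives(4,5)[OF f] by (intro D(3) that) auto
qed

section \<open>Cosine expansion of Neumann functions\<close>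

definition wmode :: "int \<Rightarrow> 'a::banach \<Rightarrow> 'a wiener" where
  "wmode m a = Wiener (\<lambda>n. if n = m \<or> n = - m then a else 0)"

lemma coef_wmode: "coef (wmode m a) n = (if n = m \<or> n = - m then a else 0)"
proof -
  have "(\<lambda>n. norm (if n = m \<or> n = - m then a else 0)) summable_on UNIV"
    by (subst summable_on_cong_neutral[of "{m, - m}" UNIV]) auto
  then show ?thesis unfolding wmode_def by (subst coef_Wiener) auto
qed

lemma norm_wmode: "norm (wmode m a) \<le> 2 * norm a"
proof -
  have "norm (wmode m a) = (\<Sum>\<^sub>\<infinity>n\<in>{m, - m}. norm (coef (wmode m a) n))"
    unfolding norm_wiener_def by (rule infsum_cong_neutral) (auto simp: coef_wmode)
  also have "\<dots> \<le> 2 * norm a"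
    by (cases "m = 0") (auto simp: coef_wmode)
  finally show ?thesis .
qed

lemma weval_wmode: "m \<noteq> 0 \<Longrightarrow> weval (wmode m a) x = (2 * cos (of_int m * x)) *\<^sub>R a"
proof -
  assume m: "m \<noteq> 0"
  have "weval (wmode m a) x = (\<Sum>\<^sub>\<infinity>n\<in>{m, - m}. cos (of_int n * x) *\<^sub>R coef (wmode m a) n)"
    unfolding weval_def by (rule infsum_cong_neutral) (auto simp: coef_wmode)
  also have "\<dots> = (2 * cos (of_int m * x)) *\<^sub>R a"
    using m by (auto simp: coef_wmode scaleR_left_distrib[symmetric])
  finally show ?thesis .
qed

lemma C2coef_wmode: "C2coef (wmode m a)"
  unfolding C2coef_def
  by (subst summable_on_cong_neutral[of "{m, - m}" UNIV]) (auto simp: coef_wmode)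

lemma cos_int_integral:
  "((\<lambda>x. cos (of_int n * x)) has_integral (if n = 0 then pi else 0)) {0..pi}"
proof (cases "n = 0")
  case True
  then show ?thesis using has_integral_const_real[of "1::real" 0 pi] by simp
next
  case False
  have "((\<lambda>x. cos (of_int n * x)) has_integral
      (sin (of_int n * pi) / of_int n - sin (of_int n * 0) / of_int n)) {0..pi}"
    by (rule fundamental_theorem_of_calculus)
       (use False in \<open>auto intro!: derivative_eq_intros
         simp: has_real_derivative_iff_has_vector_derivative[symmetric]\<close>)
  moreover have "sin (of_int n * pi) = 0" by (simp add: sin_zero_iff_int2)
  ultimately show ?thesis using False by simp
qed

lemma integral_weval:
  fixes f :: "real wiener"
  shows "(weval f has_integral pi * coef f 0) {0..pi}"
proof -
  have u: "uniform_limit {0..pi} (\<lambda>X x. \<Sum>n\<in>X. cos (of_int n * x) *\<^sub>R coef f n) (weval f)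
      (finite_subsets_at_top UNIV)"
    unfolding weval_def[abs_def]
    by (rule Weierstrass_m_test_general[where M = "\<lambda>n. norm (coef f n)"])
       (auto intro!: coef_summable norm_bounded_scaleR simp del: norm_scaleR real_norm_def real_scaleR_def)
  obtain I J where I: "\<And>X. ((\<lambda>x. \<Sum>n\<in>X. cos (of_int n * x) *\<^sub>R coef f n) has_integral I X) {0..pi}"
    and J: "(weval f has_integral J) {0..pi}" and IJ: "(I \<longlongrightarrow> J) (finite_subsets_at_top UNIV)"
    by (rule uniform_limit_integral[OF u]) (auto intro!: continuous_intros)
  have "I X = pi * coef f 0" if X: "finite X" "0 \<in> X" for X
  proof -
    have "((\<lambda>x. \<Sum>n\<in>X. cos (of_int n * x) *\<^sub>R coef f n) has_integral
        (\<Sum>n\<in>X. (if n = 0 then pi else 0) * coef f n)) {0..pi}"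
      unfolding real_scaleR_def using X(1) by (intro has_integral_sum has_integral_mult_left cos_int_integral)
    then have "I X = (\<Sum>n\<in>X. (if n = 0 then pi else 0) * coef f n)"
      using I by (rule has_integral_unique[rotated])
    also have "\<dots> = (\<Sum>n\<in>X. if n = 0 then pi * coef f 0 else 0)"
      by (rule sum.cong) auto
    also have "\<dots> = pi * coef f 0" using X by simp
    finally show ?thesis .
  qed
  then have "\<forall>\<^sub>F X in finite_subsets_at_top UNIV. I X = pi * coef f 0"
    unfolding eventually_finite_subsets_at_top by (intro exI[of _ "{0}"]) auto
  then have "(I \<longlongrightarrow> pi * coef f 0) (finite_subsets_at_top UNIV)"
    by (rule tendsto_eventually)
  then have "J = pi * coef f 0"
    using IJ tendsto_unique[OF finite_subsets_at_top_neq_bot] by blast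
  with J show ?thesis by simp
qed

text \<open>The Fourier coefficients of a product with \<open>cos (m x)\<close> are read off from the algebra: the zeroth
coefficient of \<open>f * wmode m 1\<close> is \<open>2 f m\<close>.\<close>

lemma integral_weval_cos:
  fixes f :: "real wiener"
  shows "((\<lambda>x. weval f x * cos (of_int m * x)) has_integral pi * coef f m) {0..pi}"
proof (cases "m = 0")
  case True
  then show ?thesis using integral_weval[of f] by (simp add: eta_contract_eq)
next
  case False
  have "coef (f * wmode m 1) 0 = (\<Sum>\<^sub>\<infinity>k\<in>{m, - m}. coef f k * coef (wmode m 1) (0 - k))"
    unfolding coef_mult conv_def
    by (rule infsum_cong_neutral) (auto simp: coef_wmode)
  also have "\<dots> = 2 * coef f m" using False by (simp add: coef_wmode)
  finally have "(weval (f * wmode m 1) has_integral pi * (2 * coef f m)) {0..pi}"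
    using integral_weval[of "f * wmode m 1"] by simp
  moreover have "weval (f * wmode m 1) = (\<lambda>x. (weval f x * cos (of_int m * x)) * 2)"
    using False by (auto simp: weval_mult weval_wmode)
  ultimately have "((\<lambda>x. (weval f x * cos (of_int m * x)) * 2) has_integral pi * (2 * coef f m)) {0..pi}"
    by simp
  from has_integral_mult_left[OF this, of "1/2"] show ?thesis by simp
qed

lemma coef_eq_0_if_weval_eq_0:
  fixes f :: "real wiener"
  assumes "\<And>x. x \<in> {0..pi} \<Longrightarrow> weval f x = 0"
  shows "coef f m = 0"
proof -
  have "((\<lambda>x. weval f x * cos (of_int m * x)) has_integral 0) {0..pi}"
    by (rule has_integral_is_0) (simp add: assms)
  with integral_weval_cos[of f m] have "pi * coef f m = 0"
    using has_integral_unique by blast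
  then show ?thesis by simp
qed

text \<open>If all cosine moments of \<open>H\<close> vanish, then so do its moments against polynomials in \<open>cos x\<close>,
and these approximate \<open>H\<close> uniformly by the Weierstrass theorem in the variable \<open>y = cos x\<close>;
hence the integral of \<open>H\<^sup>2\<close> is zero.\<close>

lemma cosine_complete:
  fixes H :: "real \<Rightarrow> real"
  assumes H: "continuous_on {0..pi} H"
    and 0: "\<And>m::int. integral {0..pi} (\<lambda>x. H x * cos (of_int m * x)) = 0"
    and x: "x \<in> {0..pi}"
  shows "H x = 0"
proof -
  have int: "(\<lambda>x. H x * g x) integrable_on {0..pi}" if "continuous_on {0..pi} g" for g
    by (intro integrable_continuous_real continuous_intros H that)
  have pow: "\<forall>m::int. integral {0..pi} (\<lambda>x. H x * (cos x ^ k * cos (of_int m * x))) = 0" for k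
  proof (induction k)
    case 0
    then show ?case using assms(2) by simp
  next
    case (Suc k)
    show ?case
    proof
      fix m :: int
      let ?i = "\<lambda>m. \<lambda>x. H x * (cos x ^ k * cos (of_int m * x))"
      have "cos x * cos (of_int m * x) = (cos (of_int (m + 1) * x) + cos (of_int (m - 1) * x)) / 2" for x :: real
        by (simp add: distrib_right left_diff_distrib cos_add cos_diff)
      note c = this
      have "H x * (cos x ^ Suc k * cos (of_int m * x)) = H x * cos x ^ k * (cos x * cos (of_int m * x))" for x
        by (simp only: power_Suc mult_ac)
      then have "H x * (cos x ^ Suc k * cos (of_int m * x)) = (?i (m + 1) x + ?i (m - 1) x) / 2" for x
        unfolding c by (simp add: distrib_left add_divide_distrib mult.assoc)
      then have "integral {0..pi} (\<lambda>x. H x * (cos x ^ Suc k * cos (of_int m * x)))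
          = integral {0..pi} (\<lambda>x. (?i (m + 1) x + ?i (m - 1) x) / 2)" by presburger
      also have "\<dots> = (integral {0..pi} (?i (m + 1)) + integral {0..pi} (?i (m - 1))) / 2"
        by (subst integral_divide, subst integral_add) (auto intro!: int continuous_intros)
      also have "\<dots> = 0" using Suc[rule_format, of "m + 1"] Suc[rule_format, of "m - 1"] by simp
      finally show "integral {0..pi} (\<lambda>x. H x * (cos x ^ Suc k * cos (of_int m * x))) = 0" .
    qed
  qed
  have poly: "integral {0..pi} (\<lambda>x. H x * p (cos x)) = 0" if rp: "real_polynomial_function p" for p
  proof -
    obtain a n where p: "p = (\<lambda>x. \<Sum>i\<le>n. a i * x ^ i)"
      using rp unfolding real_polynomial_function_iff_sum by auto
    have "integral {0..pi} (\<lambda>x. H x * p (cos x)) = integral {0..pi} (\<lambda>x. \<Sum>i\<le>n. a i * (H x * (cos x ^ i * cos (of_int 0 * x))))"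
      by (simp add: p sum_distrib_left mult.left_commute)
    also have "\<dots> = (\<Sum>i\<le>n. integral {0..pi} (\<lambda>x. a i * (H x * (cos x ^ i * cos (of_int 0 * x)))))"
      by (intro integral_sum) (auto intro!: int integrable_on_mult_right continuous_intros simp del: mult_zero_left)
    also have "\<dots> = 0" using pow[rule_format, where m = 0] by simp
    finally show ?thesis .
  qed
  have sq: "integral {0..pi} (\<lambda>x. H x * H x) = 0"
  proof (rule ccontr)
    let ?J = "integral {0..pi} (\<lambda>x. H x * H x)" and ?L = "integral {0..pi} (\<lambda>x. \<bar>H x\<bar>)"
    assume ne: "?J \<noteq> 0"
    have L: "?L \<ge> 0" by (intro integral_nonneg integrable_continuous_real continuous_intros H) auto
    define e where "e = \<bar>?J\<bar> / (?L + 1)"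
    have e: "e > 0" using ne L by (simp add: e_def)
    have "continuous_on {-1..1} (\<lambda>y. H (arccos y))"
      by (rule continuous_on_compose2[OF H continuous_on_arccos'])
         (auto simp: arccos_lbound arccos_ubound)
    then obtain p where p: "real_polynomial_function p" "\<And>y. y \<in> {-1..1} \<Longrightarrow> \<bar>H (arccos y) - p y\<bar> < e"
      using Stone_Weierstrass_real_polynomial_function[of "{-1..1}" "\<lambda>y. H (arccos y)" e] e by blast
    have pc: "continuous_on {0..pi} (\<lambda>x. p (cos x))"
      using p(1) by (intro continuous_on_compose2[OF continuous_on_polymonial_function[of p UNIV]])
        (auto intro!: continuous_intros simp: real_polynomial_function_eq)
    have "?J = integral {0..pi} (\<lambda>x. H x * H x) - integral {0..pi} (\<lambda>x. H x * p (cos x))"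
      using poly[OF p(1)] by simp
    also have "\<dots> = integral {0..pi} (\<lambda>x. H x * (H x - p (cos x)))"
      using integral_diff[OF int[OF H] int[OF pc]] by (simp add: right_diff_distrib)
    finally have "\<bar>?J\<bar> = norm (integral {0..pi} (\<lambda>x. H x * (H x - p (cos x))))" by simp
    also have "\<dots> \<le> integral {0..pi} (\<lambda>x. \<bar>H x\<bar> * e)"
    proof (rule integral_norm_bound_integral)
      show "(\<lambda>x. H x * (H x - p (cos x))) integrable_on {0..pi}"
        by (intro int continuous_intros H pc)
      show "(\<lambda>x. \<bar>H x\<bar> * e) integrable_on {0..pi}"
        by (intro integrable_continuous_real continuous_intros H)
      fix x assume "x \<in> {0..pi}"
      then have "\<bar>H x - p (cos x)\<bar> \<le> e"
        using p(2)[of "cos x"] by (simp add: arccos_cos less_imp_le)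
      then show "norm (H x * (H x - p (cos x))) \<le> \<bar>H x\<bar> * e"
        by (simp add: abs_mult mult_left_mono)
    qed
    also have "\<dots> = ?L * e" by simp
    also have "\<dots> < \<bar>?J\<bar>"
      using ne L by (simp add: e_def field_simps)
    finally show False by simp
  qed
  have "\<forall>x\<in>{0..pi}. H x * H x = 0"
    by (subst integral_eq_0_iff[symmetric]) (auto intro!: sq continuous_on_mult H)
  with x show ?thesis by simp
qed

lemma inverse_square_int_summable:
  "(\<lambda>n::int. if n = 0 then 1 else 1 / (of_int n)\<^sup>2 :: real) summable_on UNIV"
proof -
  let ?f = "\<lambda>n::int. if n = 0 then 1 else 1 / (of_int n)\<^sup>2 :: real"
  have "summable (\<lambda>k::nat. 1 / (real k)\<^sup>2)"
    using inverse_power_summable[of 2, where 'a = real] by (simp add: inverse_eq_divide)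
  then have "summable (\<lambda>k::nat. ?f (int k))"
    by (rule summable_comparison_test_ev[rotated])
       (auto intro!: eventually_sequentiallyI[of 1])
  then have a: "(\<lambda>k::nat. ?f (int k)) summable_on UNIV"
    by (subst summable_on_UNIV_nonneg_real_iff) auto
  have "?f summable_on range int"
    using a by (subst summable_on_reindex) (auto simp: o_def)
  moreover have "?f summable_on range (\<lambda>k. - int k)"
  proof (subst summable_on_reindex)
    have "?f \<circ> (\<lambda>k. - int k) = (\<lambda>k. ?f (int k))" by (rule ext) simp
    with a show "?f \<circ> (\<lambda>k. - int k) summable_on UNIV" by simp
  qed (simp add: inj_def)
  ultimately have "?f summable_on (range int \<union> range (\<lambda>k. - int k))"
    by (rule summable_on_union)
  moreover have "range int \<union> range (\<lambda>k. - int k) = UNIV"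
  proof -
    have "n \<in> range int \<union> range (\<lambda>k. - int k)" for n
      by (cases n rule: int_cases2) auto
    then show ?thesis by auto
  qed
  ultimately show ?thesis by simp
qed

definition inverse_square_sum :: real where
  "inverse_square_sum = (\<Sum>\<^sub>\<infinity>n::int. if n = 0 then 1 else 1 / (of_int n)\<^sup>2)"

text \<open>Integrating by parts twice bounds the coefficients by \<open>e / n\<^sup>2\<close>; the boundary terms vanish because of
the Neumann conditions and \<open>sin (n \<pi>) = 0\<close>.\<close>

lemma fourier_cosine:
  fixes g g' g'' :: "real \<Rightarrow> real"
  assumes g: "\<And>x. x \<in> {0..pi} \<Longrightarrow> (g has_real_derivative g' x) (at x within {0..pi})"
    and g': "\<And>x. x \<in> {0..pi} \<Longrightarrow> (g' has_real_derivative g'' x) (at x within {0..pi})"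
    and c: "continuous_on {0..pi} g''" and 0: "g' 0 = 0" "g' pi = 0"
    and e: "\<And>x. x \<in> {0..pi} \<Longrightarrow> \<bar>g x\<bar> \<le> e" "\<And>x. x \<in> {0..pi} \<Longrightarrow> \<bar>g'' x\<bar> \<le> e"
  shows "\<exists>f :: real wiener. norm f \<le> inverse_square_sum * e \<and> (\<forall>x\<in>{0..pi}. weval f x = g x)"
proof -
  have cg: "continuous_on {0..pi} g" using g by (rule DERIV_continuous_on)
  define c where "c n = integral {0..pi} (\<lambda>x. g x * cos (of_int n * x)) / pi" for n :: int
  have bound: "\<bar>integral {0..pi} h\<bar> \<le> e * pi"
    if "\<And>x. x \<in> {0..pi} \<Longrightarrow> \<bar>h x\<bar> \<le> e" "continuous_on {0..pi} h" for h :: "real \<Rightarrow> real"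
    using integral_bound[of 0 pi h e] that by simp
  have c_le: "\<bar>c n\<bar> \<le> e * (if n = 0 then 1 else 1 / (of_int n)\<^sup>2)" for n
  proof (cases "n = 0")
    case True
    then show ?thesis using bound[OF e(1) cg] by (simp add: c_def field_simps)
  next
    case False
    define k :: real where "k = of_int n"
    have k: "k \<noteq> 0" using False by (simp add: k_def)
    have sk: "sin (k * pi) = 0" unfolding k_def by (simp add: sin_zero_iff_int2)
    \<comment> \<open>integration by parts twice, in the form of an explicit primitive\<close>
    have "((\<lambda>x. g x * cos (k * x) + g'' x * cos (k * x) / k\<^sup>2) has_integral
       (g pi * sin (k * pi) / k + g' pi * cos (k * pi) / k\<^sup>2
        - (g 0 * sin (k * 0) / k + g' 0 * cos (k * 0) / k\<^sup>2))) {0..pi}"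
    proof (rule fundamental_theorem_of_calculus)
      fix x :: real assume x: "x \<in> {0..pi}"
      show "((\<lambda>x. g x * sin (k * x) / k + g' x * cos (k * x) / k\<^sup>2) has_vector_derivative
         g x * cos (k * x) + g'' x * cos (k * x) / k\<^sup>2) (at x within {0..pi})"
        unfolding has_real_derivative_iff_has_vector_derivative[symmetric]
        by (rule derivative_eq_intros g[OF x] g'[OF x] refl | simp add: k)+
           (use k in \<open>simp add: field_simps power2_eq_square power4_eq_xxxx\<close>)
    qed simp
    then have "integral {0..pi} (\<lambda>x. g x * cos (k * x) + g'' x * cos (k * x) / k\<^sup>2) = 0"
      using 0 sk by (simp add: integral_unique)
    then have "integral {0..pi} (\<lambda>x. g x * cos (k * x)) + integral {0..pi} (\<lambda>x. g'' x * cos (k * x)) / k\<^sup>2 = 0"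
      by (subst (asm) integral_add)
         (auto intro!: integrable_continuous_real continuous_intros cg assms(3) simp: k)
    then have "\<bar>integral {0..pi} (\<lambda>x. g x * cos (k * x))\<bar> = \<bar>integral {0..pi} (\<lambda>x. g'' x * cos (k * x))\<bar> / k\<^sup>2"
      by (simp add: eq_neg_iff_add_eq_0[symmetric])
    also have "\<dots> \<le> e * pi / k\<^sup>2"
    proof (intro divide_right_mono bound)
      fix x assume "x \<in> {0..pi}"
      then have "\<bar>g'' x\<bar> * \<bar>cos (k * x)\<bar> \<le> e * 1"
        using e(2)[of x] by (intro mult_mono) auto
      then show "\<bar>g'' x * cos (k * x)\<bar> \<le> e" by (simp add: abs_mult)
    qed (auto intro!: continuous_intros assms(3))
    finally show ?thesis using False by (simp add: c_def k_def field_simps)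
  qed
  have fin: "(\<Sum>n\<in>F. norm (c n)) \<le> inverse_square_sum * e" if "finite F" for F
  proof -
    have "0 \<le> e" using e(1)[of 0] by auto
    have "(\<Sum>n\<in>F. norm (c n)) \<le> (\<Sum>n\<in>F. e * (if n = 0 then 1 else 1 / (of_int n)\<^sup>2))"
      using c_le by (intro sum_mono) auto
    also have "\<dots> = e * (\<Sum>n\<in>F. (if n = 0 then 1 else 1 / (of_int n)\<^sup>2))"
      by (simp add: sum_distrib_left)
    also have "\<dots> \<le> e * inverse_square_sum"
      unfolding inverse_square_sum_def
      by (intro mult_left_mono finite_sum_le_infsum inverse_square_int_summable that \<open>0 \<le> e\<close>) auto
    finally show ?thesis by (simp add: mult.commute)
  qed
  have c_even: "c (- n) = c n" for n by (simp add: c_def)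
  define f where "f = Wiener c"
  have cf: "coef f = c" and nf: "norm f \<le> inverse_square_sum * e"
    unfolding f_def using wiener_of_finite_bounds[OF fin] c_even by auto
  have "g x - weval f x = 0" if "x \<in> {0..pi}" for x
  proof (rule cosine_complete[OF _ _ that])
    show "continuous_on {0..pi} (\<lambda>x. g x - weval f x)"
      by (intro continuous_intros cg continuous_on_weval)
    fix m :: int
    have "((\<lambda>x. g x * cos (of_int m * x)) has_integral pi * c m) {0..pi}"
      unfolding c_def using pi_gt_zero
      by (auto intro!: integrable_integral integrable_continuous_real continuous_intros cg)
    from has_integral_diff[OF this integral_weval_cos[of f m]]
    show "integral {0..pi} (\<lambda>x. (g x - weval f x) * cos (of_int m * x)) = 0"
      by (simp add: left_diff_distrib cf integral_unique)
  qed
  with nf show ?thesis by auto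
qed

text \<open>Closeness to a constant in \<open>C\<^sup>2\<close> becomes smallness in the Wiener norm. This is the only place
where an arbitrary steady state has to be expanded.\<close>

lemma C2_near_weval:
  assumes l: "l > 0" and U: "neumann_C2 l U" and near: "C2_near l \<epsilon> U c"
  shows "\<exists>p :: real wiener. norm p \<le> inverse_square_sum * (1 + l\<^sup>2) * \<epsilon> \<and>
     (\<forall>x\<in>{0..l * pi}. U x = c + weval p (x / l))"
proof -
  let ?g = "\<lambda>y. U (l * y) - c" and ?g' = "\<lambda>y. ddx l U (l * y) * l"
    and ?g'' = "\<lambda>y. ddx l (ddx l U) (l * y) * l * l"
  have im: "(\<lambda>y. l * y) ` {0..pi} \<subseteq> {0..l * pi}" using l by auto
  have sc: "((\<lambda>y. l * y) has_real_derivative l) (at y within {0..pi})" for y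
    by (auto intro!: derivative_eq_intros)
  have near': "\<bar>U x - c\<bar> < \<epsilon>" "\<bar>ddx l (ddx l U) x\<bar> < \<epsilon>" if "x \<in> {0..l * pi}" for x
    using near that by (auto simp: C2_near_def)
  have "\<epsilon> > 0" using near'(1)[of 0] l by auto
  have "\<exists>f :: real wiener. norm f \<le> inverse_square_sum * ((1 + l\<^sup>2) * \<epsilon>) \<and> (\<forall>y\<in>{0..pi}. weval f y = ?g y)"
  proof (rule fourier_cosine)
    fix y :: real assume y: "y \<in> {0..pi}"
    then have ly: "l * y \<in> {0..l * pi}" using im by blast
    have "((U \<circ> (\<lambda>y. l * y)) has_real_derivative ddx l U (l * y) * l) (at y within {0..pi})"
      by (rule DERIV_image_chain[OF has_field_derivative_subset[OF neumann_C2D(1)[OF l U ly] im] sc])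
    then show "(?g has_real_derivative ?g' y) (at y within {0..pi})"
      by (auto intro!: derivative_eq_intros simp: o_def)
    have "((ddx l U \<circ> (\<lambda>y. l * y)) has_real_derivative ddx l (ddx l U) (l * y) * l) (at y within {0..pi})"
      by (rule DERIV_image_chain[OF has_field_derivative_subset[OF neumann_C2D(2)[OF l U ly] im] sc])
    then show "(?g' has_real_derivative ?g'' y) (at y within {0..pi})"
      by (auto intro!: derivative_eq_intros simp: o_def)
    show "\<bar>?g y\<bar> \<le> (1 + l\<^sup>2) * \<epsilon>"
    proof -
      have "\<bar>?g y\<bar> \<le> 1 * \<epsilon>" using near'(1)[OF ly] by simp
      also have "\<dots> \<le> (1 + l\<^sup>2) * \<epsilon>" using \<open>\<epsilon> > 0\<close> by (intro mult_right_mono) auto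
      finally show ?thesis .
    qed
    show "\<bar>?g'' y\<bar> \<le> (1 + l\<^sup>2) * \<epsilon>"
    proof -
      have "\<bar>?g'' y\<bar> = \<bar>ddx l (ddx l U) (l * y)\<bar> * l\<^sup>2"
        by (simp add: abs_mult power2_eq_square)
      also have "\<dots> \<le> \<epsilon> * (1 + l\<^sup>2)"
        using near'(2)[OF ly] \<open>\<epsilon> > 0\<close> by (intro mult_mono) auto
      finally show ?thesis by (simp add: mult.commute)
    qed
  next
    have "continuous_on {0..l * pi} (ddx l (ddx l U))" using U by (simp add: neumann_C2_def)
    then have "continuous_on {0..pi} (\<lambda>y. ddx l (ddx l U) (l * y))"
      by (rule continuous_on_compose2) (use im in \<open>auto intro!: continuous_intros\<close>)
    then show "continuous_on {0..pi} ?g''" by (intro continuous_intros)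
    show "?g' 0 = 0" "?g' pi = 0" using U by (auto simp: neumann_C2_def)
  qed
  then obtain f :: "real wiener" where f: "norm f \<le> inverse_square_sum * ((1 + l\<^sup>2) * \<epsilon>)"
    "\<And>y. y \<in> {0..pi} \<Longrightarrow> weval f y = U (l * y) - c" by blast
  have "U x = c + weval f (x / l)" if "x \<in> {0..l * pi}" for x
    using f(2)[of "x / l"] that l by (simp add: field_simps)
  with f(1) show ?thesis by (auto simp: mult.assoc)
qed

section \<open>Difference quotients of rational functions in a Banach algebra\<close>

lemma geometric_inverse:
  fixes x :: "'a::{real_normed_algebra_1,banach,comm_ring_1}"
  assumes x: "norm x \<le> 1/2"
  shows "(\<Sum>n. x ^ n) * (1 - x) = 1" and "norm (\<Sum>n. x ^ n) \<le> 2"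
proof -
  have s: "summable (\<lambda>n. x ^ n)"
    by (rule complete_algebra_summable_geometric) (use x in simp)
  have "(\<Sum>n. x ^ n) = 1 + (\<Sum>n. x ^ Suc n)"
    using suminf_split_head[OF s] by simp
  also have "(\<Sum>n. x ^ Suc n) = x * (\<Sum>n. x ^ n)"
    using suminf_mult[OF s, of x] by simp
  finally show "(\<Sum>n. x ^ n) * (1 - x) = 1" by (simp add: algebra_simps)
  have "norm (x ^ n) \<le> (1/2) ^ n" for n
    by (rule order_trans[OF norm_power_ineq]) (use x in \<open>intro power_mono, auto\<close>)
  moreover have "summable (\<lambda>n. (1/2::real) ^ n)" by (rule summable_geometric) simp
  ultimately have "norm (\<Sum>n. x ^ n) \<le> (\<Sum>n. (1/2::real) ^ n)"
    by (rule norm_suminf_le)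
  then show "norm (\<Sum>n. x ^ n) \<le> 2" by (simp add: suminf_geometric)
qed

text \<open>The inverse of \<open>\<kappa> + p\<close> for small \<open>p\<close>, as a Neumann series.\<close>

definition inv_near :: "real \<Rightarrow> 'a::{real_normed_algebra_1,banach,comm_ring_1} \<Rightarrow> 'a" where
  "inv_near \<kappa> p = (1 / \<kappa>) *\<^sub>R (\<Sum>n. (- (1 / \<kappa>) *\<^sub>R p) ^ n)"

lemma inv_near:
  fixes p :: "'a::{real_normed_algebra_1,banach,comm_ring_1}"
  assumes "\<kappa> > 0" "norm p \<le> \<kappa> / 2"
  shows "inv_near \<kappa> p * (of_real \<kappa> + p) = 1" and "norm (inv_near \<kappa> p) \<le> 2 / \<kappa>"
proof -
  have x: "norm (- (1 / \<kappa>) *\<^sub>R p) \<le> 1/2" using assms by (simp add: field_simps)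
  have "of_real \<kappa> + p = \<kappa> *\<^sub>R (1 - (- (1 / \<kappa>) *\<^sub>R p))"
    using assms by (simp add: of_real_def scaleR_right_distrib)
  then show "inv_near \<kappa> p * (of_real \<kappa> + p) = 1"
    unfolding inv_near_def using geometric_inverse(1)[OF x] assms by simp
  show "norm (inv_near \<kappa> p) \<le> 2 / \<kappa>"
    unfolding inv_near_def using geometric_inverse(2)[OF x] assms by (simp add: field_simps)
qed

lemma inv_near_diff:
  fixes p q :: "'a::{real_normed_algebra_1,banach,comm_ring_1}"
  assumes \<kappa>: "\<kappa> > 0" and p: "norm p \<le> \<kappa> / 2" and q: "norm q \<le> \<kappa> / 2"
  shows "inv_near \<kappa> p - inv_near \<kappa> q = inv_near \<kappa> p * inv_near \<kappa> q * (q - p)"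
    and "norm (inv_near \<kappa> p - inv_near \<kappa> q) \<le> 4 / \<kappa>\<^sup>2 * norm (p - q)"
proof -
  let ?i = "inv_near \<kappa> p" and ?j = "inv_near \<kappa> q"
  have "?i - ?j = ?i * (?j * (of_real \<kappa> + q)) - ?j * (?i * (of_real \<kappa> + p))"
    using inv_near(1)[OF \<kappa> p] inv_near(1)[OF \<kappa> q] by simp
  then show eq: "?i - ?j = ?i * ?j * (q - p)" by (simp add: algebra_simps)
  have "norm (?i - ?j) \<le> norm ?i * norm ?j * norm (q - p)"
    unfolding eq by (rule order_trans[OF norm_mult_ineq mult_right_mono[OF norm_mult_ineq]]) simp
  also have "\<dots> \<le> (2 / \<kappa>) * (2 / \<kappa>) * norm (q - p)"
    using inv_near(2)[OF \<kappa> p] inv_near(2)[OF \<kappa> q] \<kappa> by (intro mult_mono) auto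
  finally show "norm (?i - ?j) \<le> 4 / \<kappa>\<^sup>2 * norm (p - q)"
    by (simp add: norm_minus_commute power2_eq_square)
qed

definition quadf :: "real \<Rightarrow> real \<Rightarrow> real \<Rightarrow> 'a::real_normed_algebra \<Rightarrow> 'a \<Rightarrow> 'a" where
  "quadf \<alpha> \<beta> \<gamma> p q = \<alpha> *\<^sub>R (p * p) + \<beta> *\<^sub>R (p * q) + \<gamma> *\<^sub>R (q * q)"

text \<open>The quotient \<open>(Q (p + e y, q + e z) - Q (p, q)) / e\<close> for a quadratic form \<open>Q\<close>, written without
dividing by \<open>e\<close>. The factor \<open>e\<close> is the amplitude of a bifurcating solution in one application
and the decaying function \<open>exp (\<beta> t)\<close>, which has no bounded inverse, in the other.\<close>

definition quad_dq ::
  "real \<Rightarrow> real \<Rightarrow> real \<Rightarrow> 'a::real_normed_algebra \<Rightarrow> 'a \<Rightarrow> 'a \<Rightarrow> 'a \<Rightarrow> 'a \<Rightarrow> 'a" where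
  "quad_dq \<alpha> \<beta> \<gamma> e p q y z =
     \<alpha> *\<^sub>R ((p + p) * y + e * (y * y)) + \<beta> *\<^sub>R (p * z + q * y + e * (y * z))
     + \<gamma> *\<^sub>R ((q + q) * z + e * (z * z))"

text \<open>The corresponding quotient for \<open>Q (p, q) / (\<kappa> + p)\<close>.\<close>

definition ratio_dq ::
  "real \<Rightarrow> real \<Rightarrow> real \<Rightarrow> real \<Rightarrow> 'a::{real_normed_algebra_1,banach,comm_ring_1} \<Rightarrow> 'a \<Rightarrow> 'a \<Rightarrow> 'a \<Rightarrow> 'a \<Rightarrow> 'a" where
  "ratio_dq \<kappa> \<alpha> \<beta> \<gamma> e p q y z =
     quad_dq \<alpha> \<beta> \<gamma> e p q y z * inv_near \<kappa> (p + e * y)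
     - quadf \<alpha> \<beta> \<gamma> p q * (y * inv_near \<kappa> p * inv_near \<kappa> (p + e * y))"

lemma quad_dq:
  fixes e :: "'a::{real_normed_algebra_1,comm_ring_1}"
  shows "quadf \<alpha> \<beta> \<gamma> (p + e * y) (q + e * z) = quadf \<alpha> \<beta> \<gamma> p q + e * quad_dq \<alpha> \<beta> \<gamma> e p q y z"
proof -
  have 1: "(p + e * y) * (p + e * y) = p * p + e * ((p + p) * y + e * (y * y))"
    and 2: "(p + e * y) * (q + e * z) = p * q + e * (p * z + q * y + e * (y * z))"
    and 3: "(q + e * z) * (q + e * z) = q * q + e * ((q + q) * z + e * (z * z))"
    by (simp_all add: algebra_simps)
  show ?thesis
    unfolding quadf_def quad_dq_def 1 2 3
    by (simp add: scaleR_right_distrib distrib_left add_ac)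
qed

lemma ratio_dq:
  fixes e :: "'a::{real_normed_algebra_1,banach,comm_ring_1}"
  assumes \<kappa>: "\<kappa> > 0" "norm p \<le> \<kappa> / 2" "norm (p + e * y) \<le> \<kappa> / 2"
  shows "e * ratio_dq \<kappa> \<alpha> \<beta> \<gamma> e p q y z
    = quadf \<alpha> \<beta> \<gamma> (p + e * y) (q + e * z) * inv_near \<kappa> (p + e * y) - quadf \<alpha> \<beta> \<gamma> p q * inv_near \<kappa> p"
proof -
  let ?i = "inv_near \<kappa> p" and ?j = "inv_near \<kappa> (p + e * y)" and ?Q = "quadf \<alpha> \<beta> \<gamma> p q"
  have ij: "?j = ?i - ?i * ?j * (e * y)"
    using inv_near_diff(1)[OF \<kappa>(1,2,3)] by (simp add: algebra_simps)
  have "(?Q + e * quad_dq \<alpha> \<beta> \<gamma> e p q y z) * ?j - ?Q * ?i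
      = e * (quad_dq \<alpha> \<beta> \<gamma> e p q y z * ?j) + ?Q * (?j - ?i)"
    by (simp add: algebra_simps)
  also have "?j - ?i = - (?i * ?j * (e * y))" using ij by (simp add: algebra_simps)
  finally show ?thesis
    unfolding quad_dq ratio_dq_def by (simp add: algebra_simps)
qed

lemma norm_mult_le_mult:
  fixes a b :: "'a::real_normed_algebra"
  assumes "norm a \<le> A" "norm b \<le> B"
  shows "norm (a * b) \<le> A * B"
  using assms norm_mult_ineq[of a b] by (meson mult_mono norm_ge_zero order_trans)

text \<open>The Lipschitz constant in \<open>(y, z)\<close> is proportional to the size \<open>\<eta>\<close> of the base point \<open>(p, q)\<close>
and of the increment \<open>(e y, e z)\<close>: the quotient of a quadratic form is linear in these.\<close>

lemma quad_dq_lipschitz: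
  fixes e :: "'a::{real_normed_algebra_1,comm_ring_1}"
  assumes p: "norm p \<le> \<eta>" "norm q \<le> \<eta>"
    and e: "norm e * norm y \<le> \<eta>" "norm e * norm z \<le> \<eta>" "norm e * norm y' \<le> \<eta>" "norm e * norm z' \<le> \<eta>"
  shows "norm (quad_dq \<alpha> \<beta> \<gamma> e p q y z - quad_dq \<alpha> \<beta> \<gamma> e p q y' z')
    \<le> 4 * (\<bar>\<alpha>\<bar> + \<bar>\<beta>\<bar> + \<bar>\<gamma>\<bar>) * \<eta> * (norm (y - y') + norm (z - z'))"
proof -
  let ?d = "norm (y - y') + norm (z - z')"
  have \<eta>: "0 \<le> \<eta>" using p norm_ge_zero order_trans by blast
  have d: "norm (y - y') \<le> ?d" "norm (z - z') \<le> ?d" by simp_all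
  have ep: "norm (e * v) \<le> \<eta>" if "norm e * norm v \<le> \<eta>" for v
    using that norm_mult_ineq[of e v] by linarith
  have 1: "norm (((p + p) * y + e * (y * y)) - ((p + p) * y' + e * (y' * y'))) \<le> (4 * \<eta>) * ?d"
  proof -
    have "((p + p) * y + e * (y * y)) - ((p + p) * y' + e * (y' * y'))
        = (p + p + (e * y + e * y')) * (y - y')" by (simp add: algebra_simps)
    also have "norm \<dots> \<le> (4 * \<eta>) * ?d"
    proof (rule norm_mult_le_mult[OF _ d(1)])
      have "norm (p + p + (e * y + e * y')) \<le> (norm p + norm p) + (norm (e * y) + norm (e * y'))"
        by (intro norm_triangle_mono) auto
      then show "norm (p + p + (e * y + e * y')) \<le> 4 * \<eta>" using p ep[OF e(1)] ep[OF e(3)] by linarith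
    qed
    finally show ?thesis .
  qed
  have 3: "norm (((q + q) * z + e * (z * z)) - ((q + q) * z' + e * (z' * z'))) \<le> (4 * \<eta>) * ?d"
  proof -
    have "((q + q) * z + e * (z * z)) - ((q + q) * z' + e * (z' * z'))
        = (q + q + (e * z + e * z')) * (z - z')" by (simp add: algebra_simps)
    also have "norm \<dots> \<le> (4 * \<eta>) * ?d"
    proof (rule norm_mult_le_mult[OF _ d(2)])
      have "norm (q + q + (e * z + e * z')) \<le> (norm q + norm q) + (norm (e * z) + norm (e * z'))"
        by (intro norm_triangle_mono) auto
      then show "norm (q + q + (e * z + e * z')) \<le> 4 * \<eta>" using p ep[OF e(2)] ep[OF e(4)] by linarith
    qed
    finally show ?thesis .
  qed
  have 2: "norm ((p * z + q * y + e * (y * z)) - (p * z' + q * y' + e * (y' * z'))) \<le> (4 * \<eta>) * ?d"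
  proof -
    have "(p * z + q * y + e * (y * z)) - (p * z' + q * y' + e * (y' * z'))
        = (p + e * y) * (z - z') + (q + e * z') * (y - y')" by (simp add: algebra_simps)
    also have "norm \<dots> \<le> (2 * \<eta>) * ?d + (2 * \<eta>) * ?d"
    proof (rule norm_triangle_mono[OF norm_mult_le_mult[OF _ d(2)] norm_mult_le_mult[OF _ d(1)]])
      show "norm (p + e * y) \<le> 2 * \<eta>" using norm_triangle_ineq[of p "e * y"] p ep[OF e(1)] by linarith
      show "norm (q + e * z') \<le> 2 * \<eta>" using norm_triangle_ineq[of q "e * z'"] p ep[OF e(4)] by linarith
    qed
    finally show ?thesis by (simp add: algebra_simps)
  qed
  have "quad_dq \<alpha> \<beta> \<gamma> e p q y z - quad_dq \<alpha> \<beta> \<gamma> e p q y' z'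
      = \<alpha> *\<^sub>R (((p + p) * y + e * (y * y)) - ((p + p) * y' + e * (y' * y')))
      + \<beta> *\<^sub>R ((p * z + q * y + e * (y * z)) - (p * z' + q * y' + e * (y' * z')))
      + \<gamma> *\<^sub>R (((q + q) * z + e * (z * z)) - ((q + q) * z' + e * (z' * z')))"
    unfolding quad_dq_def scaleR_diff_right by (simp only: diff_conv_add_uminus minus_add_distrib add_ac)
  also have "norm \<dots> \<le> \<bar>\<alpha>\<bar> * ((4 * \<eta>) * ?d) + \<bar>\<beta>\<bar> * ((4 * \<eta>) * ?d) + \<bar>\<gamma>\<bar> * ((4 * \<eta>) * ?d)"
    using 1 2 3 by (intro norm_triangle_mono) (auto simp only: norm_scaleR intro!: mult_left_mono abs_ge_zero)
  also have "\<dots> = 4 * (\<bar>\<alpha>\<bar> + \<bar>\<beta>\<bar> + \<bar>\<gamma>\<bar>) * \<eta> * ?d" by (simp add: algebra_simps)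
  finally show ?thesis .
qed

lemma quad_dq_0 [simp]: "quad_dq \<alpha> \<beta> \<gamma> e p q 0 0 = 0"
  by (simp add: quad_dq_def)

lemma ratio_dq_0 [simp]: "ratio_dq \<kappa> \<alpha> \<beta> \<gamma> e p q 0 0 = 0"
  by (simp add: ratio_dq_def)

lemma norm_quadf_le:
  fixes p :: "'a::{real_normed_algebra_1,comm_ring_1}"
  assumes "norm p \<le> \<eta>" "norm q \<le> \<eta>"
  shows "norm (quadf \<alpha> \<beta> \<gamma> p q) \<le> (\<bar>\<alpha>\<bar> + \<bar>\<beta>\<bar> + \<bar>\<gamma>\<bar>) * (\<eta> * \<eta>)"
proof -
  have "norm (quadf \<alpha> \<beta> \<gamma> p q) \<le> \<bar>\<alpha>\<bar> * (\<eta> * \<eta>) + \<bar>\<beta>\<bar> * (\<eta> * \<eta>) + \<bar>\<gamma>\<bar> * (\<eta> * \<eta>)"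
    unfolding quadf_def
    by (intro norm_triangle_mono) (auto intro!: mult_left_mono norm_mult_le_mult assms)
  then show ?thesis by (simp add: algebra_simps)
qed

definition ratio_lip :: "real \<Rightarrow> real \<Rightarrow> real" where
  "ratio_lip \<kappa> m = 4 * m * (2 / \<kappa>) + 8 * m * (4 / \<kappa>\<^sup>2) + m * (2 / \<kappa> * (2 / \<kappa>) + 2 / \<kappa> * (4 / \<kappa>\<^sup>2))"

lemma ratio_dq_lipschitz:
  fixes e :: "'a::{real_normed_algebra_1,banach,comm_ring_1}"
  assumes \<kappa>: "\<kappa> > 0" "2 * \<eta> \<le> \<kappa> / 2" and \<eta>1: "\<eta> \<le> 1"
    and p: "norm p \<le> \<eta>" "norm q \<le> \<eta>"
    and e: "norm e * norm y \<le> \<eta>" "norm e * norm z \<le> \<eta>" "norm e * norm y' \<le> \<eta>" "norm e * norm z' \<le> \<eta>"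
  shows "norm (ratio_dq \<kappa> \<alpha> \<beta> \<gamma> e p q y z - ratio_dq \<kappa> \<alpha> \<beta> \<gamma> e p q y' z')
    \<le> ratio_lip \<kappa> (\<bar>\<alpha>\<bar> + \<bar>\<beta>\<bar> + \<bar>\<gamma>\<bar>) * \<eta> * (norm (y - y') + norm (z - z'))"
proof -
  let ?m = "\<bar>\<alpha>\<bar> + \<bar>\<beta>\<bar> + \<bar>\<gamma>\<bar>" and ?d = "norm (y - y') + norm (z - z')"
  let ?S = "quad_dq \<alpha> \<beta> \<gamma> e p q y z" and ?S' = "quad_dq \<alpha> \<beta> \<gamma> e p q y' z'"
  let ?i = "inv_near \<kappa> p" and ?j = "inv_near \<kappa> (p + e * y)" and ?j' = "inv_near \<kappa> (p + e * y')"
  let ?Q = "quadf \<alpha> \<beta> \<gamma> p q"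
  have \<eta>: "0 \<le> \<eta>" using p norm_ge_zero order_trans by blast
  have m: "0 \<le> ?m" by simp
  have ep: "norm (e * v) \<le> norm e * norm v" for v by (rule norm_mult_ineq)
  have P: "norm p \<le> \<kappa> / 2" "norm (p + e * y) \<le> \<kappa> / 2" "norm (p + e * y') \<le> \<kappa> / 2"
    using p \<kappa> \<eta> e ep[of y] ep[of y'] norm_triangle_ineq[of p "e * y"] norm_triangle_ineq[of p "e * y'"]
    by linarith+
  have i: "norm ?i \<le> 2 / \<kappa>" and j: "norm ?j \<le> 2 / \<kappa>"
    using inv_near(2)[OF \<kappa>(1)] P by blast+
  have S: "norm (?S - ?S') \<le> 4 * ?m * \<eta> * ?d"
    by (rule quad_dq_lipschitz) (use p e in auto)
  have S0: "norm ?S' \<le> 4 * ?m * \<eta> * (norm y' + norm z')"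
    using quad_dq_lipschitz[of p \<eta> q e y' z' 0 0 \<alpha> \<beta> \<gamma>] p e \<eta> by simp
  have J: "norm (?j - ?j') \<le> 4 / \<kappa>\<^sup>2 * (norm e * ?d)"
  proof -
    have "norm (p + e * y - (p + e * y')) \<le> norm e * norm (y - y')"
      using ep[of "y - y'"] by (simp add: right_diff_distrib)
    also have "\<dots> \<le> norm e * ?d" by (intro mult_left_mono) auto
    finally have "norm (p + e * y - (p + e * y')) \<le> norm e * ?d" .
    then have "4 / \<kappa>\<^sup>2 * norm (p + e * y - (p + e * y')) \<le> 4 / \<kappa>\<^sup>2 * (norm e * ?d)"
      by (intro mult_left_mono) auto
    with inv_near_diff(2)[OF \<kappa>(1) P(2,3)] show ?thesis by linarith
  qed
  have split: "ratio_dq \<kappa> \<alpha> \<beta> \<gamma> e p q y z - ratio_dq \<kappa> \<alpha> \<beta> \<gamma> e p q y' z'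
    = (?S - ?S') * ?j + ?S' * (?j - ?j') - ?Q * ((y - y') * (?i * ?j) + y' * (?i * (?j - ?j')))"
    unfolding ratio_dq_def by (simp add: algebra_simps)
  have T1: "norm ((?S - ?S') * ?j) \<le> (4 * ?m * \<eta> * ?d) * (2 / \<kappa>)"
    by (rule norm_mult_le_mult[OF S j])
  have T2: "norm (?S' * (?j - ?j')) \<le> (4 * ?m * (4 / \<kappa>\<^sup>2)) * \<eta> * ?d * 2"
  proof -
    have "norm (?S' * (?j - ?j')) \<le> (4 * ?m * \<eta> * (norm y' + norm z')) * (4 / \<kappa>\<^sup>2 * (norm e * ?d))"
      by (rule norm_mult_le_mult[OF S0 J])
    also have "\<dots> = (4 * ?m * \<eta> * ?d * (4 / \<kappa>\<^sup>2)) * (norm e * norm y' + norm e * norm z')"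
      by (simp only: ring_distribs mult_ac)
    also have "\<dots> \<le> (4 * ?m * \<eta> * ?d * (4 / \<kappa>\<^sup>2)) * 2"
      using e \<eta>1 \<eta> by (intro mult_left_mono mult_nonneg_nonneg) auto
    finally show ?thesis by (simp only: mult_ac)
  qed
  have T3: "norm ((y - y') * (?i * ?j)) \<le> ?d * (2 / \<kappa> * (2 / \<kappa>))"
    by (intro norm_mult_le_mult i j) simp
  have T4: "norm (y' * (?i * (?j - ?j'))) \<le> 2 / \<kappa> * (4 / \<kappa>\<^sup>2) * ?d"
  proof -
    have "norm (y' * (?i * (?j - ?j'))) \<le> norm y' * (2 / \<kappa> * (4 / \<kappa>\<^sup>2 * (norm e * ?d)))"
      by (intro norm_mult_le_mult i J) simp
    also have "\<dots> = (2 / \<kappa> * (4 / \<kappa>\<^sup>2) * ?d) * (norm e * norm y')" by (simp only: mult_ac)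
    also have "\<dots> \<le> (2 / \<kappa> * (4 / \<kappa>\<^sup>2) * ?d) * 1"
      using e \<eta>1 \<kappa>(1) by (intro mult_left_mono mult_nonneg_nonneg) auto
    finally show ?thesis by simp
  qed
  have T5: "norm (?Q * ((y - y') * (?i * ?j) + y' * (?i * (?j - ?j'))))
      \<le> (?m * \<eta>) * (?d * (2 / \<kappa> * (2 / \<kappa>)) + 2 / \<kappa> * (4 / \<kappa>\<^sup>2) * ?d)"
  proof (rule norm_mult_le_mult)
    have "norm ?Q \<le> ?m * (\<eta> * \<eta>)" by (rule norm_quadf_le[OF p])
    also have "\<dots> \<le> ?m * (\<eta> * 1)" using \<eta> \<eta>1 by (intro mult_left_mono) auto
    finally show "norm ?Q \<le> ?m * \<eta>" by simp
    show "norm ((y - y') * (?i * ?j) + y' * (?i * (?j - ?j')))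
       \<le> ?d * (2 / \<kappa> * (2 / \<kappa>)) + 2 / \<kappa> * (4 / \<kappa>\<^sup>2) * ?d"
      by (rule norm_triangle_mono[OF T3 T4])
  qed
  have "norm (ratio_dq \<kappa> \<alpha> \<beta> \<gamma> e p q y z - ratio_dq \<kappa> \<alpha> \<beta> \<gamma> e p q y' z')
    \<le> norm ((?S - ?S') * ?j) + norm (?S' * (?j - ?j')) + norm (?Q * ((y - y') * (?i * ?j) + y' * (?i * (?j - ?j'))))"
    unfolding split by (meson norm_triangle_ineq4 norm_triangle_ineq add_right_mono order_trans)
  also have "\<dots> \<le> (4 * ?m * \<eta> * ?d) * (2 / \<kappa>) + (4 * ?m * (4 / \<kappa>\<^sup>2)) * \<eta> * ?d * 2
     + (?m * \<eta>) * (?d * (2 / \<kappa> * (2 / \<kappa>)) + 2 / \<kappa> * (4 / \<kappa>\<^sup>2) * ?d)"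
    by (intro add_mono T1 T2 T5)
  also have "\<dots> = ratio_lip \<kappa> ?m * \<eta> * ?d"
  proof -
    have "(4 * m * \<eta> * d) * k + (4 * m * k') * \<eta> * d * 2 + (m * \<eta>) * (d * (k * k) + k * k' * d)
      = (4 * m * k + 8 * m * k' + m * (k * k + k * k')) * \<eta> * d" for m d k k' :: real
      by (simp add: algebra_simps)
    then show ?thesis unfolding ratio_lip_def .
  qed
  finally show ?thesis .
qed

section \<open>The kinetics near the constant steady state\<close>

text \<open>The closed form of \<open>u0\<close> enters only through its sign and the equation \<open>a u0 = (1 - u0) (u0 + b)\<close>.\<close>

lemma HT_u0_root:
  assumes b: "0 < b"
  shows "HT_u0 a b > 0" and "a * HT_u0 a b = (1 - HT_u0 a b) * (HT_u0 a b + b)"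
proof -
  let ?s = "sqrt ((a + b - 1)\<^sup>2 + 4 * b)"
  have "\<bar>a + b - 1\<bar> < ?s"
    using b by (intro real_less_rsqrt) simp
  then show "HT_u0 a b > 0" unfolding HT_u0_def by simp
  have "?s * ?s = (a + b - 1)\<^sup>2 + 4 * b" using b by simp
  then show "a * HT_u0 a b = (1 - HT_u0 a b) * (HT_u0 a b + b)"
    unfolding HT_u0_def by (simp add: field_simps power2_eq_square)
qed

lemma HT_B0_eq:
  assumes b: "0 < b" shows "HT_B0 a b = HT_u0 a b - 1"
  using HT_u0_root[OF b, of a] b by (simp add: HT_B0_def field_simps)

lemma HT_u0_less_1:
  assumes "0 < b" "0 < a" shows "HT_u0 a b < 1"
proof (rule ccontr)
  assume "\<not> ?thesis"
  then have "(1 - HT_u0 a b) * (HT_u0 a b + b) \<le> 0"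
    using assms HT_u0_root(1)[of b a] by (intro mult_nonpos_nonneg) auto
  moreover have "a * HT_u0 a b > 0" using assms HT_u0_root(1)[of b a] by simp
  ultimately show False using HT_u0_root(2)[of b a] assms by simp
qed

lemma HT_B0_neg: "0 < b \<Longrightarrow> 0 < a \<Longrightarrow> HT_B0 a b < 0"
  using HT_u0_less_1[of b a] HT_B0_eq[of b a] by simp

lemma HT_A0_B0_neg:
  assumes b: "0 < b" shows "HT_A0 a b + HT_B0 a b < 0"
proof -
  let ?u = "HT_u0 a b"
  have u: "?u > 0" using HT_u0_root[OF b] by blast
  have "?u * (1 - b - 2 * ?u - a) = - (?u * ?u + b)"
    using HT_u0_root(2)[OF b, of a] by (simp add: algebra_simps)
  moreover have "HT_A0 a b + HT_B0 a b = ?u * (1 - b - 2 * ?u - a) / (b + ?u)"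
    unfolding HT_A0_def HT_B0_def
    by (simp only: times_divide_eq_left minus_divide_left add_divide_distrib[symmetric])
       (simp add: algebra_simps)
  ultimately have "HT_A0 a b + HT_B0 a b = - (?u * ?u + b) / (b + ?u)" by simp
  moreover have "?u * ?u + b > 0" "b + ?u > 0" using u b by (simp_all add: add_pos_pos)
  ultimately show ?thesis by (simp add: divide_neg_pos)
qed

lemma HT_A0_pos:
  assumes b: "0 < b" "b < 1" and a: "a > (b + 1)^2 / (2 * (1 - b))"
  shows "HT_A0 a b > 0" and "0 < a"
proof -
  let ?u = "HT_u0 a b"
  have u: "?u > 0" and eq: "a * ?u = (1 - ?u) * (?u + b)" using HT_u0_root[OF b(1)] by blast+
  have "0 < (b + 1)^2 / (2 * (1 - b))" using b by simp
  then show "0 < a" using a by linarith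
  have *: "(b + 1)^2 < a * (2 * (1 - b))" using a b by (simp add: field_simps)
  have "2 * ?u < 1 - b"
  proof (rule ccontr)
    assume "\<not> ?thesis"
    then have ge: "1 - b \<le> 2 * ?u" by simp
    \<comment> \<open>the quadratic with root \<open>u0\<close> is increasing there, so its value at \<open>(1-b)/2\<close> would not be positive\<close>
    have "(1 - b) * (1 - b + 2 * (a + b - 1)) \<le> 2 * ?u * (2 * ?u + 2 * (a + b - 1))"
    proof -
      have "(2 * ?u - (1 - b)) * (2 * ?u + (1 - b) + 2 * (a + b - 1)) \<ge> 0"
        using ge \<open>0 < a\<close> b by (intro mult_nonneg_nonneg) auto
      then show ?thesis by (simp add: algebra_simps)
    qed
    also have "\<dots> = 4 * b" using eq by (simp add: algebra_simps)
    finally show False using * by (simp add: algebra_simps power2_eq_square)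
  qed
  then show "HT_A0 a b > 0" unfolding HT_A0_def using u b by simp
qed

definition HT_f_rest :: "real \<Rightarrow> real \<Rightarrow> real \<Rightarrow> real \<Rightarrow> real" where
  "HT_f_rest a b p q = - (p * p)
     + a * b / (HT_u0 a b + b)\<^sup>2 * (quadf (HT_u0 a b) (- (HT_u0 a b + b)) 0 p q / (HT_u0 a b + b + p))"

text \<open>Exact second order expansions: \<open>A0\<close>, \<open>B0\<close> and \<open>r\<close>, \<open>-r\<close> are the entries of the Jacobian,
and the remainders consist of quadratic forms and of quotients of quadratic forms by an affine function
of the first increment.\<close>

lemma HT_f_expand:
  assumes b: "0 < b" and ne: "HT_u0 a b + b + p \<noteq> 0"
  shows "HT_f a b (HT_u0 a b + p) (HT_u0 a b + q)
    = HT_A0 a b * p + HT_B0 a b * q + HT_f_rest a b p q"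
proof -
  define u where "u = HT_u0 a b"
  define c where "c = u + b"
  have u: "u > 0" and eq: "a * u = (1 - u) * c"
    using HT_u0_root[OF b, of a] by (auto simp: u_def c_def)
  have c: "c > 0" using u b by (simp add: c_def)
  have bc: "b = c - u" by (simp add: c_def)
  have ne': "c + p \<noteq> 0" using ne by (simp add: c_def u_def)
  have id: "c * c * ((u + p) * (1 - (u + p)) * (c + p) - a * (u + p) * (u + q))
      = c * (u * (1 - b - 2 * u) * p - a * u * q) * (c + p) - p * p * (c + p) * (c * c)
        + a * b * (u * (p * p) - c * (p * q))"
  proof -
    have "c * c * ((u + p) * (1 - (u + p)) * (c + p) - a * (u + p) * (u + q))
      - (c * (u * (1 - b - 2 * u) * p - a * u * q) * (c + p) - p * p * (c + p) * (c * c)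
        + a * b * (u * (p * p) - c * (p * q)))
      = c * c * ((u + p) * (1 - (u + p)) * (c + p)) - c * (u * (1 - c - u) * p) * (c + p)
        + p * p * (c + p) * (c * c) - (a * u) * (c * c * (u + p) + (c - u) * (p * p))"
      unfolding bc by (simp add: algebra_simps)
    also have "\<dots> = 0" unfolding eq by (simp add: algebra_simps)
    finally show ?thesis by simp
  qed
  have "HT_f a b (u + p) (u + q) = (c * c * ((u + p) * (1 - (u + p)) * (c + p) - a * (u + p) * (u + q))) / (c * c * (c + p))"
  proof -
    have "u + p + b = c + p" by (simp add: c_def)
    moreover have "X - Y / (c + p) = c * c * (X * (c + p) - Y) / (c * c * (c + p))" for X Y
      using c ne' by (simp add: diff_divide_distrib)
    ultimately show ?thesis unfolding HT_f_def by (simp only:)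
  qed
  also have "\<dots> = (u * (1 - b - 2 * u) * p - a * u * q) / c - p * p
      + a * b * (u * (p * p) - c * (p * q)) / (c * c * (c + p))"
  proof -
    have "c * S * (c + p) / (c * c * (c + p)) = S / c" for S using c ne' by simp
    moreover have "p * p * (c + p) * (c * c) / (c * c * (c + p)) = p * p" using c ne' by simp
    ultimately show ?thesis unfolding id by (simp only: add_divide_distrib[of "_ - _"] diff_divide_distrib[of "_ * (c + p)"])
  qed
  also have "\<dots> = HT_A0 a b * p + HT_B0 a b * q + HT_f_rest a b p q"
    unfolding HT_A0_def HT_B0_def HT_f_rest_def quadf_def u_def[symmetric] add.commute[of b] c_def[symmetric]
  proof -
    have "a * b * N / (c * c * (c + p)) = a * b / c\<^sup>2 * (N / (c + p))" for N
      by (simp add: power2_eq_square)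
    then show "(u * (1 - b - 2 * u) * p - a * u * q) / c - p * p
        + a * b * (u * (p * p) - c * (p * q)) / (c * c * (c + p))
      = u / c * (1 - b - 2 * u) * p + - (a * u / c) * q
        + (- (p * p) + a * b / c\<^sup>2 * ((u *\<^sub>R (p * p) + - c *\<^sub>R (p * q) + 0 *\<^sub>R (q * q)) / (c + p)))"
      by (simp add: diff_divide_distrib[of "_ * p"] power2_eq_square)
  qed
  finally show ?thesis by (simp add: u_def)
qed

lemma HT_g_expand:
  assumes ne: "HT_u0 a b + p \<noteq> 0"
  shows "HT_g r (HT_u0 a b + p) (HT_u0 a b + q)
    = r * (p - q + quadf (- 1) 2 (- 1) p q / (HT_u0 a b + p))"
proof -
  let ?u = "HT_u0 a b"
  have "(?u + q) * (1 - (?u + q) / (?u + p)) = p - q + quadf (- 1) 2 (- 1) p q / (?u + p)"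
    using ne unfolding quadf_def by (simp add: field_simps)
  then show ?thesis unfolding HT_g_def by (simp only: mult.assoc)
qed

text \<open>Characters of the algebra. Applied to point evaluations they translate the algebraic identities for the
difference quotients into statements about the kinetics at a point.\<close>

definition real_alg_hom :: "('a::{real_normed_algebra_1} \<Rightarrow> real) \<Rightarrow> bool" where
  "real_alg_hom h \<longleftrightarrow> h 1 = 1 \<and> (\<forall>x y. h (x + y) = h x + h y) \<and> (\<forall>x y. h (x * y) = h x * h y)
     \<and> (\<forall>c x. h (c *\<^sub>R x) = c * h x)"

lemma real_alg_homD:
  assumes "real_alg_hom h"
  shows "h 1 = 1" "h (x + y) = h x + h y" "h (x * y) = h x * h y" "h (c *\<^sub>R x) = c * h x"
    "h (of_real c) = c" "h (x - y) = h x - h y" "h 0 = 0"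
proof -
  show 1: "h 1 = 1" "h (x + y) = h x + h y" "h (x * y) = h x * h y" "h (c *\<^sub>R x) = c * h x" for x y c
    using assms by (simp_all add: real_alg_hom_def)
  show "h (of_real c) = c" by (simp add: of_real_def 1)
  have "h (x - y) = h (x + (- 1) *\<^sub>R y)" by simp
  also have "\<dots> = h x - h y" unfolding 1 by simp
  finally show "h (x - y) = h x - h y" .
  have "h 0 = h (0 *\<^sub>R 0)" by simp
  also have "\<dots> = 0" unfolding 1 by simp
  finally show "h 0 = 0" .
qed

lemma real_alg_hom_quadf:
  "real_alg_hom h \<Longrightarrow> h (quadf \<alpha> \<beta> \<gamma> p q) = quadf \<alpha> \<beta> \<gamma> (h p) (h q)"
  by (simp add: quadf_def real_alg_homD)

lemma real_alg_hom_inv_near: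
  assumes h: "real_alg_hom h" and "\<kappa> > 0" "norm p \<le> \<kappa> / 2"
  shows "\<kappa> + h p \<noteq> 0" and "h (inv_near \<kappa> p) = 1 / (\<kappa> + h p)"
proof -
  have "h (inv_near \<kappa> p) * (\<kappa> + h p) = h (inv_near \<kappa> p * (of_real \<kappa> + p))"
    using h by (simp add: real_alg_homD)
  also have "\<dots> = 1" using inv_near(1)[OF assms(2,3)] h by (simp add: real_alg_homD)
  finally have *: "h (inv_near \<kappa> p) * (\<kappa> + h p) = 1" .
  then show "\<kappa> + h p \<noteq> 0" by auto
  with * show "h (inv_near \<kappa> p) = 1 / (\<kappa> + h p)" by (simp add: field_simps)
qed

text \<open>Difference quotients of the nonlinear parts of the two kinetic terms; the factor \<open>r\<close> of the second one
is left out because \<open>r\<close> varies along the branch.\<close>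

definition HT_F ::
  "real \<Rightarrow> real \<Rightarrow> 'a::{real_normed_algebra_1,banach,comm_ring_1} \<Rightarrow> 'a \<Rightarrow> 'a \<Rightarrow> 'a \<Rightarrow> 'a \<Rightarrow> 'a" where
  "HT_F a b e p q y z = quad_dq (- 1) 0 0 e p q y z
     + (a * b / (HT_u0 a b + b)\<^sup>2) *\<^sub>R ratio_dq (HT_u0 a b + b) (HT_u0 a b) (- (HT_u0 a b + b)) 0 e p q y z"

definition HT_G ::
  "real \<Rightarrow> real \<Rightarrow> 'a::{real_normed_algebra_1,banach,comm_ring_1} \<Rightarrow> 'a \<Rightarrow> 'a \<Rightarrow> 'a \<Rightarrow> 'a \<Rightarrow> 'a" where
  "HT_G a b e p q y z = ratio_dq (HT_u0 a b) (- 1) 2 (- 1) e p q y z"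

lemma HT_FG_0 [simp]: "HT_F a b e p q 0 0 = 0" "HT_G a b e p q 0 0 = 0"
  by (simp_all add: HT_F_def HT_G_def)

lemma HT_FG_hom:
  fixes e :: "'a::{real_normed_algebra_1,banach,comm_ring_1}"
  assumes h: "real_alg_hom h" and b: "0 < b"
    and p: "norm p \<le> HT_u0 a b / 2" and py: "norm (p + e * y) \<le> HT_u0 a b / 2"
  shows "HT_f a b (HT_u0 a b + h (p + e * y)) (HT_u0 a b + h (q + e * z)) - HT_f a b (HT_u0 a b + h p) (HT_u0 a b + h q)
      = HT_A0 a b * h (e * y) + HT_B0 a b * h (e * z) + h e * h (HT_F a b e p q y z)"
    and "HT_g r (HT_u0 a b + h (p + e * y)) (HT_u0 a b + h (q + e * z)) - HT_g r (HT_u0 a b + h p) (HT_u0 a b + h q)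
      = r * (h (e * y) - h (e * z) + h e * h (HT_G a b e p q y z))"
proof -
  let ?u = "HT_u0 a b"
  let ?c = "?u + b"
  have u: "?u > 0" using HT_u0_root[OF b] by blast
  have c: "?c > 0" using u b by simp
  have "?u / 2 \<le> ?c / 2" using b by simp
  then have pc: "norm p \<le> ?c / 2" "norm (p + e * y) \<le> ?c / 2"
    using p py order_trans by blast+
  have 1: "h e * h (quad_dq \<alpha> \<beta> \<gamma> e p q y z) = quadf \<alpha> \<beta> \<gamma> (h (p + e * y)) (h (q + e * z)) - quadf \<alpha> \<beta> \<gamma> (h p) (h q)"
    for \<alpha> \<beta> \<gamma>
  proof -
    have "quadf \<alpha> \<beta> \<gamma> (h (p + e * y)) (h (q + e * z)) = h (quadf \<alpha> \<beta> \<gamma> p q + e * quad_dq \<alpha> \<beta> \<gamma> e p q y z)"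
      unfolding real_alg_hom_quadf[OF h, symmetric] quad_dq ..
    then show ?thesis by (simp add: real_alg_homD[OF h] real_alg_hom_quadf[OF h])
  qed
  have 2: "h e * h (ratio_dq \<kappa> \<alpha> \<beta> \<gamma> e p q y z)
     = quadf \<alpha> \<beta> \<gamma> (h (p + e * y)) (h (q + e * z)) / (\<kappa> + h (p + e * y)) - quadf \<alpha> \<beta> \<gamma> (h p) (h q) / (\<kappa> + h p)"
    if \<kappa>: "\<kappa> > 0" "norm p \<le> \<kappa> / 2" "norm (p + e * y) \<le> \<kappa> / 2" for \<kappa> \<alpha> \<beta> \<gamma>
  proof -
    have "h e * h (ratio_dq \<kappa> \<alpha> \<beta> \<gamma> e p q y z) = h (e * ratio_dq \<kappa> \<alpha> \<beta> \<gamma> e p q y z)"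
      by (simp add: real_alg_homD[OF h])
    then show ?thesis
      unfolding ratio_dq[OF \<kappa>]
      using real_alg_hom_inv_near(2)[OF h \<kappa>(1,2)] real_alg_hom_inv_near(2)[OF h \<kappa>(1,3)]
      by (simp add: real_alg_homD(3,6)[OF h] real_alg_hom_quadf[OF h])
  qed
  have ne: "?c + h p \<noteq> 0" "?c + h (p + e * y) \<noteq> 0" "?u + h p \<noteq> 0" "?u + h (p + e * y) \<noteq> 0"
    using real_alg_hom_inv_near(1)[OF h] u c p py pc by blast+
  have r: "h e * h (HT_F a b e p q y z) = HT_f_rest a b (h (p + e * y)) (h (q + e * z)) - HT_f_rest a b (h p) (h q)"
  proof -
    have "h e * h (HT_F a b e p q y z) = h e * h (quad_dq (- 1) 0 0 e p q y z)
       + (a * b / ?c\<^sup>2) * (h e * h (ratio_dq ?c ?u (- ?c) 0 e p q y z))"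
      unfolding HT_F_def by (simp only: real_alg_homD(2,4)[OF h] ring_distribs mult_ac)
    moreover have "quadf (- 1) 0 0 x y = - (x * x)" for x y :: real by (simp add: quadf_def)
    moreover have "- x - - y + k * (X - Y) = - x + k * X - (- y + k * Y)" for x y k X Y :: real
      by (simp add: algebra_simps)
    ultimately show ?thesis
      unfolding 1 2[OF c pc] HT_f_rest_def by (simp only:)
  qed
  show "HT_f a b (?u + h (p + e * y)) (?u + h (q + e * z)) - HT_f a b (?u + h p) (?u + h q)
      = HT_A0 a b * h (e * y) + HT_B0 a b * h (e * z) + h e * h (HT_F a b e p q y z)"
    unfolding r HT_f_expand[OF b ne(1)] HT_f_expand[OF b ne(2)]
    by (simp add: real_alg_homD(2)[OF h] distrib_left)
  show "HT_g r (?u + h (p + e * y)) (?u + h (q + e * z)) - HT_g r (?u + h p) (?u + h q)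
      = r * (h (e * y) - h (e * z) + h e * h (HT_G a b e p q y z))"
    unfolding HT_G_def 2[OF u p py] HT_g_expand[OF ne(3)] HT_g_expand[OF ne(4)]
    by (simp add: real_alg_homD(2)[OF h] right_diff_distrib[of r] distrib_left[of r])
qed

lemma HT_FG_lipschitz:
  assumes b: "0 < b"
  shows "\<exists>C \<eta>0. C > 0 \<and> \<eta>0 > 0 \<and> 2 * \<eta>0 \<le> HT_u0 a b / 2 \<and>
    (\<forall>\<eta> e p q y z y' z'. \<eta> \<le> \<eta>0 \<longrightarrow> norm p \<le> \<eta> \<longrightarrow> norm q \<le> \<eta> \<longrightarrow>
       norm e * norm y \<le> \<eta> \<longrightarrow> norm e * norm z \<le> \<eta> \<longrightarrow> norm e * norm y' \<le> \<eta> \<longrightarrow> norm e * norm z' \<le> \<eta> \<longrightarrow>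
       norm (HT_F a b e p q y z - HT_F a b e p q y' z') \<le> C * \<eta> * (norm (y - y') + norm (z - z')) \<and>
       norm (HT_G a b e p q y z - HT_G a b e p q y' (z'::'a::{real_normed_algebra_1,banach,comm_ring_1}))
         \<le> C * \<eta> * (norm (y - y') + norm (z - z')))"
proof -
  let ?u = "HT_u0 a b"
  let ?c = "?u + b"
  let ?k = "a * b / ?c\<^sup>2"
  have u: "?u > 0" using HT_u0_root[OF b] by blast
  have c: "?c > 0" using u b by simp
  define C1 where "C1 = ratio_lip ?c (\<bar>?u\<bar> + \<bar>- ?c\<bar> + \<bar>0\<bar>)"
  define C2 where "C2 = ratio_lip ?u (\<bar>- 1\<bar> + \<bar>2\<bar> + \<bar>- 1\<bar>)"
  have C1: "C1 \<ge> 0" and C2: "C2 \<ge> 0"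
    unfolding C1_def C2_def ratio_lip_def using u c by (auto intro!: add_nonneg_nonneg mult_nonneg_nonneg divide_nonneg_pos)
  define C where "C = 4 + \<bar>?k\<bar> * C1 + C2"
  define \<eta>0 where "\<eta>0 = min 1 (?u / 4)"
  have "C > 0" using C1 C2 by (simp add: C_def add_pos_nonneg)
  moreover have "\<eta>0 > 0" "2 * \<eta>0 \<le> ?u / 2" using u by (auto simp: \<eta>0_def)
  moreover have "norm (HT_F a b e p q y z - HT_F a b e p q y' z') \<le> C * \<eta> * (norm (y - y') + norm (z - z')) \<and>
       norm (HT_G a b e p q y z - HT_G a b e p q y' z') \<le> C * \<eta> * (norm (y - y') + norm (z - z'))"
    if \<eta>: "\<eta> \<le> \<eta>0" and p: "norm p \<le> \<eta>" "norm q \<le> \<eta>"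
      and e: "norm e * norm y \<le> \<eta>" "norm e * norm z \<le> \<eta>" "norm e * norm y' \<le> \<eta>" "norm e * norm z' \<le> \<eta>"
    for \<eta> and e p q y z y' z' :: 'a
  proof -
    let ?d = "norm (y - y') + norm (z - z')"
    have "?u / 2 \<le> ?c / 2" using b by simp
    moreover have "2 * \<eta> \<le> ?u / 2" "\<eta> \<le> 1" using \<eta> by (auto simp: \<eta>0_def)
    moreover have "0 \<le> \<eta>" using p(1) norm_ge_zero order_trans by blast
    ultimately have \<eta>: "2 * \<eta> \<le> ?u / 2" "2 * \<eta> \<le> ?c / 2" "\<eta> \<le> 1" "0 \<le> \<eta>"
      by (auto intro: order_trans)
    have \<eta>d: "0 \<le> \<eta> * ?d" using \<eta> by simp
    note S = quad_dq_lipschitz[OF p e, of "- 1" 0 0]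
      and R1 = ratio_dq_lipschitz[OF c \<eta>(2,3) p e, of ?u "- ?c" 0, folded C1_def]
      and R2 = ratio_dq_lipschitz[OF u \<eta>(1,3) p e, of "- 1" 2 "- 1", folded C2_def]
    have "HT_F a b e p q y z - HT_F a b e p q y' z'
        = (quad_dq (- 1) 0 0 e p q y z - quad_dq (- 1) 0 0 e p q y' z')
        + ?k *\<^sub>R (ratio_dq ?c ?u (- ?c) 0 e p q y z - ratio_dq ?c ?u (- ?c) 0 e p q y' z')"
      unfolding HT_F_def by (simp add: scaleR_diff_right)
    also have "norm \<dots> \<le> 4 * (\<bar>- 1\<bar> + \<bar>0\<bar> + \<bar>0\<bar>) * \<eta> * ?d + \<bar>?k\<bar> * (C1 * \<eta> * ?d)"
      by (rule norm_triangle_mono[OF S]) (use R1 in \<open>auto intro: mult_left_mono simp only: norm_scaleR\<close>)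
    also have "\<dots> = (4 + \<bar>?k\<bar> * C1) * (\<eta> * ?d)"
    proof -
      have "4 * (\<bar>- 1\<bar> + \<bar>0\<bar> + \<bar>0\<bar>) * \<eta> * d + k * (C1 * \<eta> * d) = (4 + k * C1) * (\<eta> * d)" for k d
        by (simp add: algebra_simps)
      then show ?thesis .
    qed
    also have "\<dots> \<le> C * (\<eta> * ?d)" using C2 by (intro mult_right_mono \<eta>d) (simp add: C_def)
    finally have 1: "norm (HT_F a b e p q y z - HT_F a b e p q y' z') \<le> C * \<eta> * ?d" by (simp add: mult.assoc)
    have "norm (HT_G a b e p q y z - HT_G a b e p q y' z') \<le> C2 * (\<eta> * ?d)"
      using R2 unfolding HT_G_def by (simp only: mult.assoc)
    also have "\<dots> \<le> C * (\<eta> * ?d)" using C1 by (intro mult_right_mono \<eta>d) (simp add: C_def)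
    finally show ?thesis using 1 by (simp add: mult.assoc)
  qed
  ultimately show ?thesis by (intro exI[of _ C] exI[of _ \<eta>0]) auto
qed

section \<open>Fourier multipliers and contractions\<close>

text \<open>Operators that act separately on each coefficient, as every constant coefficient operator does.\<close>

definition wmult :: "(int \<Rightarrow> 'a \<Rightarrow> 'a) \<Rightarrow> 'a::banach wiener \<Rightarrow> 'a wiener" where
  "wmult K f = Wiener (\<lambda>n. K n (coef f n))"

lemma wmult:
  assumes K: "\<And>n x. norm (K n x) \<le> C / (1 + (of_int n)\<^sup>2) * norm x" and even: "\<And>n. K (- n) = K n"
  shows "coef (wmult K f) n = K n (coef f n)" and "norm (wmult K f) \<le> C * norm f"
    and "C2coef (wmult K f)" and "norm (laplace (wmult K f)) \<le> C * norm f"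
proof -
  have C: "0 \<le> C * norm x" for x :: 'a
  proof -
    have "0 \<le> C / (1 + (of_int 0)\<^sup>2) * norm x" using K[of 0 x] norm_ge_zero order_trans by blast
    then show ?thesis by simp
  qed
  have le: "(1 + (of_int n)\<^sup>2) * norm (K n x) \<le> C * norm x" for n x
    using K[of n x] by (simp add: field_simps add_pos_nonneg)
  have le1: "norm (K n x) \<le> C * norm x" and le2: "(of_int n)\<^sup>2 * norm (K n x) \<le> C * norm x" for n x
  proof -
    have "norm (K n x) + (of_int n)\<^sup>2 * norm (K n x) \<le> C * norm x"
      using le[of n x] by (simp add: distrib_right)
    moreover have "0 \<le> (of_int n)\<^sup>2 * norm (K n x)" "0 \<le> norm (K n x)" by simp_all
    ultimately show "norm (K n x) \<le> C * norm x" "(of_int n)\<^sup>2 * norm (K n x) \<le> C * norm x"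
      by linarith+
  qed
  have fin: "(\<Sum>n\<in>F. C * norm (coef f n)) \<le> C * norm f" if "finite F" for F
  proof (cases "C \<ge> 0")
    case True
    then show ?thesis
      using sum_norm_coef_le[OF that, of f] by (simp add: sum_distrib_left[symmetric] mult_left_mono)
  next
    case False
    then have "norm (coef f n) = 0" for n
      using C[of "coef f n"] by (metis mult_nonneg_nonpos2 mult_neg_pos norm_ge_zero not_le order_antisym order_le_less)
    then have "f = 0" by (intro wiener_eqI) simp
    then show ?thesis by simp
  qed
  have Ke: "K (- n) (coef f (- n)) = K n (coef f n)" for n by (simp add: even)
  have fin1: "(\<Sum>n\<in>F. norm (K n (coef f n))) \<le> C * norm f" if "finite F" for F
    by (rule order_trans[OF sum_mono fin[OF that]]) (rule le1)
  have fin2: "(\<Sum>n\<in>F. norm (- (of_int n)\<^sup>2 *\<^sub>R K n (coef f n))) \<le> C * norm f" if "finite F" for F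
    by (rule order_trans[OF sum_mono fin[OF that]]) (use le2 in simp)
  show c: "coef (wmult K f) n = K n (coef f n)" for n
    unfolding wmult_def by (subst wiener_of_finite_bounds(1)[OF fin1 Ke]) simp_all
  show "norm (wmult K f) \<le> C * norm f"
    unfolding wmult_def by (rule wiener_of_finite_bounds(2)[OF fin1 Ke]) simp_all
  show "C2coef (wmult K f)"
    unfolding C2coef_def c
    by (rule nonneg_bdd_above_summable_on) (use fin2 in \<open>auto intro!: bdd_aboveI[of _ "C * norm f"]\<close>)
  show "norm (laplace (wmult K f)) \<le> C * norm f"
    unfolding laplace_def c
    by (rule wiener_of_finite_bounds(2)[OF fin2]) (simp_all add: even)
qed

lemma contraction_fixed_point:
  fixes \<Psi> :: "'a::banach \<Rightarrow> 'a"
  assumes \<tau>: "0 \<le> \<tau>"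
    and lip: "\<And>x y. norm x \<le> \<tau> \<Longrightarrow> norm y \<le> \<tau> \<Longrightarrow> norm (\<Psi> x - \<Psi> y) \<le> 1/2 * norm (x - y)"
    and 0: "norm (\<Psi> 0) \<le> \<tau> / 2"
  shows "\<exists>x. norm x \<le> \<tau> \<and> \<Psi> x = x"
proof -
  have "\<exists>!x\<in>cball 0 \<tau>. \<Psi> x = x"
  proof (rule Banach_fix[where c = "1/2"])
    show "complete (cball (0::'a) \<tau>)" by (simp add: complete_eq_closed)
    show "\<Psi> ` cball 0 \<tau> \<subseteq> cball 0 \<tau>"
    proof clarsimp
      fix x :: 'a assume x: "norm x \<le> \<tau>"
      have "norm (\<Psi> x) \<le> norm (\<Psi> x - \<Psi> 0) + norm (\<Psi> 0)" by (metis norm_triangle_sub add.commute)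
      also have "\<dots> \<le> 1/2 * norm (x - 0) + \<tau> / 2" using x \<tau> lip[of x 0] 0 by (intro add_mono) auto
      finally show "norm (\<Psi> x) \<le> \<tau>" using x by simp
    qed
    show "dist (\<Psi> x) (\<Psi> y) \<le> 1/2 * dist x y" if "x \<in> cball 0 \<tau>" "y \<in> cball 0 \<tau>" for x y
      using lip[of x y] that by (simp add: dist_norm)
  qed (use \<tau> in auto)
  then show ?thesis by auto
qed

lemma wmult_diff:
  assumes K: "\<And>n x. norm (K n x) \<le> C / (1 + (of_int n)\<^sup>2) * norm x" and even: "\<And>n. K (- n) = K n"
    and lin: "\<And>n x y. K n (x - y) = K n x - K n y"
  shows "wmult K (f - g) = wmult K f - wmult K g"
  by (rule wiener_eqI) (simp add: wmult(1)[OF K even] lin)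

lemma one_plus_square_pos: "0 < 1 + (x::real)\<^sup>2" "0 < (1 + (x::real)\<^sup>2)\<^sup>2"
proof -
  show "0 < 1 + x\<^sup>2" by (simp add: add_pos_nonneg)
  then show "0 < (1 + x\<^sup>2)\<^sup>2" by (rule zero_less_power)
qed

lemma C2coef_add:
  assumes "C2coef f" "C2coef g" shows "C2coef (f + g)"
proof -
  have "(\<lambda>n. (of_int n)\<^sup>2 * norm (coef f n) + (of_int n)\<^sup>2 * norm (coef g n)) summable_on UNIV"
    using assms unfolding C2coef_def by (rule summable_on_add)
  then show ?thesis unfolding C2coef_def
    by (rule summable_on_comparison_test)
       (auto intro!: mult_left_mono norm_triangle_ineq simp: distrib_left[symmetric])
qed

lemma C2coef_scaleR: "C2coef f \<Longrightarrow> C2coef (c *\<^sub>R f)"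
  unfolding C2coef_def
  using summable_on_cmult_right[of "\<lambda>n. (of_int n)\<^sup>2 * norm (coef f n)" UNIV "\<bar>c\<bar>"]
  by (simp add: mult.left_commute)

lemma laplace_add: "C2coef f \<Longrightarrow> C2coef g \<Longrightarrow> laplace (f + g) = laplace f + laplace g"
  by (rule wiener_eqI) (simp add: coef_laplace C2coef_add scaleR_add_right)

lemma laplace_scaleR: "C2coef f \<Longrightarrow> laplace (c *\<^sub>R f) = c *\<^sub>R laplace f"
  by (rule wiener_eqI) (simp add: coef_laplace C2coef_scaleR scaleR_left_commute)

lemma weval_hom: "real_alg_hom (\<lambda>f :: real wiener. weval f x)"
  unfolding real_alg_hom_def by (simp add: weval_one weval_add weval_mult weval_scaleR)

section \<open>The linearized steady state problem\<close>

lemma positive_lower_bound: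
  fixes g :: "nat \<Rightarrow> real"
  assumes "\<And>k. P k \<Longrightarrow> g k > 0" and "c > 0" and "\<And>k. k \<ge> N \<Longrightarrow> P k \<Longrightarrow> g k \<ge> c"
  shows "\<exists>\<kappa>>0. \<forall>k. P k \<longrightarrow> g k \<ge> \<kappa>"
proof -
  define \<kappa> where "\<kappa> = Min (insert c (g ` {k. k < N \<and> P k}))"
  have "\<kappa> > 0" unfolding \<kappa>_def using assms by (subst Min_gr_iff) auto
  moreover have "g k \<ge> \<kappa>" if "P k" for k
  proof (cases "k < N")
    case True
    then show ?thesis unfolding \<kappa>_def using that by (intro Min_le) auto
  next
    case False
    have "\<kappa> \<le> c" unfolding \<kappa>_def by (intro Min_le) auto
    with False assms(3)[of k] that show ?thesis by simp
  qed
  ultimately show ?thesis by blast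
qed

definition xval :: "real \<Rightarrow> int \<Rightarrow> real" where "xval l n = (of_int n)\<^sup>2 / l\<^sup>2"

lemma xval_minus [simp]: "xval l (- n) = xval l n" by (simp add: xval_def)

lemma xval_bounds:
  assumes "l > 0"
  shows "0 \<le> xval l n" and "xval l n \<le> (1 / l\<^sup>2) * (1 + (of_int n)\<^sup>2)"
    and "n \<noteq> 0 \<Longrightarrow> 1 + (of_int n)\<^sup>2 \<le> 2 * l\<^sup>2 * xval l n"
proof -
  show "0 \<le> xval l n" by (simp add: xval_def)
  show "xval l n \<le> (1 / l\<^sup>2) * (1 + (of_int n)\<^sup>2)"
    using assms by (simp add: xval_def field_simps)
  assume "n \<noteq> 0"
  then have "1 \<le> \<bar>of_int n :: real\<bar>" by linarith
  then have "1\<^sup>2 \<le> \<bar>of_int n :: real\<bar>\<^sup>2" by (intro power_mono) auto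
  then show "1 + (of_int n)\<^sup>2 \<le> 2 * l\<^sup>2 * xval l n"
    using assms by (simp add: xval_def)
qed

text \<open>Nonzero determinants grow like \<open>n\<^sup>4\<close> with a uniform constant: for large \<open>n\<close> the leading term
dominates, and only finitely many modes remain.\<close>

lemma determinant_lower_bound:
  fixes D :: "int \<Rightarrow> real"
  assumes l: "l > 0" and p: "p > 0" and s: "s \<ge> 0"
    and D: "\<And>n. D n = p * (xval l n)\<^sup>2 + q * xval l n + s"
    and ne: "\<And>n. \<bar>n\<bar> \<noteq> m \<Longrightarrow> D n \<noteq> 0"
  shows "\<exists>\<kappa>>0. \<forall>n. \<bar>n\<bar> \<noteq> m \<longrightarrow> \<bar>D n\<bar> \<ge> \<kappa> * (1 + (of_int n)\<^sup>2)\<^sup>2"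
proof -
  define c where "c = p / (8 * l ^ 4)"
  define N where "N = nat \<lceil>l * sqrt (2 * \<bar>q\<bar> / p)\<rceil> + 1"
  have c: "c > 0" using p l by (simp add: c_def)
  have big: "\<bar>D (int k)\<bar> / (1 + (of_int (int k))\<^sup>2)\<^sup>2 \<ge> c" if k: "k \<ge> N" for k
  proof -
    let ?x = "xval l (int k)"
    have "l * sqrt (2 * \<bar>q\<bar> / p) \<le> real k" using k unfolding N_def by linarith
    then have "(l * sqrt (2 * \<bar>q\<bar> / p))\<^sup>2 \<le> (real k)\<^sup>2" using l p by (intro power_mono) auto
    then have "2 * \<bar>q\<bar> / p \<le> ?x" using l p by (simp add: xval_def power_mult_distrib field_simps)
    then have "- q \<le> p / 2 * ?x" using p by (simp add: field_simps)
    then have "- q * ?x \<le> (p / 2 * ?x) * ?x" using xval_bounds(1)[OF l] by (intro mult_right_mono) auto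
    then have "p / 2 * ?x\<^sup>2 \<le> D (int k)" unfolding D using s by (simp add: power2_eq_square)
    moreover have "(1 + (of_int (int k))\<^sup>2)\<^sup>2 \<le> (2 * l\<^sup>2 * ?x)\<^sup>2"
      using xval_bounds(3)[OF l, of "int k"] k by (intro power_mono) (auto simp: N_def)
    then have "c * (1 + (of_int (int k))\<^sup>2)\<^sup>2 \<le> c * (2 * l\<^sup>2 * ?x)\<^sup>2"
      using c by (intro mult_left_mono) auto
    moreover have "c * (2 * l\<^sup>2 * ?x)\<^sup>2 = p / 2 * ?x\<^sup>2"
      using l by (simp add: c_def power_mult_distrib field_simps)
    ultimately have "c * (1 + (of_int (int k))\<^sup>2)\<^sup>2 \<le> \<bar>D (int k)\<bar>" by linarith
    moreover note one_plus_square_pos(2)[of "of_int (int k)"]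
    ultimately show ?thesis by (simp only: le_divide_eq if_True)
  qed
  have pos: "\<bar>D (int k)\<bar> / (1 + (of_int (int k))\<^sup>2)\<^sup>2 > 0" if "int k \<noteq> m" for k
  proof -
    note one_plus_square_pos(2)[of "of_int (int k)"]
    with ne[of "int k"] that show ?thesis by (intro divide_pos_pos) auto
  qed
  obtain \<kappa> where \<kappa>: "\<kappa> > 0" "\<And>k. int k \<noteq> m \<Longrightarrow> \<bar>D (int k)\<bar> / (1 + (of_int (int k))\<^sup>2)\<^sup>2 \<ge> \<kappa>"
    using positive_lower_bound[of "\<lambda>k. int k \<noteq> m" "\<lambda>k. \<bar>D (int k)\<bar> / (1 + (of_int (int k))\<^sup>2)\<^sup>2" c N] pos c big
    by blast
  have "\<bar>D n\<bar> \<ge> \<kappa> * (1 + (of_int n)\<^sup>2)\<^sup>2" if "\<bar>n\<bar> \<noteq> m" for n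
  proof -
    have eq: "D (int (nat \<bar>n\<bar>)) = D n" "(of_int (int (nat \<bar>n\<bar>)) :: real)\<^sup>2 = (of_int n)\<^sup>2"
      by (simp_all add: D xval_def)
    from one_plus_square_pos(2)[of "of_int n"] show ?thesis
      using \<kappa>(2)[of "nat \<bar>n\<bar>"] that unfolding eq by (simp add: le_divide_eq)
  qed
  with \<kappa>(1) show ?thesis by blast
qed

text \<open>The bordered linear problem: at the modes \<open>m\<close> and \<open>-m\<close> the matrix is singular, so the first component
is prescribed to vanish there and the parameter increment \<open>S3\<close>, which enters with the factor
\<open>g\<close>, takes its place as an unknown. Elsewhere the matrix is inverted by Cramer's rule, and the growth
of the determinant gives the gain of two derivatives.\<close>

lemma turing_solver:
  fixes m :: int
  assumes l: "l > 0" and m: "m > 0" and B: "B \<noteq> 0" and g: "g \<noteq> 0" and \<kappa>: "\<kappa> > 0"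
    and \<alpha>: "\<And>n. \<bar>\<alpha> n\<bar> \<le> C0 * (1 + (of_int n)\<^sup>2)" and \<gamma>: "\<And>n. \<bar>\<gamma> n\<bar> \<le> C0 * (1 + (of_int n)\<^sup>2)"
    and even: "\<And>n. \<alpha> (- n) = \<alpha> n" "\<And>n. \<gamma> (- n) = \<gamma> n"
    and D: "\<And>n. \<bar>n\<bar> \<noteq> m \<Longrightarrow> \<bar>\<alpha> n * \<gamma> n - B * r\<bar> \<ge> \<kappa> * (1 + (of_int n)\<^sup>2)\<^sup>2"
  shows "\<exists>S1 S2 S3 L. L > 0 \<and> (\<forall>(F :: real wiener) (G :: real wiener).
      (\<forall>n. \<alpha> n * coef (S1 F G) n + B * coef (S2 F G) n = coef F n) \<and>
      (\<forall>n. r * coef (S1 F G) n + \<gamma> n * coef (S2 F G) n + (if \<bar>n\<bar> = m then g * S3 F G else 0) = coef G n) \<and>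
      coef (S1 F G) m = 0 \<and>
      (\<forall>F' G'. S1 F G - S1 F' G' = S1 (F - F') (G - G') \<and> S2 F G - S2 F' G' = S2 (F - F') (G - G')
         \<and> S3 F G - S3 F' G' = S3 (F - F') (G - G')) \<and>
      norm (S1 F G) \<le> L * (norm F + norm G) \<and> norm (S2 F G) \<le> L * (norm F + norm G) \<and>
      \<bar>S3 F G\<bar> \<le> L * (norm F + norm G) \<and>
      C2coef (S1 F G) \<and> C2coef (S2 F G) \<and>
      norm (laplace (S1 F G)) \<le> L * (norm F + norm G) \<and> norm (laplace (S2 F G)) \<le> L * (norm F + norm G))"
proof -
  define d where "d n = \<alpha> n * \<gamma> n - B * r" for n
  define k11 where "k11 n = (if \<bar>n\<bar> = m then 0 else \<gamma> n / d n)" for n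
  define k12 where "k12 n = (if \<bar>n\<bar> = m then 0 else - B / d n)" for n
  define k21 where "k21 n = (if \<bar>n\<bar> = m then 1 / B else - r / d n)" for n
  define k22 where "k22 n = (if \<bar>n\<bar> = m then 0 else \<alpha> n / d n)" for n
  define C where "C = (C0 + \<bar>B\<bar> + \<bar>r\<bar>) / \<kappa> + (1 + (of_int m)\<^sup>2) / \<bar>B\<bar>"
  have sq: "1 \<le> 1 + (of_int n :: real)\<^sup>2" for n by simp
  have C0: "0 \<le> C0" using \<alpha>[of 0] by auto
  have d: "\<bar>d n\<bar> \<ge> \<kappa> * (1 + (of_int n)\<^sup>2)\<^sup>2" if "\<bar>n\<bar> \<noteq> m" for n using D[OF that] by (simp add: d_def)
  have d0: "d n \<noteq> 0" if "\<bar>n\<bar> \<noteq> m" for n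
  proof -
    have "\<kappa> * (1 + (of_int n)\<^sup>2)\<^sup>2 > 0" using \<kappa> one_plus_square_pos(2) by (rule mult_pos_pos)
    with d[OF that] show ?thesis by auto
  qed
  have quot: "\<bar>x\<bar> / \<bar>d n\<bar> \<le> C / (1 + (of_int n)\<^sup>2)"
    if n: "\<bar>n\<bar> \<noteq> m" and x: "\<bar>x\<bar> \<le> (C0 + \<bar>B\<bar> + \<bar>r\<bar>) * (1 + (of_int n)\<^sup>2)" for x n
  proof -
    let ?w = "1 + (of_int n :: real)\<^sup>2"
    have w: "?w > 0" by (rule one_plus_square_pos)
    have "\<bar>x\<bar> / \<bar>d n\<bar> \<le> ((C0 + \<bar>B\<bar> + \<bar>r\<bar>) * ?w) / (\<kappa> * ?w\<^sup>2)"
      by (rule frac_le) (use x d[OF n] \<kappa> w C0 in auto)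
    also have "\<dots> = ((C0 + \<bar>B\<bar> + \<bar>r\<bar>) / \<kappa>) / ?w"
      using w by (simp add: power2_eq_square)
    also have "\<dots> \<le> C / ?w"
      unfolding C_def using w by (intro divide_right_mono) auto
    finally show ?thesis .
  qed
  have le: "x \<le> (C0 + \<bar>B\<bar> + \<bar>r\<bar>) * (1 + (of_int n)\<^sup>2)"
    if "x \<le> C0 * (1 + (of_int n)\<^sup>2) \<or> x \<le> \<bar>B\<bar> \<or> x \<le> \<bar>r\<bar>" for x and n :: int
  proof -
    let ?w = "1 + (of_int n :: real)\<^sup>2"
    have "\<bar>B\<bar> * 1 \<le> \<bar>B\<bar> * ?w" "\<bar>r\<bar> * 1 \<le> \<bar>r\<bar> * ?w" by (intro mult_left_mono sq abs_ge_zero)+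
    moreover have "0 \<le> C0 * ?w" "0 \<le> \<bar>B\<bar> * ?w" "0 \<le> \<bar>r\<bar> * ?w" using C0 by auto
    ultimately show ?thesis unfolding distrib_right using that by linarith
  qed
  have C: "0 \<le> C" unfolding C_def using C0 \<kappa> by auto
  have b11: "\<bar>k11 n\<bar> \<le> C / (1 + (of_int n)\<^sup>2)" and b12: "\<bar>k12 n\<bar> \<le> C / (1 + (of_int n)\<^sup>2)"
    and b22: "\<bar>k22 n\<bar> \<le> C / (1 + (of_int n)\<^sup>2)" for n
    unfolding k11_def k12_def k22_def using C \<alpha>[of n] \<gamma>[of n] by (auto intro!: quot le)
  have b21: "\<bar>k21 n\<bar> \<le> C / (1 + (of_int n)\<^sup>2)" for n
  proof (cases "\<bar>n\<bar> = m")
    case True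
    then have nm: "(of_int n :: real)\<^sup>2 = (of_int m)\<^sup>2" by (metis of_int_abs power2_abs)
    have "(1 + (of_int m)\<^sup>2) / \<bar>B\<bar> / (1 + (of_int m)\<^sup>2) \<le> C / (1 + (of_int m)\<^sup>2)"
      unfolding C_def using C0 \<kappa> by (intro divide_right_mono) auto
    moreover have "(1 + (of_int m :: real)\<^sup>2) \<noteq> 0" using sq[of m] by linarith
    ultimately show ?thesis using True by (simp add: k21_def nm)
  next
    case False
    then show ?thesis unfolding k21_def by (auto intro!: quot le)
  qed
  define K where "K k n x = k n * x" for k :: "int \<Rightarrow> real" and n and x :: real
  have K: "norm (K k n x) \<le> C / (1 + (of_int n)\<^sup>2) * norm x"
    if "\<And>n. \<bar>k n\<bar> \<le> C / (1 + (of_int n)\<^sup>2)" for k n x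
    unfolding K_def real_norm_def abs_mult by (intro mult_right_mono that) auto
  have dev: "d (- n) = d n" for n by (simp add: d_def even)
  have Ke: "K k11 (- n) = K k11 n" "K k12 (- n) = K k12 n" "K k21 (- n) = K k21 n" "K k22 (- n) = K k22 n" for n
    by (rule ext, simp add: K_def k11_def k12_def k21_def k22_def dev even)+
  note W11 = wmult[OF K[OF b11] Ke(1)] and W12 = wmult[OF K[OF b12] Ke(2)]
    and W21 = wmult[OF K[OF b21] Ke(3)] and W22 = wmult[OF K[OF b22] Ke(4)]
  have lin: "K k n (x - y) = K k n x - K k n y" for k n x y by (simp add: K_def right_diff_distrib)
  note D11 = wmult_diff[OF K[OF b11] Ke(1) lin] and D12 = wmult_diff[OF K[OF b12] Ke(2) lin]
    and D21 = wmult_diff[OF K[OF b21] Ke(3) lin] and D22 = wmult_diff[OF K[OF b22] Ke(4) lin]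
  \<comment> \<open>the entries of the inverse matrices act as Fourier multipliers\<close>
  define S1 where "S1 F G = wmult (K k11) F + wmult (K k12) G" for F G
  define S2 where "S2 F G = wmult (K k21) F + wmult (K k22) G" for F G
  define S3 where "S3 F G = (coef G m - \<gamma> m / B * coef F m) / g" for F G :: "real wiener"
  define L where "L = C + 1 + (1 + \<bar>\<gamma> m / B\<bar>) / \<bar>g\<bar>"
  have L: "L > 0" and CL: "C \<le> L" "(1 + \<bar>\<gamma> m / B\<bar>) / \<bar>g\<bar> \<le> L"
    using C by (auto simp: L_def add_pos_nonneg add_nonneg_pos)
  have c1: "coef (S1 F G) n = k11 n * coef F n + k12 n * coef G n"
    and c2: "coef (S2 F G) n = k21 n * coef F n + k22 n * coef G n" for F G n
    by (simp_all add: S1_def S2_def W11(1) W12(1) W21(1) W22(1)) (simp_all add: K_def)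
  have e1: "\<alpha> n * coef (S1 F G) n + B * coef (S2 F G) n = coef F n" for F G n
  proof (cases "\<bar>n\<bar> = m")
    case True
    then show ?thesis using B by (simp add: c1 c2 k11_def k12_def k21_def k22_def)
  next
    case False
    have "\<alpha> n * (\<gamma> n / d n * x + - B / d n * y) + B * (- r / d n * x + \<alpha> n / d n * y) = d n * x / d n" for x y
      by (simp add: d_def add_divide_distrib[symmetric] diff_divide_distrib[symmetric] algebra_simps)
    with False d0[OF False] show ?thesis by (simp add: c1 c2 k11_def k12_def k21_def k22_def)
  qed
  have e2: "r * coef (S1 F G) n + \<gamma> n * coef (S2 F G) n + (if \<bar>n\<bar> = m then g * S3 F G else 0) = coef G n" for F G n
  proof (cases "\<bar>n\<bar> = m")
    case True
    then have "n = m \<or> n = - m" by linarith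
    then have "coef F n = coef F m" "coef G n = coef G m" "\<gamma> n = \<gamma> m" using even by auto
    then show ?thesis using True g by (simp add: c1 c2 k11_def k12_def k21_def k22_def S3_def)
  next
    case False
    have "r * (\<gamma> n / d n * x + - B / d n * y) + \<gamma> n * (- r / d n * x + \<alpha> n / d n * y) = d n * y / d n" for x y
      by (simp add: d_def add_divide_distrib[symmetric] diff_divide_distrib[symmetric] algebra_simps)
    with False d0[OF False] show ?thesis by (simp add: c1 c2 k11_def k12_def k21_def k22_def)
  qed
  have e3: "coef (S1 F G) m = 0" for F G using m by (simp add: c1 k11_def k12_def)
  have e4: "S1 F G - S1 F' G' = S1 (F - F') (G - G')" "S2 F G - S2 F' G' = S2 (F - F') (G - G')"
     "S3 F G - S3 F' G' = S3 (F - F') (G - G')" for F G F' G'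
  proof -
    have "(x - k * y) / g - (x' - k * y') / g = ((x - x') - k * (y - y')) / g" for k x y x' y' :: real
      by (simp add: diff_divide_distrib[symmetric] right_diff_distrib)
    then show "S3 F G - S3 F' G' = S3 (F - F') (G - G')" by (simp only: S3_def coef_diff)
  qed (simp_all add: S1_def S2_def D11 D12 D21 D22)
  have nn: "norm (x + y) \<le> L * (norm F + norm G)" if "norm x \<le> C * norm F" "norm y \<le> C * norm G"
    for x y F G :: "real wiener"
  proof -
    have "C * norm F \<le> L * norm F" "C * norm G \<le> L * norm G" by (intro mult_right_mono CL norm_ge_zero)+
    with that norm_triangle_ineq[of x y] show ?thesis unfolding distrib_left by linarith
  qed
  have e5: "norm (S1 F G) \<le> L * (norm F + norm G)" "norm (S2 F G) \<le> L * (norm F + norm G)" for F G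
    unfolding S1_def S2_def by (intro nn W11(2) W12(2) W21(2) W22(2))+
  have e6: "C2coef (S1 F G)" "C2coef (S2 F G)" for F G
    unfolding S1_def S2_def by (intro C2coef_add W11(3) W12(3) W21(3) W22(3))+
  have e7: "norm (laplace (S1 F G)) \<le> L * (norm F + norm G)" "norm (laplace (S2 F G)) \<le> L * (norm F + norm G)" for F G
    unfolding S1_def S2_def laplace_add[OF W11(3) W12(3)] laplace_add[OF W21(3) W22(3)]
    by (intro nn W11(4) W12(4) W21(4) W22(4))+
  have e8: "\<bar>S3 F G\<bar> \<le> L * (norm F + norm G)" for F G
  proof -
    have "\<bar>coef G m - \<gamma> m / B * coef F m\<bar> \<le> \<bar>coef G m\<bar> + \<bar>\<gamma> m / B\<bar> * \<bar>coef F m\<bar>"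
      unfolding abs_mult[symmetric] by (rule abs_triangle_ineq4)
    also have "\<dots> \<le> norm G + \<bar>\<gamma> m / B\<bar> * norm F"
      using norm_coef_le[of G m] norm_coef_le[of F m] by (intro add_mono mult_left_mono) auto
    also have "\<dots> \<le> (1 + \<bar>\<gamma> m / B\<bar>) * (norm F + norm G)"
    proof -
      have "0 \<le> \<bar>\<gamma> m / B\<bar> * norm G" by (intro mult_nonneg_nonneg) auto
      then show ?thesis by (simp only: ring_distribs) simp
    qed
    finally have "\<bar>S3 F G\<bar> \<le> (1 + \<bar>\<gamma> m / B\<bar>) * (norm F + norm G) / \<bar>g\<bar>"
      unfolding S3_def abs_divide by (intro divide_right_mono) auto
    also have "\<dots> = (1 + \<bar>\<gamma> m / B\<bar>) / \<bar>g\<bar> * (norm F + norm G)" by simp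
    also have "\<dots> \<le> L * (norm F + norm G)" by (intro mult_right_mono CL) auto
    finally show ?thesis .
  qed
  show ?thesis
    by (rule exI[of _ S1], rule exI[of _ S2], rule exI[of _ S3], rule exI[of _ L])
       (intro conjI allI L e1 e2 e3 e4 e5 e6 e7 e8)
qed

section \<open>The bifurcating branch\<close>

lemma weval_of_real: "weval (of_real c :: real wiener) x = c"
  using real_alg_homD(5)[OF weval_hom] .

lemma weval_injective:
  fixes f :: "real wiener"
  assumes l: "l > 0" and "\<And>x. x \<in> {0..l * pi} \<Longrightarrow> weval f (x / l) = weval g (x / l)"
  shows "f = g"
proof -
  have "weval (f - g) y = 0" if "y \<in> {0..pi}" for y
    using assms(2)[of "l * y"] that l by (simp add: weval_diff)
  from coef_eq_0_if_weval_eq_0[OF this] have "coef (f - g) n = 0" for n by blast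
  then show ?thesis by (intro wiener_eqI) simp
qed

lemma HT_constant_zero:
  assumes "0 < b" shows "HT_f a b (HT_u0 a b) (HT_u0 a b) = 0" and "HT_g r (HT_u0 a b) (HT_u0 a b) = 0"
  using HT_f_expand[of b a 0 0] HT_g_expand[of a b 0 r 0] HT_u0_root[OF assms, of a] assms
  by (simp_all add: HT_f_rest_def quadf_def)

lemma HT_constant_steady_state:
  assumes l: "l > 0" and b: "0 < b"
  shows "HT_steady_state a b d1 d2 r l (\<lambda>_. HT_u0 a b) (\<lambda>_. HT_v0 a b)"
  unfolding HT_steady_state_def HT_v0_def
  using neumann_C2_const[OF l] HT_constant_zero(1)[OF b, of a] HT_constant_zero(2)[OF b, of r a]
    HT_u0_root[OF b, of a] by auto

lemma small_factor:
  fixes M :: real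
  assumes "\<delta> > 0" shows "\<exists>s0>0. \<forall>s. 0 < s \<and> s \<le> s0 \<longrightarrow> s * M \<le> \<delta>"
proof (intro exI conjI allI impI)
  show "\<delta> / (\<bar>M\<bar> + 1) > 0" using assms by (simp add: add_nonneg_pos)
  fix s assume s: "0 < s \<and> s \<le> \<delta> / (\<bar>M\<bar> + 1)"
  have "s * M \<le> s * (\<bar>M\<bar> + 1)" using s by (intro mult_left_mono) auto
  also have "\<dots> \<le> \<delta>" using s by (simp add: pos_le_divide_eq add_nonneg_pos)
  finally show "s * M \<le> \<delta>" .
qed

text \<open>Bifurcation from a simple eigenvalue. Seek \<open>u = u0 + s (\<Phi>1 + y)\<close>, \<open>v = u0 + s (\<Phi>2 + z)\<close> and the
parameter \<open>r + \<rho>\<close>, with the kernel \<open>(\<Phi>1, \<Phi>2)\<close> of the linearization. After division by \<open>s\<close>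
the nonlinear terms have Lipschitz constant of order \<open>s\<close>, and the term \<open>\<rho> (y - z)\<close> is quadratic, so that the
bordered solver yields a contraction on a small ball for small \<open>s\<close>. The hypothesis \<open>transv\<close> makes
\<open>r\<close>-differentiation of the operator move the kernel out of the range. Since the coefficient of
mode \<open>m\<close> in \<open>\<Phi>1 + y\<close> is \<open>1\<close>, the solution is not constant.\<close>

lemma turing_branch:
  fixes m :: int
  assumes b: "0 < b" and a: "0 < a" and d: "0 < d1" "0 < d2" and l: "0 < l" and r: "0 < r" and m: "0 < m"
    and \<alpha>_def: "\<alpha> = (\<lambda>n. HT_A0 a b - d1 * xval l n)" and \<gamma>_def: "\<gamma> = (\<lambda>n. - (r + d2 * xval l n))"
    and ker: "\<alpha> m * \<gamma> m - HT_B0 a b * r = 0"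
    and inv: "\<And>n. \<bar>n\<bar> \<noteq> m \<Longrightarrow> \<alpha> n * \<gamma> n - HT_B0 a b * r \<noteq> 0"
    and transv: "\<alpha> m + HT_B0 a b < 0"
    and \<epsilon>: "\<epsilon> > 0"
  shows "\<exists>r' U V. HT_bif_solution a b d1 d2 l r \<epsilon> r' U V"
proof -
  let ?u = "HT_u0 a b" and ?A = "HT_A0 a b" and ?B = "HT_B0 a b"
  have u: "?u > 0" using HT_u0_root[OF b] by blast
  have B: "?B < 0" using HT_B0_neg[OF b a] .
  define \<phi> where "\<phi> = - \<alpha> m / ?B"
  define g where "g = 1 - \<phi>"
  have Bg: "?B * g = ?B + \<alpha> m" using B by (simp add: g_def \<phi>_def right_diff_distrib distrib_left)
  then have g: "g \<noteq> 0" using transv by auto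
  \<comment> \<open>\<open>(1, \<phi>)\<close> spans the kernel of the linearization at mode \<open>m\<close>\<close>
  have k1: "\<alpha> m + ?B * \<phi> = 0" using B by (simp add: \<phi>_def)
  have k2: "r + \<gamma> m * \<phi> = 0"
  proof -
    have "?B * (r + \<gamma> m * \<phi>) = 0" using ker k1 by (simp add: algebra_simps \<phi>_def)
    then show ?thesis using B by simp
  qed
  have \<alpha>\<gamma>: "\<alpha> n * \<gamma> n - ?B * r
      = (d1 * d2) * (xval l n)\<^sup>2 + (d1 * r - d2 * ?A) * xval l n + (- (?A + ?B) * r)" for n
    unfolding \<alpha>_def \<gamma>_def by (simp add: algebra_simps power2_eq_square)
  obtain \<kappa> where \<kappa>: "\<kappa> > 0" "\<And>n. \<bar>n\<bar> \<noteq> m \<Longrightarrow> \<bar>\<alpha> n * \<gamma> n - ?B * r\<bar> \<ge> \<kappa> * (1 + (of_int n)\<^sup>2)\<^sup>2"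
    using determinant_lower_bound[OF l _ _ \<alpha>\<gamma> inv] d HT_A0_B0_neg[OF b, of a] r
    by (auto simp: mult_nonpos_nonneg less_imp_le)
  define C0 where "C0 = \<bar>?A\<bar> + r + (d1 + d2) / l\<^sup>2"
  have C0: "\<bar>\<alpha> n\<bar> \<le> C0 * (1 + (of_int n)\<^sup>2)" "\<bar>\<gamma> n\<bar> \<le> C0 * (1 + (of_int n)\<^sup>2)" for n
  proof -
    let ?w = "1 + (of_int n :: real)\<^sup>2"
    have "\<bar>?A\<bar> * 1 \<le> \<bar>?A\<bar> * ?w" "r * 1 \<le> r * ?w" using r by (intro mult_left_mono; simp)+
    moreover have "d1 * xval l n \<le> d1 * (1 / l\<^sup>2 * ?w)" "d2 * xval l n \<le> d2 * (1 / l\<^sup>2 * ?w)"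
      using d by (intro mult_left_mono xval_bounds l; simp)+
    moreover have "C0 * ?w = \<bar>?A\<bar> * ?w + r * ?w + d1 * (1 / l\<^sup>2 * ?w) + d2 * (1 / l\<^sup>2 * ?w)"
    proof -
      have "(x + r + (d1 + d2) * k) * w = x * w + r * w + d1 * (k * w) + d2 * (k * w)" for x k w :: real
        by (simp add: algebra_simps)
      from this[of _ "1 / l\<^sup>2"] show ?thesis unfolding C0_def by simp
    qed
    moreover have "0 \<le> d1 * xval l n" "0 \<le> d2 * xval l n" "0 \<le> d1 * (1 / l\<^sup>2 * ?w)" "0 \<le> d2 * (1 / l\<^sup>2 * ?w)"
      using d xval_bounds(1)[OF l] by auto
    moreover have "\<bar>\<alpha> n\<bar> \<le> \<bar>?A\<bar> + d1 * xval l n" "\<bar>\<gamma> n\<bar> \<le> r + d2 * xval l n"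
    proof -
      have "0 \<le> d1 * xval l n" "0 \<le> d2 * xval l n" using d xval_bounds(1)[OF l] by auto
      then show "\<bar>\<alpha> n\<bar> \<le> \<bar>?A\<bar> + d1 * xval l n" "\<bar>\<gamma> n\<bar> \<le> r + d2 * xval l n"
        unfolding \<alpha>_def \<gamma>_def using r by linarith+
    qed
    ultimately show "\<bar>\<alpha> n\<bar> \<le> C0 * ?w" "\<bar>\<gamma> n\<bar> \<le> C0 * ?w" using r by linarith+
  qed
  obtain S1 S2 S3 L0 where L0: "L0 > 0" and S: "\<And>(F :: real wiener) (G :: real wiener).
      (\<forall>n. \<alpha> n * coef (S1 F G) n + ?B * coef (S2 F G) n = coef F n) \<and>
      (\<forall>n. r * coef (S1 F G) n + \<gamma> n * coef (S2 F G) n + (if \<bar>n\<bar> = m then g * S3 F G else 0) = coef G n) \<and>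
      coef (S1 F G) m = 0 \<and>
      (\<forall>F' G'. S1 F G - S1 F' G' = S1 (F - F') (G - G') \<and> S2 F G - S2 F' G' = S2 (F - F') (G - G')
         \<and> S3 F G - S3 F' G' = S3 (F - F') (G - G')) \<and>
      norm (S1 F G) \<le> L0 * (norm F + norm G) \<and> norm (S2 F G) \<le> L0 * (norm F + norm G) \<and>
      \<bar>S3 F G\<bar> \<le> L0 * (norm F + norm G) \<and>
      C2coef (S1 F G) \<and> C2coef (S2 F G) \<and>
      norm (laplace (S1 F G)) \<le> L0 * (norm F + norm G) \<and> norm (laplace (S2 F G)) \<le> L0 * (norm F + norm G)"
    using turing_solver[OF l m _ g \<kappa>(1) C0 _ _ \<kappa>(2)] B by (auto simp: \<alpha>_def \<gamma>_def)
  obtain C \<eta>0 where C: "C > 0" and \<eta>0: "\<eta>0 > 0" "2 * \<eta>0 \<le> ?u / 2" and lip: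
    "\<And>\<eta> (e :: real wiener) p q y z y' z'. \<eta> \<le> \<eta>0 \<Longrightarrow> norm p \<le> \<eta> \<Longrightarrow> norm q \<le> \<eta> \<Longrightarrow>
       norm e * norm y \<le> \<eta> \<Longrightarrow> norm e * norm z \<le> \<eta> \<Longrightarrow> norm e * norm y' \<le> \<eta> \<Longrightarrow> norm e * norm z' \<le> \<eta> \<Longrightarrow>
       norm (HT_F a b e p q y z - HT_F a b e p q y' z') \<le> C * \<eta> * (norm (y - y') + norm (z - z')) \<and>
       norm (HT_G a b e p q y z - HT_G a b e p q y' z') \<le> C * \<eta> * (norm (y - y') + norm (z - z'))"
    using HT_FG_lipschitz[OF b, of a] by blast
  define \<Phi>1 where "\<Phi>1 = (wmode m 1 :: real wiener)"
  define \<Phi>2 where "\<Phi>2 = (wmode m \<phi> :: real wiener)"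
  define R where "R = 3 + 2 * \<bar>\<phi>\<bar>"
  have R: "R > 0" by (simp add: R_def)
  have \<Phi>: "norm \<Phi>1 + 1 \<le> R" "norm \<Phi>2 + 1 \<le> R"
    using norm_wmode[of m "1::real"] norm_wmode[of m \<phi>] by (auto simp: R_def \<Phi>1_def \<Phi>2_def)
  define L where "L = 3 * L0"
  have L: "L > 0" using L0 by (simp add: L_def)
  define M where "M = norm (laplace \<Phi>1) + norm (laplace \<Phi>2) + L0 * (C * \<eta>0 * (2 * R) * (r + 2) + 2) + R"
  \<comment> \<open>the radius of the ball for \<open>(y, z, \<rho>)\<close>: it also keeps \<open>r + \<rho>\<close> positive and \<open>\<epsilon>\<close>-close to \<open>r\<close>\<close>
  define \<tau> where "\<tau> = min (1 / (16 * L)) (min 1 (min (r / 2) (\<epsilon> / 2)))"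
  have \<tau>: "0 < \<tau>" "\<tau> \<le> 1" "\<tau> < r" "\<tau> < \<epsilon>" "L * (4 * \<tau>) \<le> 1 / 4"
  proof -
    show "0 < \<tau>" "\<tau> \<le> 1" "\<tau> < r" "\<tau> < \<epsilon>" using L r \<epsilon> by (auto simp: \<tau>_def)
    have "\<tau> \<le> 1 / (16 * L)" by (simp add: \<tau>_def)
    then show "L * (4 * \<tau>) \<le> 1 / 4" using L by (simp add: field_simps)
  qed
  \<comment> \<open>the amplitude is chosen after the radius: \<open>s1\<close> for the domain of the kinetics, \<open>s2\<close> and \<open>s3\<close> for the contraction, \<open>s4\<close> for closeness to the constant state\<close>
  obtain s1 where s1: "s1 > 0" "\<And>s. 0 < s \<Longrightarrow> s \<le> s1 \<Longrightarrow> s * R \<le> \<eta>0"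
    using small_factor[OF \<eta>0(1), of R] by blast
  obtain s2 where s2: "s2 > 0" "\<And>s. 0 < s \<Longrightarrow> s \<le> s2 \<Longrightarrow> s * (R * (L * C * (2 * (r + 2) + 2 * R))) \<le> 1 / 4"
    using small_factor[of "1/4" "R * (L * C * (2 * (r + 2) + 2 * R))"] by auto
  obtain s3 where s3: "s3 > 0" "\<And>s. 0 < s \<Longrightarrow> s \<le> s3 \<Longrightarrow> s * (R * (L * (1 + r) * C * (2 * R))) \<le> \<tau> / 2"
    using small_factor[of "\<tau> / 2" "R * (L * (1 + r) * C * (2 * R))"] \<tau> by auto
  obtain s4 where s4: "s4 > 0" "\<And>s. 0 < s \<Longrightarrow> s \<le> s4 \<Longrightarrow> s * (M * (1 + 1 / l + 1 / l\<^sup>2)) \<le> min (\<epsilon> / 2) (?u / 2)"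
    using small_factor[of "min (\<epsilon> / 2) (?u / 2)" "M * (1 + 1 / l + 1 / l\<^sup>2)"] \<epsilon> u by auto
  define s where "s = min (min s1 s2) (min s3 s4)"
  have s: "0 < s" "s * R \<le> \<eta>0" "s * (R * (L * C * (2 * (r + 2) + 2 * R))) \<le> 1 / 4"
     "s * (R * (L * (1 + r) * C * (2 * R))) \<le> \<tau> / 2" "s * (M * (1 + 1 / l + 1 / l\<^sup>2)) \<le> min (\<epsilon> / 2) (?u / 2)"
    using s1 s2 s3 s4 by (auto simp: s_def)
  define \<eta> where "\<eta> = s * R"
  have \<eta>: "0 \<le> \<eta>" "\<eta> \<le> \<eta>0" using s R by (auto simp: \<eta>_def)
  define e where "e = (of_real s :: real wiener)"
  have ne: "norm e = s" using s by (simp add: e_def)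
  let ?F = "\<lambda>y z. HT_F a b e 0 0 (\<Phi>1 + y) (\<Phi>2 + z)" and ?G = "\<lambda>y z. HT_G a b e 0 0 (\<Phi>1 + y) (\<Phi>2 + z)"
  have Y: "norm (\<Phi>1 + y) \<le> R" "norm (\<Phi>2 + y) \<le> R" if "norm y \<le> \<tau>" for y
    using norm_triangle_ineq[of \<Phi>1 y] norm_triangle_ineq[of \<Phi>2 y] \<Phi> that \<tau> by linarith+
  have eY: "norm e * norm (\<Phi>1 + y) \<le> \<eta>" "norm e * norm (\<Phi>2 + y) \<le> \<eta>" if "norm y \<le> \<tau>" for y
    unfolding ne \<eta>_def using Y[OF that] s by (auto intro: mult_left_mono)
  have FG: "norm (?F y z - ?F y' z') \<le> C * \<eta> * (norm (y - y') + norm (z - z'))"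
           "norm (?G y z - ?G y' z') \<le> C * \<eta> * (norm (y - y') + norm (z - z'))"
    if "norm y \<le> \<tau>" "norm z \<le> \<tau>" "norm y' \<le> \<tau>" "norm z' \<le> \<tau>" for y z y' z'
    using lip[OF \<eta>(2), of 0 0 e "\<Phi>1 + y" "\<Phi>2 + z" "\<Phi>1 + y'" "\<Phi>2 + z'"] eY that \<eta> by auto
  have FG0: "norm (?F y z) \<le> C * \<eta> * (2 * R)" "norm (?G y z) \<le> C * \<eta> * (2 * R)"
    if "norm y \<le> \<tau>" "norm z \<le> \<tau>" for y z
  proof -
    have "norm (?F y z) \<le> C * \<eta> * (norm (\<Phi>1 + y) + norm (\<Phi>2 + z))"
         "norm (?G y z) \<le> C * \<eta> * (norm (\<Phi>1 + y) + norm (\<Phi>2 + z))"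
      using lip[OF \<eta>(2), of 0 0 e "\<Phi>1 + y" "\<Phi>2 + z" 0 0] eY that \<eta> by auto
    moreover have "C * \<eta> * (norm (\<Phi>1 + y) + norm (\<Phi>2 + z)) \<le> C * \<eta> * (2 * R)"
      using Y(1)[OF that(1)] Y(2)[OF that(2)] C \<eta> by (intro mult_left_mono) auto
    ultimately show "norm (?F y z) \<le> C * \<eta> * (2 * R)" "norm (?G y z) \<le> C * \<eta> * (2 * R)" by linarith+
  qed
  define f1 where "f1 y z = - ?F y z" for y z
  define f2 where "f2 y z \<rho> = - ((r + \<rho>) *\<^sub>R ?G y z) - \<rho> *\<^sub>R (y - z)" for y z \<rho>
  define \<Psi> where "\<Psi> X = (case X of (y, z, \<rho>) \<Rightarrow>
      (S1 (f1 y z) (f2 y z \<rho>), S2 (f1 y z) (f2 y z \<rho>), S3 (f1 y z) (f2 y z \<rho>)))"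
    for X :: "real wiener \<times> real wiener \<times> real"
  have comp: "norm y \<le> norm (y, z, \<rho>)" "norm z \<le> norm (y, z, \<rho>)" "\<bar>\<rho>\<bar> \<le> norm (y, z, \<rho>)"
    for y z :: "real wiener" and \<rho> :: real
    using norm_fst_le[of y "(z, \<rho>)"] norm_snd_le[of "(z, \<rho>)" y] norm_fst_le[of z \<rho>] norm_snd_le[of \<rho> z]
    by auto
  have trip: "norm (S1 P Q, S2 P Q, S3 P Q) \<le> L * (norm P + norm Q)" for P Q
    using norm_Pair_le[of "S1 P Q" "(S2 P Q, S3 P Q)"] norm_Pair_le[of "S2 P Q" "S3 P Q"] S[of P Q]
    by (simp add: L_def)
  have f2_le: "norm (f2 y z \<rho>) \<le> (r + 1) * (C * \<eta> * (2 * R)) + \<tau> * (2 * \<tau>)"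
    if "norm y \<le> \<tau>" "norm z \<le> \<tau>" "\<bar>\<rho>\<bar> \<le> \<tau>" for y z \<rho>
  proof -
    have "norm (f2 y z \<rho>) \<le> \<bar>r + \<rho>\<bar> * norm (?G y z) + \<bar>\<rho>\<bar> * norm (y - z)"
      unfolding f2_def by (rule order_trans[OF norm_triangle_ineq4]) simp
    also have "\<dots> \<le> (r + 1) * (C * \<eta> * (2 * R)) + \<tau> * (2 * \<tau>)"
      using that \<tau> r FG0(2)[OF that(1,2)] norm_triangle_ineq4[of y z]
      by (intro add_mono mult_mono) auto
    finally show ?thesis .
  qed
  have "\<exists>X. norm X \<le> \<tau> \<and> \<Psi> X = X"
  proof (rule contraction_fixed_point)
    show "0 \<le> \<tau>" using \<tau> by simp
    fix X X' :: "real wiener \<times> real wiener \<times> real"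
    assume X: "norm X \<le> \<tau>" and X': "norm X' \<le> \<tau>"
    obtain y z \<rho> where Xe: "X = (y, z, \<rho>)" by (cases X) auto
    obtain y' z' \<rho>' where Xe': "X' = (y', z', \<rho>')" by (cases X') auto
    define N where "N = norm (X - X')"
    have N: "norm (y - y') \<le> N" "norm (z - z') \<le> N" "\<bar>\<rho> - \<rho>'\<bar> \<le> N"
      using comp[where y = "y - y'" and z = "z - z'" and \<rho> = "\<rho> - \<rho>'"] by (simp_all add: N_def Xe Xe')
    have "0 \<le> N" by (simp add: N_def)
    have bd: "norm y \<le> \<tau>" "norm z \<le> \<tau>" "\<bar>\<rho>\<bar> \<le> \<tau>" "norm y' \<le> \<tau>" "norm z' \<le> \<tau>" "\<bar>\<rho>'\<bar> \<le> \<tau>"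
      using comp[where y = y and z = z and \<rho> = \<rho>] comp[where y = y' and z = z' and \<rho> = \<rho>'] X X' by (auto simp: Xe Xe')
    have C\<eta>: "0 \<le> C * \<eta>" using C \<eta> by simp
    have dN: "C * \<eta> * (norm (y - y') + norm (z - z')) \<le> C * \<eta> * (2 * N)"
      using N C\<eta> by (intro mult_left_mono) auto
    have d1: "norm (f1 y z - f1 y' z') \<le> C * \<eta> * (2 * N)"
      using FG(1)[OF bd(1,2,4,5)] dN unfolding f1_def by (simp add: norm_minus_commute)
    have d2: "norm (f2 y z \<rho> - f2 y' z' \<rho>') \<le> (r + 1) * (C * \<eta> * (2 * N)) + N * (C * \<eta> * (2 * R)) + \<tau> * (2 * N) + N * (2 * \<tau>)"
    proof -
      have "f2 y z \<rho> - f2 y' z' \<rho>' = - ((r + \<rho>) *\<^sub>R (?G y z - ?G y' z') + (\<rho> - \<rho>') *\<^sub>R ?G y' z'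
          + \<rho> *\<^sub>R ((y - y') - (z - z')) + (\<rho> - \<rho>') *\<^sub>R (y' - z'))"
        unfolding f2_def by (simp add: algebra_simps)
      also have "norm \<dots> \<le> \<bar>r + \<rho>\<bar> * norm (?G y z - ?G y' z') + \<bar>\<rho> - \<rho>'\<bar> * norm (?G y' z')
          + \<bar>\<rho>\<bar> * norm ((y - y') - (z - z')) + \<bar>\<rho> - \<rho>'\<bar> * norm (y' - z')"
        unfolding norm_minus_cancel by (intro norm_triangle_mono) simp_all
      also have "\<dots> \<le> (r + 1) * (C * \<eta> * (2 * N)) + N * (C * \<eta> * (2 * R)) + \<tau> * (2 * N) + N * (2 * \<tau>)"
      proof (intro add_mono mult_mono)
        show "norm (?G y z - ?G y' z') \<le> C * \<eta> * (2 * N)" using FG(2)[OF bd(1,2,4,5)] dN by linarith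
        show "norm (?G y' z') \<le> C * \<eta> * (2 * R)" by (rule FG0(2)[OF bd(4,5)])
        show "norm ((y - y') - (z - z')) \<le> 2 * N" using norm_triangle_ineq4[of "y - y'" "z - z'"] N by linarith
        show "norm (y' - z') \<le> 2 * \<tau>" using norm_triangle_ineq4[of y' z'] bd by linarith
      qed (use N bd \<tau> r \<open>0 \<le> N\<close> in auto)
      finally show ?thesis .
    qed
    have "norm (\<Psi> X - \<Psi> X') = norm (S1 (f1 y z - f1 y' z') (f2 y z \<rho> - f2 y' z' \<rho>'),
        S2 (f1 y z - f1 y' z') (f2 y z \<rho> - f2 y' z' \<rho>'), S3 (f1 y z - f1 y' z') (f2 y z \<rho> - f2 y' z' \<rho>'))"
      using S by (simp add: \<Psi>_def Xe Xe')
    also have "\<dots> \<le> L * (norm (f1 y z - f1 y' z') + norm (f2 y z \<rho> - f2 y' z' \<rho>'))" by (rule trip)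
    also have "\<dots> \<le> L * (C * \<eta> * (2 * N) + ((r + 1) * (C * \<eta> * (2 * N)) + N * (C * \<eta> * (2 * R)) + \<tau> * (2 * N) + N * (2 * \<tau>)))"
      using L by (intro mult_left_mono add_mono d1 d2) auto
    also have "\<dots> = (s * (R * (L * C * (2 * (r + 2) + 2 * R))) + L * (4 * \<tau>)) * N"
      unfolding \<eta>_def by (simp add: algebra_simps)
    also have "\<dots> \<le> (1 / 4 + 1 / 4) * N"
      using s \<tau> \<open>0 \<le> N\<close> by (intro mult_right_mono add_mono) auto
    finally show "norm (\<Psi> X - \<Psi> X') \<le> 1/2 * norm (X - X')" by (simp add: N_def)
  next
    have "norm (\<Psi> 0) \<le> L * (norm (f1 0 0) + norm (f2 0 0 0))"
      using trip by (simp add: \<Psi>_def zero_prod_def)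
    also have "\<dots> \<le> L * (C * \<eta> * (2 * R) + r * (C * \<eta> * (2 * R)))"
      using L r FG0[of 0 0] \<tau> by (intro mult_left_mono add_mono) (auto simp: f1_def f2_def intro: mult_left_mono)
    also have "\<dots> = s * (R * (L * (1 + r) * C * (2 * R)))"
      unfolding \<eta>_def by (simp add: algebra_simps)
    also have "\<dots> \<le> \<tau> / 2" by (rule s)
    finally show "norm (\<Psi> 0) \<le> \<tau> / 2" .
  qed
  then obtain y z \<rho> where X: "norm (y, z, \<rho>) \<le> \<tau>" and fp: "\<Psi> (y, z, \<rho>) = (y, z, \<rho>)"
    by (metis prod_cases3)
  have bd: "norm y \<le> \<tau>" "norm z \<le> \<tau>" "\<bar>\<rho>\<bar> \<le> \<tau>" using comp[where y = y and z = z and \<rho> = \<rho>] X by auto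
  have yz: "S1 (f1 y z) (f2 y z \<rho>) = y" "S2 (f1 y z) (f2 y z \<rho>) = z" "S3 (f1 y z) (f2 y z \<rho>) = \<rho>"
    using fp by (auto simp: \<Psi>_def)
  note Syz = S[of "f1 y z" "f2 y z \<rho>", unfolded yz]
  define Y1 where "Y1 = \<Phi>1 + y"
  define Y2 where "Y2 = \<Phi>2 + z"
  define F where "F = ?F y z"
  define G where "G = ?G y z"
  have C2: "C2coef Y1" "C2coef Y2" "C2coef \<Phi>1" "C2coef \<Phi>2" "C2coef y" "C2coef z"
    using Syz by (auto simp: Y1_def Y2_def \<Phi>1_def \<Phi>2_def intro!: C2coef_add C2coef_wmode)
  have cY: "coef Y1 n = (if \<bar>n\<bar> = m then 1 else 0) + coef y n" "coef Y2 n = (if \<bar>n\<bar> = m then \<phi> else 0) + coef z n" for n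
    using m by (auto simp: Y1_def Y2_def \<Phi>1_def \<Phi>2_def coef_wmode)
  have mode: "\<alpha> n = \<alpha> m" "\<gamma> n = \<gamma> m" if "\<bar>n\<bar> = m" for n
  proof -
    have "n = m \<or> n = - m" using that by linarith
    then show "\<alpha> n = \<alpha> m" "\<gamma> n = \<gamma> m" by (auto simp: \<alpha>_def \<gamma>_def)
  qed
  \<comment> \<open>the fixed point equation, read coefficientwise, is the steady state problem divided by \<open>s\<close>\<close>
  have E1: "(d1 / l\<^sup>2) *\<^sub>R laplace Y1 + ?A *\<^sub>R Y1 + ?B *\<^sub>R Y2 + F = 0"
  proof (rule wiener_eqI)
    fix n
    have "\<alpha> n * coef y n + ?B * coef z n = - coef F n" using Syz by (simp add: f1_def F_def)
    moreover have "\<alpha> n * coef Y1 n + ?B * coef Y2 n = \<alpha> n * coef y n + ?B * coef z n"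
      using k1 mode(1)[of n] by (auto simp: cY algebra_simps)
    ultimately have "\<alpha> n * coef Y1 n + ?B * coef Y2 n + coef F n = 0" by simp
    then show "coef ((d1 / l\<^sup>2) *\<^sub>R laplace Y1 + ?A *\<^sub>R Y1 + ?B *\<^sub>R Y2 + F) n = coef 0 n"
      by (simp add: coef_laplace[OF C2(1)] \<alpha>_def xval_def algebra_simps)
  qed
  have E2: "(d2 / l\<^sup>2) *\<^sub>R laplace Y2 + (r + \<rho>) *\<^sub>R (Y1 - Y2 + G) = 0"
  proof (rule wiener_eqI)
    fix n
    have "r * coef y n + \<gamma> n * coef z n + (if \<bar>n\<bar> = m then g * \<rho> else 0)
        = - ((r + \<rho>) * coef G n) - \<rho> * (coef y n - coef z n)" using Syz by (simp add: f2_def G_def)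
    moreover have "r * coef Y1 n + \<gamma> n * coef Y2 n = r * coef y n + \<gamma> n * coef z n"
      using k2 mode(2)[of n] by (auto simp: cY algebra_simps)
    moreover have "\<rho> * (coef Y1 n - coef Y2 n) = \<rho> * (coef y n - coef z n) + (if \<bar>n\<bar> = m then g * \<rho> else 0)"
      by (auto simp: cY g_def algebra_simps)
    ultimately have "r * coef Y1 n + \<gamma> n * coef Y2 n + \<rho> * (coef Y1 n - coef Y2 n) + (r + \<rho>) * coef G n = 0"
      by linarith
    then show "coef ((d2 / l\<^sup>2) *\<^sub>R laplace Y2 + (r + \<rho>) *\<^sub>R (Y1 - Y2 + G)) n = coef 0 n"
      by (simp add: coef_laplace[OF C2(2)] \<gamma>_def xval_def algebra_simps)
  qed
  have nY: "norm Y1 \<le> R" "norm Y2 \<le> R" using Y bd by (auto simp: Y1_def Y2_def)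
  have lapY: "norm (laplace Y1) \<le> M" "norm (laplace Y2) \<le> M" and RM: "R \<le> M"
  proof -
    have C\<eta>R: "C * \<eta> * (2 * R) \<le> C * \<eta>0 * (2 * R)" using C \<eta> R by (intro mult_right_mono mult_left_mono) auto
    have "norm (f1 y z) \<le> C * \<eta>0 * (2 * R)"
      using order_trans[OF FG0(1)[OF bd(1,2)] C\<eta>R] by (simp only: f1_def norm_minus_cancel)
    moreover have "norm (f2 y z \<rho>) \<le> (r + 1) * (C * \<eta>0 * (2 * R)) + 2"
    proof -
      have "(r + 1) * (C * \<eta> * (2 * R)) \<le> (r + 1) * (C * \<eta>0 * (2 * R))" using C\<eta>R r by (intro mult_left_mono) auto
      moreover have "\<tau> * (2 * \<tau>) \<le> 1 * (2 * 1)" using \<tau> by (intro mult_mono) auto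
      ultimately show ?thesis using f2_le[OF bd] by linarith
    qed
    ultimately have "norm (f1 y z) + norm (f2 y z \<rho>) \<le> C * \<eta>0 * (2 * R) * (r + 2) + 2"
      by (simp add: algebra_simps)
    then have "L0 * (norm (f1 y z) + norm (f2 y z \<rho>)) \<le> L0 * (C * \<eta>0 * (2 * R) * (r + 2) + 2)"
      using L0 by (intro mult_left_mono) auto
    then have lyz: "norm (laplace y) \<le> L0 * (C * \<eta>0 * (2 * R) * (r + 2) + 2)" "norm (laplace z) \<le> L0 * (C * \<eta>0 * (2 * R) * (r + 2) + 2)"
      using Syz by linarith+
    have pos: "0 \<le> L0 * (C * \<eta>0 * (2 * R) * (r + 2) + 2)"
      using lyz(1) norm_ge_zero order_trans by blast
    show "norm (laplace Y1) \<le> M" "norm (laplace Y2) \<le> M"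
      using norm_triangle_ineq[of "laplace \<Phi>1" "laplace y"] norm_triangle_ineq[of "laplace \<Phi>2" "laplace z"] lyz R
        norm_ge_zero[of "laplace \<Phi>1"] norm_ge_zero[of "laplace \<Phi>2"]
      unfolding Y1_def Y2_def laplace_add[OF C2(3,5)] laplace_add[OF C2(4,6)] M_def by linarith+
    show "R \<le> M" unfolding M_def using pos norm_ge_zero[of "laplace \<Phi>1"] norm_ge_zero[of "laplace \<Phi>2"] by linarith
  qed
  have M: "0 \<le> M" using RM R by linarith
  have sM: "s * M \<le> \<epsilon> / 2" "s * M \<le> ?u / 2" "s * M / l \<le> \<epsilon> / 2" "s * M / l\<^sup>2 \<le> \<epsilon> / 2"
  proof -
    have "s * (M * (1 + 1 / l + 1 / l\<^sup>2)) = s * M + s * M / l + s * M / l\<^sup>2" by (simp add: algebra_simps)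
    moreover have "0 \<le> s * M" "0 \<le> s * M / l" "0 \<le> s * M / l\<^sup>2" using s M l by auto
    ultimately show "s * M \<le> \<epsilon> / 2" "s * M \<le> ?u / 2" "s * M / l \<le> \<epsilon> / 2" "s * M / l\<^sup>2 \<le> \<epsilon> / 2"
      using s(5) by linarith+
  qed
  define Uf where "Uf Y = (\<lambda>x. ?u + weval (s *\<^sub>R Y) (x / l))" for Y
  have near: "neumann_C2 l (Uf Y)" "C2_near l \<epsilon> (Uf Y) ?u"
    "\<And>x. x \<in> {0..l * pi} \<Longrightarrow> Uf Y x > 0"
    "\<And>x. x \<in> {0..l * pi} \<Longrightarrow> ddx l (ddx l (Uf Y)) x = s * weval (laplace Y) (x / l) / l\<^sup>2"
    if Yc: "C2coef Y" and Yb: "norm Y \<le> R" "norm (laplace Y) \<le> M" for Y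
  proof -
    have sY: "C2coef (s *\<^sub>R Y)" by (rule C2coef_scaleR[OF Yc])
    note nc = neumann_C2_const[OF l, where c = ?u] and nw = neumann_C2_weval[OF l sY]
    note na = neumann_C2_add[OF l nc(1) nw(1), folded Uf_def]
    show "neumann_C2 l (Uf Y)" by (rule na(1))
    have dd: "ddx l (ddx l (Uf Y)) x = s * weval (laplace Y) (x / l) / l\<^sup>2" if "x \<in> {0..l * pi}" for x
      using na(3)[OF that] nc(3)[OF that] nw(3)[OF that] by (simp add: laplace_scaleR[OF Yc] weval_scaleR)
    then show "ddx l (ddx l (Uf Y)) x = s * weval (laplace Y) (x / l) / l\<^sup>2" if "x \<in> {0..l * pi}" for x
      using that by blast
    have d: "ddx l (Uf Y) x = wsin (s *\<^sub>R Y) (x / l) / l" if "x \<in> {0..l * pi}" for x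
      using na(2)[OF that] nc(2)[OF that] nw(2)[OF that] by simp
    have 0: "\<bar>Uf Y x - ?u\<bar> \<le> s * M" for x
    proof -
      have "\<bar>weval (s *\<^sub>R Y) (x / l)\<bar> \<le> norm (s *\<^sub>R Y)" using norm_weval_le[of "s *\<^sub>R Y" "x / l"] by simp
      also have "\<dots> \<le> s * M" using s Yb RM by (auto intro!: mult_left_mono)
      finally show ?thesis by (simp add: Uf_def)
    qed
    have 1: "\<bar>ddx l (Uf Y) x\<bar> \<le> s * M / l" if "x \<in> {0..l * pi}" for x
    proof -
      have "\<bar>wsin (s *\<^sub>R Y) (x / l)\<bar> \<le> norm (laplace (s *\<^sub>R Y))" by (rule weval_derivatives(3)[OF sY])
      also have "\<dots> \<le> s * M" unfolding laplace_scaleR[OF Yc] using s Yb by (auto intro!: mult_left_mono)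
      finally show ?thesis unfolding d[OF that] abs_divide using l by (simp add: divide_right_mono)
    qed
    have 2: "\<bar>ddx l (ddx l (Uf Y)) x\<bar> \<le> s * M / l\<^sup>2" if "x \<in> {0..l * pi}" for x
    proof -
      have "\<bar>weval (laplace Y) (x / l)\<bar> \<le> M" using norm_weval_le[of "laplace Y" "x / l"] Yb by simp
      then show ?thesis unfolding dd[OF that] using s by (simp add: abs_mult divide_right_mono mult_left_mono)
    qed
    show "C2_near l \<epsilon> (Uf Y) ?u"
      unfolding C2_near_def using 0 1 2 sM \<epsilon> by (smt (verit) field_sum_of_halves)
    show "Uf Y x > 0" for x using 0[of x] sM u by linarith
  qed
  have hom: "HT_f a b (Uf Y1 x) (Uf Y2 x) = s * (?A * weval Y1 (x / l) + ?B * weval Y2 (x / l) + weval F (x / l))"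
    "HT_g (r + \<rho>) (Uf Y1 x) (Uf Y2 x) = s * ((r + \<rho>) * (weval Y1 (x / l) - weval Y2 (x / l) + weval G (x / l)))" for x
  proof -
    have eY1: "norm (0 + e * Y1) \<le> ?u / 2"
      using norm_mult_ineq[of e Y1] eY(1)[OF bd(1)] \<eta> \<eta>0 by (simp add: Y1_def)
    have "norm (0 :: real wiener) \<le> ?u / 2" using u by simp
    note H = HT_FG_hom[OF weval_hom[of "x / l"] b this eY1, where q = 0 and z = Y2]
    have es: "e * Y = s *\<^sub>R Y" for Y by (simp add: e_def scaleR_conv_of_real)
    show "HT_f a b (Uf Y1 x) (Uf Y2 x) = s * (?A * weval Y1 (x / l) + ?B * weval Y2 (x / l) + weval F (x / l))"
      using H(1) HT_constant_zero(1)[OF b, of a]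
      by (simp add: es Uf_def weval_scaleR F_def Y1_def[symmetric] Y2_def[symmetric])
         (simp add: e_def weval_of_real algebra_simps)
    show "HT_g (r + \<rho>) (Uf Y1 x) (Uf Y2 x) = s * ((r + \<rho>) * (weval Y1 (x / l) - weval Y2 (x / l) + weval G (x / l)))"
      using H(2)[where r = "r + \<rho>"] HT_constant_zero(2)[OF b, where r = "r + \<rho>" and a = a]
      by (simp add: es Uf_def weval_scaleR G_def Y1_def[symmetric] Y2_def[symmetric])
         (simp add: e_def weval_of_real algebra_simps)
  qed
  have steady: "HT_steady_state a b d1 d2 (r + \<rho>) l (Uf Y1) (Uf Y2)"
    unfolding HT_steady_state_def
  proof (intro conjI ballI)
    fix x assume x: "x \<in> {0<..<l * pi}"
    then have x': "x \<in> {0..l * pi}" by auto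
    have "weval ((d1 / l\<^sup>2) *\<^sub>R laplace Y1 + ?A *\<^sub>R Y1 + ?B *\<^sub>R Y2 + F) (x / l) = 0" unfolding E1 by simp
    then have "d1 * weval (laplace Y1) (x / l) / l\<^sup>2 + (?A * weval Y1 (x / l) + ?B * weval Y2 (x / l) + weval F (x / l)) = 0"
      by (simp add: weval_add weval_scaleR)
    then have "s * (d1 * weval (laplace Y1) (x / l) / l\<^sup>2 + (?A * weval Y1 (x / l) + ?B * weval Y2 (x / l) + weval F (x / l))) = 0"
      by simp
    then show "d1 * ddx l (ddx l (Uf Y1)) x + HT_f a b (Uf Y1 x) (Uf Y2 x) = 0"
      unfolding near(4)[OF C2(1) nY(1) lapY(1) x'] hom(1) by (simp add: algebra_simps)
    have "weval ((d2 / l\<^sup>2) *\<^sub>R laplace Y2 + (r + \<rho>) *\<^sub>R (Y1 - Y2 + G)) (x / l) = 0" unfolding E2 by simp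
    then have "d2 * weval (laplace Y2) (x / l) / l\<^sup>2 + (r + \<rho>) * (weval Y1 (x / l) - weval Y2 (x / l) + weval G (x / l)) = 0"
      by (simp add: weval_add weval_scaleR weval_diff)
    then have "s * (d2 * weval (laplace Y2) (x / l) / l\<^sup>2 + (r + \<rho>) * (weval Y1 (x / l) - weval Y2 (x / l) + weval G (x / l))) = 0"
      by simp
    then show "d2 * ddx l (ddx l (Uf Y2)) x + HT_g (r + \<rho>) (Uf Y1 x) (Uf Y2 x) = 0"
      unfolding near(4)[OF C2(2) nY(2) lapY(2) x'] hom(2) by (simp add: algebra_simps)
  qed (use near C2 nY lapY in auto)
  have nonconst: "\<not> Uf Y1 constant_on {0..l * pi}"
  proof
    assume "Uf Y1 constant_on {0..l * pi}"
    then obtain c where c: "\<And>x. x \<in> {0..l * pi} \<Longrightarrow> Uf Y1 x = c" by (auto simp: constant_on_def)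
    have "s *\<^sub>R Y1 = of_real (c - ?u)"
    proof (rule weval_injective[OF l])
      fix x assume "x \<in> {0..l * pi}"
      from c[OF this] show "weval (s *\<^sub>R Y1) (x / l) = weval (of_real (c - ?u)) (x / l)"
        unfolding weval_of_real by (simp add: Uf_def)
    qed
    then have "coef (s *\<^sub>R Y1) m = coef ((c - ?u) *\<^sub>R 1) m" by (simp only: of_real_def)
    then have "s * coef Y1 m = 0" using m by (simp add: coef_one)
    moreover have "coef Y1 m = 1" using Syz m by (simp add: cY)
    ultimately show False using s by simp
  qed
  have "HT_bif_solution a b d1 d2 l r \<epsilon> (r + \<rho>) (Uf Y1) (Uf Y2)"
    unfolding HT_bif_solution_def HT_v0_def
    using steady nonconst near(2) C2 nY lapY bd \<tau> by auto
  then show ?thesis by blast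
qed

section \<open>Bounded solutions of linear differential equations\<close>

text \<open>Time dependence is measured in bounded continuous functions on the whole line, although equations are solved
only for \<open>t < 0\<close>: forcing terms are replaced by their value at \<open>0\<close> for positive times.\<close>

type_synonym bfun = "real \<Rightarrow>\<^sub>C real"

instance bcontfun :: (metric_space, banach) banach ..

instantiation bcontfun :: (topological_space, "{real_normed_algebra_1,comm_ring_1}") comm_ring_1
begin

definition times_bcontfun :: "('a \<Rightarrow>\<^sub>C 'b) \<Rightarrow> ('a \<Rightarrow>\<^sub>C 'b) \<Rightarrow> 'a \<Rightarrow>\<^sub>C 'b" where
  "times_bcontfun f g = Bcontfun (\<lambda>x. apply_bcontfun f x * apply_bcontfun g x)"
definition one_bcontfun :: "'a \<Rightarrow>\<^sub>C 'b" where
  "one_bcontfun = const_bcontfun 1"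

lemma apply_bcontfun_mult:
  "apply_bcontfun (f * g) x = apply_bcontfun f x * (apply_bcontfun g x :: 'b)"
proof -
  have "(\<lambda>x. apply_bcontfun f x * apply_bcontfun g x) \<in> bcontfun"
  proof (rule bcontfun_normI)
    show "norm (apply_bcontfun f x * apply_bcontfun g x) \<le> norm f * norm g" for x
      by (rule order_trans[OF norm_mult_ineq]) (intro mult_mono norm_bounded norm_ge_zero)
  qed (intro continuous_intros continuous_on_apply_bcontfun)
  then show ?thesis by (simp add: times_bcontfun_def Bcontfun_inverse)
qed

lemma apply_bcontfun_one: "apply_bcontfun 1 x = (1 :: 'b)"
  by (simp add: one_bcontfun_def const_bcontfun.rep_eq)

instance
proof
  show "(0 :: 'a \<Rightarrow>\<^sub>C 'b) \<noteq> 1"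
  proof
    assume "(0 :: 'a \<Rightarrow>\<^sub>C 'b) = 1"
    then have "apply_bcontfun (0 :: 'a \<Rightarrow>\<^sub>C 'b) undefined = apply_bcontfun 1 undefined" by simp
    then show False by (simp add: apply_bcontfun_one)
  qed
qed (rule bcontfun_eqI, simp add: apply_bcontfun_mult apply_bcontfun_one algebra_simps)+

end

instance bcontfun :: (topological_space, "{real_normed_algebra_1,comm_ring_1}") real_normed_algebra_1
proof
  fix f g :: "'a \<Rightarrow>\<^sub>C 'b" and c :: real
  show "c *\<^sub>R f * g = c *\<^sub>R (f * g)" "f * c *\<^sub>R g = c *\<^sub>R (f * g)"
    by (rule bcontfun_eqI, simp add: apply_bcontfun_mult)+
  show "norm (f * g) \<le> norm f * norm g"
  proof (rule norm_bound)
    show "norm (apply_bcontfun (f * g) x) \<le> norm f * norm g" for x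
      unfolding apply_bcontfun_mult
      by (rule order_trans[OF norm_mult_ineq]) (intro mult_mono norm_bounded norm_ge_zero)
  qed
  show "norm (1 :: 'a \<Rightarrow>\<^sub>C 'b) = 1"
  proof (rule antisym)
    show "norm (1 :: 'a \<Rightarrow>\<^sub>C 'b) \<le> 1" by (rule norm_bound) (simp add: apply_bcontfun_one)
    show "1 \<le> norm (1 :: 'a \<Rightarrow>\<^sub>C 'b)"
      using norm_bounded[of "1 :: 'a \<Rightarrow>\<^sub>C 'b" undefined] by (simp add: apply_bcontfun_one)
  qed
qed

text \<open>For \<open>Re \<mu> < 0\<close> the integral of \<open>exp (\<mu> s) \<phi> s\<close> over \<open>{t..}\<close> converges absolutely; stable and unstable
equations both reduce to it, the former after time reversal.\<close>

lemma exp_tail_integral: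
  fixes \<phi> :: "real \<Rightarrow> complex"
  assumes \<mu>: "Re \<mu> < 0" and c: "continuous_on UNIV \<phi>" and M: "\<And>t. norm (\<phi> t) \<le> M"
  shows "(\<lambda>s. exp (\<mu> * of_real s) * \<phi> s) integrable_on {t..}"
    and "norm (integral {t..} (\<lambda>s. exp (\<mu> * of_real s) * \<phi> s)) \<le> M * (exp (Re \<mu> * t) / - Re \<mu>)"
    and "((\<lambda>t. integral {t..} (\<lambda>s. exp (\<mu> * of_real s) * \<phi> s)) has_vector_derivative
       - (exp (\<mu> * of_real t) * \<phi> t)) (at t)"
proof -
  let ?k = "\<lambda>s. exp (\<mu> * of_real s) * \<phi> s"
  have ck: "continuous_on S ?k" for S
    by (intro continuous_intros continuous_on_subset[OF c]) auto
  have g: "((\<lambda>s. M * exp (Re \<mu> * s)) has_integral M * (exp (Re \<mu> * t) / - Re \<mu>)) {t..}" for t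
    using has_integral_mult_right[OF has_integral_exp_minus_to_infinity[of "- Re \<mu>" t], of M] \<mu> by simp
  have nk: "norm (?k s) \<le> M * exp (Re \<mu> * s)" for s
    using M[of s] by (simp add: norm_mult mult.commute mult_left_mono)
  show int: "?k integrable_on {t..}" for t
  proof (rule measurable_bounded_by_integrable_imp_integrable[OF _ has_integral_integrable[OF g]])
    show "?k \<in> borel_measurable (lebesgue_on {t..})"
      by (rule continuous_imp_measurable_on_sets_lebesgue[OF ck]) simp
  qed (use nk in auto)
  show "norm (integral {t..} ?k) \<le> M * (exp (Re \<mu> * t) / - Re \<mu>)" for t
    using integral_norm_bound_integral[OF int has_integral_integrable[OF g] nk] integral_unique[OF g]
    by simp
  have split: "integral {x..} ?k = integral {t - 1..} ?k - integral {t - 1..x} ?k" if "x \<in> {t - 1..t + 1}" for x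
  proof -
    have "(?k has_integral (integral {t - 1..x} ?k + integral {x..} ?k)) ({t - 1..x} \<union> {x..})"
    proof (rule has_integral_Un)
      show "(?k has_integral integral {t - 1..x} ?k) {t - 1..x}"
        by (intro integrable_integral integrable_continuous_real ck)
      show "(?k has_integral integral {x..} ?k) {x..}" by (intro integrable_integral int)
      have "{t - 1..x} \<inter> {x..} = {x}" using that by auto
      then show "negligible ({t - 1..x} \<inter> {x..})" by simp
    qed
    moreover have "{t - 1..x} \<union> {x..} = {t - 1..}" using that by auto
    ultimately show ?thesis by (simp add: integral_unique)
  qed
  have "((\<lambda>x. integral {t - 1..x} ?k) has_vector_derivative ?k t) (at t within {t - 1..t + 1})"
    by (rule integral_has_vector_derivative[OF ck]) simp
  then have "((\<lambda>x. integral {t - 1..} ?k - integral {t - 1..x} ?k) has_vector_derivative 0 - ?k t) (at t within {t - 1..t + 1})"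
    by (intro has_vector_derivative_diff has_vector_derivative_const)
  then have "((\<lambda>x. integral {x..} ?k) has_vector_derivative 0 - ?k t) (at t within {t - 1..t + 1})"
    by (rule has_vector_derivative_transform[rotated 2]) (simp, erule split)
  then show "((\<lambda>x. integral {x..} ?k) has_vector_derivative - ?k t) (at t)"
    by (simp add: at_within_Icc_at)
qed

definition tail_op :: "complex \<Rightarrow> (real \<Rightarrow> complex) \<Rightarrow> real \<Rightarrow> complex" where
  "tail_op \<mu> \<phi> t = exp (- \<mu> * of_real t) * integral {t..} (\<lambda>s. exp (\<mu> * of_real s) * \<phi> s)"

lemma tail_op:
  fixes \<phi> :: "real \<Rightarrow> complex"
  assumes \<mu>: "Re \<mu> < 0" and c: "continuous_on UNIV \<phi>" and M: "\<And>t. norm (\<phi> t) \<le> M"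
  shows "norm (tail_op \<mu> \<phi> t) \<le> M / - Re \<mu>"
    and "(tail_op \<mu> \<phi> has_vector_derivative (- \<mu> * tail_op \<mu> \<phi> t - \<phi> t)) (at t)"
proof -
  have "norm (tail_op \<mu> \<phi> t) \<le> exp (- Re \<mu> * t) * (M * (exp (Re \<mu> * t) / - Re \<mu>))"
    unfolding tail_op_def norm_mult using exp_tail_integral(2)[OF assms, of t]
    by (intro mult_mono) auto
  also have "\<dots> = (exp (- Re \<mu> * t) * exp (Re \<mu> * t)) * (M / - Re \<mu>)" by simp
  also have "exp (- Re \<mu> * t) * exp (Re \<mu> * t) = 1" unfolding exp_add[symmetric] by simp
  also have "1 * (M / - Re \<mu>) = M / - Re \<mu>" by simp
  finally show "norm (tail_op \<mu> \<phi> t) \<le> M / - Re \<mu>" .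
  have e: "((\<lambda>t. exp (- \<mu> * of_real t)) has_vector_derivative - \<mu> * exp (- \<mu> * of_real t)) (at t)"
  proof -
    have "s *\<^sub>R (- \<mu>) = - \<mu> * of_real s" for s
      by (simp add: scaleR_conv_of_real mult.commute)
    then show ?thesis using exp_scaleR_has_vector_derivative_left[of "- \<mu>" t] by (simp only:)
  qed
  have "(tail_op \<mu> \<phi> has_vector_derivative
      (exp (- \<mu> * of_real t) * (- (exp (\<mu> * of_real t) * \<phi> t))
       + (- \<mu> * exp (- \<mu> * of_real t)) * integral {t..} (\<lambda>s. exp (\<mu> * of_real s) * \<phi> s))) (at t)"
    unfolding tail_op_def[abs_def]
    by (rule has_vector_derivative_mult[OF e exp_tail_integral(3)[OF assms]])
  moreover have eq: "exp (- \<mu> * of_real t) * (- (exp (\<mu> * of_real t) * \<phi> t)) = - \<phi> t"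
    unfolding mult_minus_right mult.assoc[symmetric] exp_add[symmetric] by simp
  ultimately show "(tail_op \<mu> \<phi> has_vector_derivative (- \<mu> * tail_op \<mu> \<phi> t - \<phi> t)) (at t)"
    unfolding eq by (simp add: tail_op_def mult.assoc minus_diff_commute)
qed

lemma tail_op_diff:
  assumes \<mu>: "Re \<mu> < 0" and "continuous_on UNIV \<phi>" "\<And>t. norm (\<phi> t) \<le> M"
    and "continuous_on UNIV \<psi>" "\<And>t. norm (\<psi> t) \<le> M'"
  shows "tail_op \<mu> (\<lambda>t. \<phi> t - \<psi> t) t = tail_op \<mu> \<phi> t - tail_op \<mu> \<psi> t"
proof -
  have "integral {t..} (\<lambda>s. exp (\<mu> * of_real s) * (\<phi> s - \<psi> s))
    = integral {t..} (\<lambda>s. exp (\<mu> * of_real s) * \<phi> s) - integral {t..} (\<lambda>s. exp (\<mu> * of_real s) * \<psi> s)"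
    unfolding right_diff_distrib
    by (intro integral_diff exp_tail_integral(1)[OF \<mu> assms(2,3)] exp_tail_integral(1)[OF \<mu> assms(4,5)])
  then show ?thesis by (simp add: tail_op_def right_diff_distrib)
qed

text \<open>The bounded solution of \<open>y' = \<zeta> y + f\<close>: integrate from \<open>-\<infinity>\<close> if \<open>Re \<zeta> < 0\<close> and from
\<open>+\<infinity>\<close> if \<open>Re \<zeta> > 0\<close>. The last clause says that it does not feel the forcing at positive times.\<close>

lemma bounded_ode_solver:
  assumes \<zeta>: "Re \<zeta> \<noteq> 0"
  shows "\<exists>S :: (real \<Rightarrow>\<^sub>C complex) \<Rightarrow> (real \<Rightarrow>\<^sub>C complex).
    (\<forall>(f :: real \<Rightarrow>\<^sub>C complex) t. (apply_bcontfun (S f) has_vector_derivative \<zeta> * apply_bcontfun (S f) t + apply_bcontfun f (min t 0)) (at t)) \<and>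
    (\<forall>f :: real \<Rightarrow>\<^sub>C complex. norm (S f) \<le> norm f / \<bar>Re \<zeta>\<bar>) \<and> (\<forall>f g. S (f - g) = S f - S g) \<and>
    (\<forall>f :: real \<Rightarrow>\<^sub>C complex. (\<forall>t\<le>0. apply_bcontfun f t = 0) \<longrightarrow> S f = 0)"
proof -
  define \<sigma> :: real where "\<sigma> = (if Re \<zeta> < 0 then - 1 else 1)"
  define \<mu> where "\<mu> = - of_real \<sigma> * \<zeta>"
  have \<sigma>: "\<sigma> * \<sigma> = 1" and \<sigma>1: "\<bar>\<sigma>\<bar> = 1" by (simp_all add: \<sigma>_def)
  have \<mu>: "Re \<mu> < 0" "- Re \<mu> = \<bar>Re \<zeta>\<bar>" using \<zeta> by (auto simp: \<mu>_def \<sigma>_def)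
  have \<mu>\<zeta>: "- of_real \<sigma> * \<mu> = \<zeta>" using \<sigma> by (simp add: \<mu>_def mult.assoc[symmetric] of_real_mult[symmetric])
  define \<phi> where "\<phi> f s = apply_bcontfun f (min (\<sigma> * s) 0)" for f :: "real \<Rightarrow>\<^sub>C complex" and s
  have \<phi>c: "continuous_on UNIV (\<phi> f)" for f
    unfolding \<phi>_def[abs_def]
    by (rule continuous_on_compose2[OF continuous_on_apply_bcontfun[of UNIV]]) (auto intro!: continuous_intros)
  have \<phi>M: "norm (\<phi> f t) \<le> norm f" for f t unfolding \<phi>_def by (rule norm_bounded)
  note T = tail_op[OF \<mu>(1) \<phi>c \<phi>M]
  define R where "R f t = (- of_real \<sigma> * tail_op \<mu> (\<phi> f) (\<sigma> * t))" for f t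
  have R_le: "norm (R f t) \<le> norm f / \<bar>Re \<zeta>\<bar>" for f t
    using T(1)[of f "\<sigma> * t"] unfolding R_def norm_mult \<mu>(2) by (simp add: \<sigma>1)
  have R_der: "(R f has_vector_derivative \<zeta> * R f t + apply_bcontfun f (min t 0)) (at t)" for f t
  proof -
    have "((\<lambda>t. \<sigma> * t) has_vector_derivative \<sigma>) (at t)"
      by (auto intro!: derivative_eq_intros)
    from vector_diff_chain_at[OF this T(2)[of f "\<sigma> * t"]]
    have 1: "((\<lambda>t. tail_op \<mu> (\<phi> f) (\<sigma> * t)) has_vector_derivative
        \<sigma> *\<^sub>R (- \<mu> * tail_op \<mu> (\<phi> f) (\<sigma> * t) - \<phi> f (\<sigma> * t))) (at t)" by (simp add: o_def)
    have "(R f has_vector_derivative - of_real \<sigma> * (\<sigma> *\<^sub>R (- \<mu> * tail_op \<mu> (\<phi> f) (\<sigma> * t) - \<phi> f (\<sigma> * t)))) (at t)"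
      unfolding R_def[abs_def] by (rule has_vector_derivative_mult_right[OF 1])
    moreover have "- of_real \<sigma> * (\<sigma> *\<^sub>R (- \<mu> * X - Y)) = (- of_real \<sigma> * \<mu>) * (- of_real \<sigma> * X) + Y" for X Y :: complex
    proof -
      have "of_real \<sigma> * (of_real \<sigma> * Z) = Z" for Z :: complex
        using \<sigma> by (metis mult.assoc mult_1 of_real_1 of_real_mult)
      then show ?thesis by (simp add: scaleR_conv_of_real algebra_simps)
    qed
    moreover have "\<phi> f (\<sigma> * t) = f (min t 0)" using \<sigma> by (simp add: \<phi>_def mult.assoc[symmetric])
    ultimately show ?thesis unfolding \<mu>\<zeta> R_def by simp
  qed
  have R_b: "R f \<in> bcontfun" for f
  proof (rule bcontfun_normI)
    show "continuous_on UNIV (R f)"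
      using R_der by (auto intro!: continuous_at_imp_continuous_on has_vector_derivative_continuous)
  qed (rule R_le)
  define S where "S f = Bcontfun (R f)" for f
  have S: "apply_bcontfun (S f) = R f" for f using R_b by (simp add: S_def Bcontfun_inverse)
  have "S (f - g) = S f - S g" for f g
  proof (rule bcontfun_eqI)
    fix t
    have "\<phi> (f - g) = (\<lambda>s. \<phi> f s - \<phi> g s)" by (rule ext) (simp add: \<phi>_def)
    then show "apply_bcontfun (S (f - g)) t = apply_bcontfun (S f - S g) t"
      using tail_op_diff[OF \<mu>(1) \<phi>c \<phi>M \<phi>c \<phi>M, of f g "\<sigma> * t"] by (simp add: S R_def right_diff_distrib)
  qed
  moreover have "S f = 0" if "\<forall>t\<le>0. apply_bcontfun f t = 0" for f
  proof (rule bcontfun_eqI)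
    fix t
    have "\<phi> f = (\<lambda>s. 0)" using that by (auto simp: \<phi>_def)
    then show "apply_bcontfun (S f) t = apply_bcontfun 0 t" by (simp add: S R_def tail_op_def)
  qed
  moreover have "norm (S f) \<le> norm f / \<bar>Re \<zeta>\<bar>" for f
    by (rule norm_bound) (simp add: S R_le)
  ultimately show ?thesis
    using R_der by (intro exI[of _ S]) (auto simp: S)
qed

definition bcomp :: "('b::real_normed_vector \<Rightarrow> 'c::real_normed_vector) \<Rightarrow> ('a::topological_space \<Rightarrow>\<^sub>C 'b) \<Rightarrow> ('a \<Rightarrow>\<^sub>C 'c)" where
  "bcomp h f = Bcontfun (\<lambda>x. h (apply_bcontfun f x))"

lemma bcomp:
  assumes h: "bounded_linear h" and n: "\<And>x. norm (h x) \<le> norm x"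
  shows "apply_bcontfun (bcomp h f) x = h (apply_bcontfun f x)" and "norm (bcomp h f) \<le> norm f"
proof -
  have le: "norm (h (apply_bcontfun f x)) \<le> norm f" for x using n norm_bounded order_trans by blast
  have "(\<lambda>x. h (apply_bcontfun f x)) \<in> bcontfun"
    by (rule bcontfun_normI[OF _ le])
       (intro bounded_linear.continuous_on[OF h] continuous_on_apply_bcontfun)
  then show a: "apply_bcontfun (bcomp h f) x = h (apply_bcontfun f x)" for x
    by (simp add: bcomp_def Bcontfun_inverse)
  show "norm (bcomp h f) \<le> norm f" by (rule norm_bound) (simp add: a le)
qed

text \<open>The operator \<open>d\<^sup>2/dt\<^sup>2 - T d/dt + D\<close> is inverted by two first order problems with its complex
characteristic roots; the real part is a real solution because \<open>T\<close> and \<open>D\<close> are real. Double and complex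
roots need no separate treatment.\<close>

lemma second_order_solver:
  fixes \<zeta>1 \<zeta>2 :: complex
  assumes \<rho>: "\<rho> > 0" "\<bar>Re \<zeta>1\<bar> \<ge> \<rho>" "\<bar>Re \<zeta>2\<bar> \<ge> \<rho>"
    and T: "\<zeta>1 + \<zeta>2 = of_real T" and D: "\<zeta>1 * \<zeta>2 = of_real D"
  shows "\<exists>G H :: bfun \<Rightarrow> bfun.
    (\<forall>f :: bfun. \<forall>t<0. (apply_bcontfun (G f) has_real_derivative apply_bcontfun (H f) t) (at t) \<and>
        (apply_bcontfun (H f) has_real_derivative (T * apply_bcontfun (H f) t - D * apply_bcontfun (G f) t + apply_bcontfun f t)) (at t)) \<and>
    (\<forall>f :: bfun. norm (G f) \<le> norm f / \<rho>\<^sup>2) \<and> (\<forall>f :: bfun. norm (H f) \<le> (norm \<zeta>1 / \<rho>\<^sup>2 + 1 / \<rho>) * norm f) \<and>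
    (\<forall>f g. G (f - g) = G f - G g \<and> H (f - g) = H f - H g) \<and>
    (\<forall>f :: bfun. (\<forall>t\<le>0. apply_bcontfun f t = 0) \<longrightarrow> G f = 0 \<and> H f = 0)"
proof -
  have "Re \<zeta>1 \<noteq> 0" "Re \<zeta>2 \<noteq> 0" using \<rho> by auto
  then obtain S1 S2 :: "(real \<Rightarrow>\<^sub>C complex) \<Rightarrow> (real \<Rightarrow>\<^sub>C complex)" where
    S1: "\<And>(f :: real \<Rightarrow>\<^sub>C complex) t. (apply_bcontfun (S1 f) has_vector_derivative \<zeta>1 * apply_bcontfun (S1 f) t + apply_bcontfun f (min t 0)) (at t)"
      "\<And>f. norm (S1 f) \<le> norm f / \<bar>Re \<zeta>1\<bar>" "\<And>f g. S1 (f - g) = S1 f - S1 g"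
      "\<And>f. (\<forall>t\<le>0. apply_bcontfun f t = 0) \<Longrightarrow> S1 f = 0" and
    S2: "\<And>(f :: real \<Rightarrow>\<^sub>C complex) t. (apply_bcontfun (S2 f) has_vector_derivative \<zeta>2 * apply_bcontfun (S2 f) t + apply_bcontfun f (min t 0)) (at t)"
      "\<And>f. norm (S2 f) \<le> norm f / \<bar>Re \<zeta>2\<bar>" "\<And>f g. S2 (f - g) = S2 f - S2 g"
      "\<And>f. (\<forall>t\<le>0. apply_bcontfun f t = 0) \<Longrightarrow> S2 f = 0"
    using bounded_ode_solver[of \<zeta>1] bounded_ode_solver[of \<zeta>2] by metis
  have cb: "apply_bcontfun (bcomp complex_of_real f) t = of_real (f t)" "norm (bcomp complex_of_real f) \<le> norm f"
    and rb: "apply_bcontfun (bcomp Re g) t = Re (g t)" "norm (bcomp Re g) \<le> norm g"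
    for f :: "bfun" and g :: "real \<Rightarrow>\<^sub>C complex" and t
    by (intro bcomp bounded_linear_of_real bounded_linear_Re; simp add: abs_Re_le_cmod)+
  have mb: "apply_bcontfun (bcomp ((*) \<zeta>1) g) t = \<zeta>1 * g t" for g :: "real \<Rightarrow>\<^sub>C complex" and t
  proof -
    have "(\<lambda>x. \<zeta>1 * apply_bcontfun g x) \<in> bcontfun"
      by (rule bcontfun_normI[where b = "norm \<zeta>1 * norm g"])
         (auto intro!: continuous_intros mult_left_mono norm_bounded simp: norm_mult)
    then show ?thesis by (simp add: bcomp_def Bcontfun_inverse)
  qed
  define h where "h f = S2 (bcomp complex_of_real f)" for f
  define g where "g f = S1 (h f)" for f
  define k where "k f = bcomp ((*) \<zeta>1) (g f) + h f" for f
  have ka: "apply_bcontfun (k f) t = \<zeta>1 * g f t + h f t" for f t by (simp add: k_def mb)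
  define G where "G f = bcomp Re (g f)" for f
  define H where "H f = bcomp Re (k f)" for f
  have inv: "norm f / \<bar>Re \<zeta>1\<bar> \<le> norm f / \<rho>" "norm f / \<bar>Re \<zeta>2\<bar> \<le> norm f / \<rho>" for f :: "real \<Rightarrow>\<^sub>C complex"
    using \<rho> by (auto intro!: divide_left_mono)
  have hn: "norm (h f) \<le> norm f / \<rho>" for f
    unfolding h_def using S2(2) inv(2) cb(2) \<rho>(1)
    by (meson divide_right_mono less_imp_le order_trans)
  have gn: "norm (g f) \<le> norm f / \<rho>\<^sup>2" for f
  proof -
    have "norm (g f) \<le> norm (h f) / \<rho>" unfolding g_def using S1(2) inv(1) order_trans by blast
    also have "\<dots> \<le> norm f / \<rho> / \<rho>" using hn \<rho> by (intro divide_right_mono) auto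
    finally show ?thesis by (simp add: power2_eq_square)
  qed
  have Gn: "norm (G f) \<le> norm f / \<rho>\<^sup>2" for f unfolding G_def using rb(2) gn order_trans by blast
  have Hn: "norm (H f) \<le> (norm \<zeta>1 / \<rho>\<^sup>2 + 1 / \<rho>) * norm f" for f
  proof (rule norm_bound)
    fix t
    have "norm (apply_bcontfun (H f) t) \<le> norm (\<zeta>1 * g f t + h f t)"
      unfolding H_def rb ka real_norm_def by (rule abs_Re_le_cmod)
    also have "\<dots> \<le> norm \<zeta>1 * norm (g f) + norm (h f)"
      by (rule order_trans[OF norm_triangle_ineq]) (auto simp: norm_mult intro!: add_mono mult_left_mono norm_bounded)
    also have "\<dots> \<le> norm \<zeta>1 * (norm f / \<rho>\<^sup>2) + norm f / \<rho>"
      using gn hn by (intro add_mono mult_left_mono) auto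
    finally show "norm (apply_bcontfun (H f) t) \<le> (norm \<zeta>1 / \<rho>\<^sup>2 + 1 / \<rho>) * norm f"
      by (simp add: algebra_simps)
  qed
  have lin: "G (f - f') = G f - G f'" "H (f - f') = H f - H f'" for f f'
  proof -
    have "bcomp complex_of_real (f - f') = bcomp complex_of_real f - bcomp complex_of_real f'"
      by (rule bcontfun_eqI) (simp add: cb)
    then have h: "h (f - f') = h f - h f'" by (simp add: h_def S2(3))
    then have g: "g (f - f') = g f - g f'" by (simp add: g_def S1(3))
    show "G (f - f') = G f - G f'" by (rule bcontfun_eqI) (simp add: G_def rb g)
    show "H (f - f') = H f - H f'" by (rule bcontfun_eqI) (simp add: H_def rb ka g h algebra_simps)
  qed
  have zero: "G f = 0 \<and> H f = 0" if "\<forall>t\<le>0. apply_bcontfun f t = 0" for f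
  proof -
    have h: "h f = 0" unfolding h_def by (rule S2(4)) (simp add: cb that)
    then have "g f = 0" unfolding g_def by (intro S1(4)) simp
    then show ?thesis using h by (auto intro!: bcontfun_eqI simp: G_def H_def rb ka)
  qed
  have der: "(apply_bcontfun (G f) has_real_derivative H f t) (at t) \<and>
        (apply_bcontfun (H f) has_real_derivative (T * H f t - D * G f t + f t)) (at t)" if "t < 0" for f t
  proof -
    have dh: "(apply_bcontfun (h f) has_vector_derivative \<zeta>2 * h f t + of_real (f t)) (at t)"
      using S2(1)[of "bcomp complex_of_real f" t] that by (simp add: h_def cb min_def)
    have dg: "(apply_bcontfun (g f) has_vector_derivative k f t) (at t)"
      using S1(1)[of "h f" t] that by (simp add: g_def ka min_def)
    have "(apply_bcontfun (k f) has_vector_derivative \<zeta>1 * k f t + (\<zeta>2 * h f t + of_real (f t))) (at t)"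
      unfolding ka[abs_def] by (intro has_vector_derivative_add has_vector_derivative_mult_right dg[unfolded ka] dh)
    moreover have "\<zeta>1 * k f t + (\<zeta>2 * h f t + of_real (f t)) = of_real T * k f t - of_real D * g f t + of_real (f t)"
      unfolding T[symmetric] D[symmetric] ka by (simp add: algebra_simps)
    ultimately have dk: "(apply_bcontfun (k f) has_vector_derivative of_real T * k f t - of_real D * g f t + of_real (f t)) (at t)"
      by simp
    have "((\<lambda>t. Re (g f t)) has_vector_derivative Re (k f t)) (at t)"
      by (rule bounded_linear.has_vector_derivative[OF bounded_linear_Re dg])
    moreover have "((\<lambda>t. Re (k f t)) has_vector_derivative Re (of_real T * k f t - of_real D * g f t + of_real (f t))) (at t)"
      by (rule bounded_linear.has_vector_derivative[OF bounded_linear_Re dk])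
    ultimately show ?thesis
      unfolding has_real_derivative_iff_has_vector_derivative
      by (simp add: G_def H_def rb(1)[abs_def])
  qed
  show ?thesis
    by (rule exI[of _ G], rule exI[of _ H]) (use der Gn Hn lin zero in auto)
qed

text \<open>Bounded solution operators for the planar system with matrix \<open>((\<alpha>, B), (r, \<gamma>))\<close>.\<close>

definition solves_mode ::
  "real \<Rightarrow> real \<Rightarrow> real \<Rightarrow> real \<Rightarrow> real \<Rightarrow>
    (bfun \<Rightarrow> bfun) \<Rightarrow> (bfun \<Rightarrow> bfun) \<Rightarrow>
    (bfun \<Rightarrow> bfun) \<Rightarrow> (bfun \<Rightarrow> bfun) \<Rightarrow> bool" where
  "solves_mode \<alpha> \<gamma> B r C K1 K2 K3 K4 \<longleftrightarrow>
    (\<forall>(f :: bfun) (g :: bfun). \<forall>t<0.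
        (apply_bcontfun (K1 f + K2 g) has_real_derivative
            (\<alpha> * apply_bcontfun (K1 f + K2 g) t + B * apply_bcontfun (K3 f + K4 g) t + apply_bcontfun f t)) (at t) \<and>
        (apply_bcontfun (K3 f + K4 g) has_real_derivative
            (r * apply_bcontfun (K1 f + K2 g) t + \<gamma> * apply_bcontfun (K3 f + K4 g) t + apply_bcontfun g t)) (at t)) \<and>
    (\<forall>K\<in>{K1, K2, K3, K4}. (\<forall>f :: bfun. norm (K f) \<le> C * norm f) \<and>
       (\<forall>f g. K (f - g) = K f - K g) \<and> (\<forall>f. (\<forall>t\<le>0. apply_bcontfun f t = 0) \<longrightarrow> K f = 0))"

text \<open>With the scalar solution \<open>G\<close> of the characteristic second order equation, the planar system is solved by
the adjugate matrix: \<open>y1 = (d/dt - \<gamma>) G f + B G g\<close> and \<open>y2 = r G f + (d/dt - \<alpha>) G g\<close>.\<close>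

lemma mode_solver:
  fixes \<zeta>1 \<zeta>2 :: complex
  assumes \<rho>: "\<rho> > 0" "\<bar>Re \<zeta>1\<bar> \<ge> \<rho>" "\<bar>Re \<zeta>2\<bar> \<ge> \<rho>"
    and T: "\<zeta>1 + \<zeta>2 = of_real (\<alpha> + \<gamma>)" and D: "\<zeta>1 * \<zeta>2 = of_real (\<alpha> * \<gamma> - B * r)"
    and \<nu>: "norm \<zeta>1 \<le> \<nu>" "\<bar>\<alpha>\<bar> \<le> \<nu>" "\<bar>\<gamma>\<bar> \<le> \<nu>" "\<bar>B\<bar> \<le> \<nu>" "\<bar>r\<bar> \<le> \<nu>"
  shows "\<exists>K1 K2 K3 K4. solves_mode \<alpha> \<gamma> B r (2 * \<nu> / \<rho>\<^sup>2 + 1 / \<rho>) K1 K2 K3 K4"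
proof -
  obtain G H :: "bfun \<Rightarrow> bfun" where
    der: "\<And>(f :: bfun) t. t < 0 \<Longrightarrow> (apply_bcontfun (G f) has_real_derivative apply_bcontfun (H f) t) (at t)"
       "\<And>(f :: bfun) t. t < 0 \<Longrightarrow> (apply_bcontfun (H f) has_real_derivative ((\<alpha> + \<gamma>) * apply_bcontfun (H f) t - (\<alpha> * \<gamma> - B * r) * apply_bcontfun (G f) t + apply_bcontfun f t)) (at t)"
    and n: "\<And>f. norm (G f) \<le> norm f / \<rho>\<^sup>2" "\<And>f. norm (H f) \<le> (norm \<zeta>1 / \<rho>\<^sup>2 + 1 / \<rho>) * norm f"
    and lin: "\<And>f g. G (f - g) = G f - G g" "\<And>f g. H (f - g) = H f - H g"
    and z: "\<And>f. (\<forall>t\<le>0. apply_bcontfun f t = 0) \<Longrightarrow> G f = 0" "\<And>f. (\<forall>t\<le>0. apply_bcontfun f t = 0) \<Longrightarrow> H f = 0"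
    using second_order_solver[OF \<rho> T D] by blast
  define K where "K c f = H f - c *\<^sub>R G f" for c f
  define J where "J c f = c *\<^sub>R G f" for c f
  have \<nu>0: "0 \<le> \<nu>" using \<nu> norm_ge_zero order_trans by blast
  have cG: "norm (c *\<^sub>R G f) \<le> \<nu> / \<rho>\<^sup>2 * norm f" if "\<bar>c\<bar> \<le> \<nu>" for c f
  proof -
    have "\<bar>c\<bar> * norm (G f) \<le> \<nu> * (norm f / \<rho>\<^sup>2)" using that n(1) by (intro mult_mono) (auto simp: \<nu>0)
    then show ?thesis by simp
  qed
  have "norm \<zeta>1 / \<rho>\<^sup>2 \<le> \<nu> / \<rho>\<^sup>2" using \<nu> by (intro divide_right_mono) auto
  then have Hn: "norm (H f) \<le> (\<nu> / \<rho>\<^sup>2 + 1 / \<rho>) * norm f" for f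
    using order_trans[OF n(2) mult_right_mono[of "norm \<zeta>1 / \<rho>\<^sup>2 + 1 / \<rho>" "\<nu> / \<rho>\<^sup>2 + 1 / \<rho>" "norm f"]] by simp
  have eq: "(2 * \<nu> / \<rho>\<^sup>2 + 1 / \<rho>) * x = (\<nu> / \<rho>\<^sup>2 + 1 / \<rho>) * x + \<nu> / \<rho>\<^sup>2 * x" for x
    by (simp add: algebra_simps)
  have Kn: "norm (K c f) \<le> (2 * \<nu> / \<rho>\<^sup>2 + 1 / \<rho>) * norm f" if "\<bar>c\<bar> \<le> \<nu>" for c f
    unfolding K_def eq using norm_triangle_ineq4[of "H f" "c *\<^sub>R G f"] Hn[of f] cG[OF that, of f] by linarith
  have Jn: "norm (J c f) \<le> (2 * \<nu> / \<rho>\<^sup>2 + 1 / \<rho>) * norm f" if "\<bar>c\<bar> \<le> \<nu>" for c f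
  proof -
    have "0 \<le> (\<nu> / \<rho>\<^sup>2 + 1 / \<rho>) * norm f" using \<nu>0 \<rho> by simp
    then show ?thesis unfolding J_def eq using cG[OF that, of f] by linarith
  qed
  have lz: "K c (f - g) = K c f - K c g" "J c (f - g) = J c f - J c g"
     "(\<forall>t\<le>0. apply_bcontfun f t = 0) \<Longrightarrow> K c f = 0" "(\<forall>t\<le>0. apply_bcontfun f t = 0) \<Longrightarrow> J c f = 0" for c f g
    using z[of f] by (simp_all add: K_def J_def lin scaleR_diff_right)
  have ap: "apply_bcontfun (K \<gamma> f + J B g) = (\<lambda>t. H f t - \<gamma> * G f t + B * G g t)"
     "apply_bcontfun (J r f + K \<alpha> g) = (\<lambda>t. r * G f t + (H g t - \<alpha> * G g t))" for f g
    by (auto simp: K_def J_def)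
  have "(apply_bcontfun (K \<gamma> f + J B g) has_real_derivative
            (\<alpha> * (K \<gamma> f + J B g) t + B * (J r f + K \<alpha> g) t + f t)) (at t) \<and>
        (apply_bcontfun (J r f + K \<alpha> g) has_real_derivative
            (r * (K \<gamma> f + J B g) t + \<gamma> * (J r f + K \<alpha> g) t + g t)) (at t)" if "t < 0" for f g t
    unfolding ap
    by (auto intro!: derivative_eq_intros der[OF that] simp: algebra_simps)
  note ode = this
  have "\<forall>L\<in>{K \<gamma>, J B, J r, K \<alpha>}. (\<forall>f. norm (L f) \<le> (2 * \<nu> / \<rho>\<^sup>2 + 1 / \<rho>) * norm f) \<and>
       (\<forall>f g. L (f - g) = L f - L g) \<and> (\<forall>f. (\<forall>t\<le>0. apply_bcontfun f t = 0) \<longrightarrow> L f = 0)"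
    using Kn[OF \<nu>(3)] Jn[OF \<nu>(4)] Jn[OF \<nu>(5)] Kn[OF \<nu>(2)] lz by blast
  with ode show ?thesis unfolding solves_mode_def by blast
qed

section \<open>Hyperbolic splitting of the linearized dynamics\<close>

definition freeze :: "real \<Rightarrow> bfun wiener \<Rightarrow> real wiener" where
  "freeze t f = Wiener (\<lambda>n. apply_bcontfun (coef f n) t)"

lemma abs_apply_le: "\<bar>apply_bcontfun f t\<bar> \<le> norm (f :: bfun)"
  using norm_bounded[of f t] by simp

lemma coef_freeze: "coef (freeze t f) n = apply_bcontfun (coef f n) t"
proof -
  have "(\<lambda>n. norm (apply_bcontfun (coef f n) t)) summable_on UNIV"
    by (rule summable_on_comparison_test[OF coef_summable[of f]]) (auto intro: norm_bounded simp del: real_norm_def)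
  then show ?thesis unfolding freeze_def by (subst coef_Wiener) auto
qed

lemma bounded_linear_apply_bcontfun:
  "bounded_linear (\<lambda>f :: bfun. apply_bcontfun f t)"
  by (rule bounded_linear_intro[where K = 1]) (simp_all add: abs_apply_le)

lemma apply_weval:
  fixes f :: "bfun wiener"
  shows "apply_bcontfun (weval f x) t = (\<Sum>\<^sub>\<infinity>n. cos (of_int n * x) * apply_bcontfun (coef f n) t)"
proof -
  have "apply_bcontfun (weval f x) t = (\<Sum>\<^sub>\<infinity>n. apply_bcontfun (cos (of_int n * x) *\<^sub>R coef f n) t)"
    unfolding weval_def
    by (rule infsumI[symmetric], rule has_sum_bounded_linear[OF bounded_linear_apply_bcontfun],
        rule has_sum_infsum, rule weval_summable)
  then show ?thesis by simp
qed

lemma weval_freeze: "weval (freeze t f) x = apply_bcontfun (weval f x) t"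
  unfolding apply_weval by (simp add: weval_def coef_freeze)

lemma C2coef_freeze:
  assumes "C2coef f" shows "C2coef (freeze t f)" and "laplace (freeze t f) = freeze t (laplace f)"
proof -
  show c: "C2coef (freeze t f)"
    unfolding C2coef_def coef_freeze
    by (rule summable_on_comparison_test[OF assms[unfolded C2coef_def]])
       (auto intro!: mult_left_mono abs_apply_le)
  show "laplace (freeze t f) = freeze t (laplace f)"
    by (rule wiener_eqI) (simp add: coef_laplace[OF c] coef_laplace[OF assms] coef_freeze)
qed

lemma freeze_hom: "real_alg_hom (\<lambda>f :: bfun wiener. apply_bcontfun (weval f x) t)"
  unfolding real_alg_hom_def
  by (simp add: weval_one weval_add weval_mult weval_scaleR apply_bcontfun_one apply_bcontfun_mult)

lemma continuous_on_apply_weval: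
  fixes f :: "bfun wiener"
  shows "continuous_on S (\<lambda>(x, t). apply_bcontfun (weval f (x / l)) t)"
proof -
  have "continuous_on S (\<lambda>z. \<Sum>\<^sub>\<infinity>n. cos (of_int n * (fst z / l)) * apply_bcontfun (coef f n) (snd z))"
  proof (rule infsum_continuous_on[where M = "\<lambda>n. norm (coef f n)"])
    fix n
    show "continuous_on S (\<lambda>z. cos (of_int n * (fst z / l)) * apply_bcontfun (coef f n) (snd z))"
      unfolding divide_inverse
      by (intro continuous_intros continuous_on_compose2[OF continuous_on_apply_bcontfun[of UNIV]]) auto
    fix z :: "real \<times> real"
    have "\<bar>cos (of_int n * (fst z / l))\<bar> * \<bar>apply_bcontfun (coef f n) (snd z)\<bar> \<le> 1 * norm (coef f n)"
      using norm_bounded[of "coef f n" "snd z"] by (intro mult_mono) auto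
    then show "norm (cos (of_int n * (fst z / l)) * apply_bcontfun (coef f n) (snd z)) \<le> norm (coef f n)"
      by (simp add: abs_mult)
  qed (rule coef_summable)
  then show ?thesis by (simp add: apply_weval case_prod_unfold)
qed

definition steady_lift :: "real wiener \<Rightarrow> bfun wiener" where
  "steady_lift f = Wiener (\<lambda>n. const_bcontfun (coef f n))"

lemma norm_const_bcontfun: "norm (const_bcontfun c :: bfun) \<le> \<bar>c\<bar>"
  by (rule norm_bound) (simp add: const_bcontfun.rep_eq)

lemma steady_lift:
  "apply_bcontfun (weval (steady_lift f) x) t = weval f x" "norm (steady_lift f) \<le> norm f"
proof -
  have le: "(\<Sum>n\<in>F. norm (const_bcontfun (coef f n) :: bfun)) \<le> norm f" if "finite F" for F
    by (rule order_trans[OF sum_mono sum_norm_coef_le[OF that, of f]]) (simp add: norm_const_bcontfun)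
  have c: "coef (steady_lift f) = (\<lambda>n. const_bcontfun (coef f n))"
    unfolding steady_lift_def by (rule wiener_of_finite_bounds(1)[OF le]) simp_all
  show "norm (steady_lift f) \<le> norm f"
    unfolding steady_lift_def by (rule wiener_of_finite_bounds(2)[OF le]) simp_all
  show "apply_bcontfun (weval (steady_lift f) x) t = weval f x"
    unfolding apply_weval by (simp add: c const_bcontfun.rep_eq weval_def)
qed

lemma wmode_0:
  "weval (wmode 0 a) x = a" "norm (wmode 0 a) \<le> norm a"
proof -
  have "weval (wmode 0 a) x = (\<Sum>\<^sub>\<infinity>n\<in>{0}. cos (of_int n * x) *\<^sub>R coef (wmode 0 a) n)"
    unfolding weval_def by (rule infsum_cong_neutral) (auto simp: coef_wmode)
  then show "weval (wmode 0 a) x = a" by (simp add: coef_wmode)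
  have "norm (wmode 0 a) = (\<Sum>\<^sub>\<infinity>n\<in>{0}. norm (coef (wmode 0 a) n))"
    unfolding norm_wiener_def by (rule infsum_cong_neutral) (auto simp: coef_wmode)
  then show "norm (wmode 0 a) \<le> norm a" by (simp add: coef_wmode)
qed

text \<open>Because the norm takes the supremum in time before summing over the modes, the series of derivatives converges
uniformly as soon as it represents an element of the algebra.\<close>

lemma weval_time_derivative:
  fixes f :: "bfun wiener"
  assumes t: "t < 0"
    and d: "\<And>n t. t < 0 \<Longrightarrow> (apply_bcontfun (coef f n) has_real_derivative apply_bcontfun (coef g n) t) (at t)"
  shows "(apply_bcontfun (weval f x) has_real_derivative apply_bcontfun (weval g x) t) (at t)"
proof -
  have "((\<lambda>t. \<Sum>\<^sub>\<infinity>n. cos (of_int n * x) * apply_bcontfun (coef f n) t) has_real_derivative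
     (\<Sum>\<^sub>\<infinity>n. cos (of_int n * x) * apply_bcontfun (coef g n) t)) (at t)"
  proof (rule infsum_has_real_derivative[where S = "{..<0}" and M = "\<lambda>n. norm (coef g n)"])
    fix n and s :: real assume s: "s \<in> {..<0}"
    then show "((\<lambda>t. cos (of_int n * x) * apply_bcontfun (coef f n) t) has_real_derivative
        cos (of_int n * x) * apply_bcontfun (coef g n) s) (at s)"
      using d[of s n] by (intro DERIV_cmult) auto
    have "\<bar>cos (of_int n * x)\<bar> * \<bar>apply_bcontfun (coef g n) s\<bar> \<le> 1 * norm (coef g n)"
      using norm_bounded[of "coef g n" s] by (intro mult_mono) auto
    then show "\<bar>cos (of_int n * x) * apply_bcontfun (coef g n) s\<bar> \<le> norm (coef g n)"
      by (simp add: abs_mult)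
  next
    fix s :: real
    have "(\<lambda>n. cos (of_int n * x) *\<^sub>R coef (freeze s f) n) summable_on UNIV" by (rule weval_summable)
    then show "(\<lambda>n. cos (of_int n * x) * apply_bcontfun (coef f n) s) summable_on UNIV"
      by (simp add: coef_freeze)
  qed (use t in \<open>auto intro: coef_summable\<close>)
  then show ?thesis by (simp add: apply_weval[abs_def])
qed

lemma quadratic_roots:
  fixes T D :: real
  shows "\<exists>z1 z2 :: complex. z1 + z2 = of_real T \<and> z1 * z2 = of_real D"
proof -
  define s where "s = csqrt (of_real (T\<^sup>2 - 4 * D))"
  have s: "s * s = of_real T * of_real T - 4 * of_real D"
    using power2_csqrt[of "of_real (T\<^sup>2 - 4 * D)"] by (simp add: s_def power2_eq_square)
  have "(of_real T + s) / 2 * ((of_real T - s) / 2) = (of_real T * of_real T - s * s) / 4"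
    by (simp add: algebra_simps)
  also have "\<dots> = of_real D" unfolding s by simp
  finally show ?thesis
    by (intro exI[of _ "(of_real T + s) / 2"] exI[of _ "(of_real T - s) / 2"]) (simp add: field_simps)
qed

text \<open>Both root estimates compare the two sides of \<open>(z - \<alpha>) (z - \<gamma>) = c\<close>: far from \<open>\<alpha>\<close> and \<open>\<gamma>\<close> the product
is too large.\<close>

lemma root_norm_le:
  fixes z :: complex
  assumes "(z - of_real \<alpha>) * (z - of_real \<gamma>) = of_real c"
  shows "norm z \<le> \<bar>\<alpha>\<bar> + \<bar>\<gamma>\<bar> + \<bar>c\<bar> + 1"
proof (rule ccontr)
  assume "\<not> ?thesis"
  then have z: "\<bar>\<alpha>\<bar> + \<bar>\<gamma>\<bar> + \<bar>c\<bar> + 1 < norm z" by simp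
  have "\<bar>c\<bar> + 1 < norm (z - of_real \<alpha>)" "1 < norm (z - of_real \<gamma>)"
    using z norm_triangle_ineq2[of z "of_real \<alpha>"] norm_triangle_ineq2[of z "of_real \<gamma>"] by auto
  then have "(\<bar>c\<bar> + 1) * 1 < norm (z - of_real \<alpha>) * norm (z - of_real \<gamma>)"
    by (intro mult_strict_mono) auto
  also have "\<dots> = \<bar>c\<bar>" unfolding norm_mult[symmetric] assms by simp
  finally show False by simp
qed

lemma root_Re_le:
  fixes z :: complex
  assumes "(z - of_real \<alpha>) * (z - of_real \<gamma>) = of_real c"
    and "\<alpha> + \<bar>c\<bar> + 1 \<le> m" "\<gamma> + \<bar>c\<bar> + 1 \<le> m"
  shows "Re z \<le> m"
proof (rule ccontr)
  assume "\<not> ?thesis"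
  then have z: "m < Re z" by simp
  have "\<bar>c\<bar> + 1 < norm (z - of_real \<alpha>)" "1 < norm (z - of_real \<gamma>)"
    using z assms complex_Re_le_cmod[of "z - of_real \<alpha>"] complex_Re_le_cmod[of "z - of_real \<gamma>"] by auto
  then have "(\<bar>c\<bar> + 1) * 1 < norm (z - of_real \<alpha>) * norm (z - of_real \<gamma>)"
    by (intro mult_strict_mono) auto
  also have "\<dots> = \<bar>c\<bar>" unfolding norm_mult[symmetric] assms(1) by simp
  finally show False by simp
qed

lemma root_char:
  fixes z :: complex
  assumes "z + w = of_real (\<alpha> + \<gamma>)" "z * w = of_real (\<alpha> * \<gamma> - c)"
  shows "(z - of_real \<alpha>) * (z - of_real \<gamma>) = of_real c"
proof -
  have "(z - of_real \<alpha>) * (z - of_real \<gamma>) = z * z - (z + w) * z + (z * w + of_real c)"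
    unfolding assms by (simp add: algebra_simps)
  then show ?thesis by (simp add: algebra_simps)
qed

text \<open>Eigenvalues of high modes lie near \<open>-d1 x\<close> or \<open>-d2 x\<close> with \<open>x = n\<^sup>2/l\<^sup>2\<close>, so that the
distance to the line \<open>Re z = \<beta>\<close> grows quadratically once it is positive for every mode.\<close>

lemma spectral_gap:
  fixes z :: "int \<Rightarrow> complex"
  assumes l: "l > 0" and d: "d1 > 0" "d2 > 0" and r: "r > 0"
    and z: "\<And>n. (z n - of_real (A - d1 * xval l n)) * (z n - of_real (- (r + d2 * xval l n))) = of_real (B * r)"
    and even: "\<And>n. z (- n) = z n"
    and \<beta>: "\<beta> > 0" "\<And>n. Re (z n) \<noteq> \<beta>"
  shows "\<exists>c>0. \<forall>n. \<bar>Re (z n) - \<beta>\<bar> \<ge> c * (1 + (of_int n)\<^sup>2)"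
proof -
  \<comment> \<open>beyond mode \<open>N\<close> the diffusion part exceeds twice the bound \<open>Q\<close> of the kinetic part\<close>
  define dm where "dm = min d1 d2"
  have dm: "dm > 0" "dm \<le> d1" "dm \<le> d2" using d by (auto simp: dm_def)
  define Q where "Q = \<bar>A\<bar> + \<bar>B * r\<bar> + 1"
  define c where "c = dm / (4 * l\<^sup>2)"
  define N where "N = nat \<lceil>l * sqrt (2 * Q / dm)\<rceil> + 1"
  have c: "c > 0" using dm l by (simp add: c_def)
  have Q: "Q > 0" by (simp add: Q_def add_nonneg_pos)
  have big: "\<bar>Re (z (int k)) - \<beta>\<bar> / (1 + (of_int (int k))\<^sup>2) \<ge> c" if k: "k \<ge> N" for k
  proof -
    let ?x = "xval l (int k)"
    have "l * sqrt (2 * Q / dm) \<le> real k" using k unfolding N_def by linarith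
    then have "(l * sqrt (2 * Q / dm))\<^sup>2 \<le> (real k)\<^sup>2" using l dm Q by (intro power_mono) auto
    then have "2 * Q / dm \<le> ?x" using l dm Q by (simp add: xval_def power_mult_distrib field_simps)
    then have Qx: "Q \<le> dm / 2 * ?x" using dm by (simp add: field_simps)
    have dx: "dm * ?x \<le> d1 * ?x" "dm * ?x \<le> d2 * ?x" using dm xval_bounds(1)[OF l] by (auto intro: mult_right_mono)
    have "Re (z (int k)) \<le> - (dm / 2 * ?x)"
    proof (rule root_Re_le[OF z])
      show "A - d1 * ?x + \<bar>B * r\<bar> + 1 \<le> - (dm / 2 * ?x)" using Qx dx unfolding Q_def by linarith
      show "- (r + d2 * ?x) + \<bar>B * r\<bar> + 1 \<le> - (dm / 2 * ?x)" using Qx dx r unfolding Q_def by linarith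
    qed
    then have "dm / 2 * ?x \<le> \<bar>Re (z (int k)) - \<beta>\<bar>" using \<beta>(1) by linarith
    moreover have "c * (1 + (of_int (int k))\<^sup>2) \<le> c * (2 * l\<^sup>2 * ?x)"
      using xval_bounds(3)[OF l, of "int k"] k c by (intro mult_left_mono) (auto simp: N_def)
    moreover have "c * (2 * l\<^sup>2 * ?x) = dm / 2 * ?x" using l by (simp add: c_def field_simps)
    ultimately have "c * (1 + (of_int (int k))\<^sup>2) \<le> \<bar>Re (z (int k)) - \<beta>\<bar>" by linarith
    then show ?thesis using one_plus_square_pos(1)[of "of_int (int k)"] by (simp only: le_divide_eq if_True)
  qed
  have pos: "\<bar>Re (z (int k)) - \<beta>\<bar> / (1 + (of_int (int k))\<^sup>2) > 0" for k
    using \<beta>(2)[of "int k"] one_plus_square_pos(1)[of "of_int (int k)"] by (intro divide_pos_pos) auto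
  obtain \<kappa> where \<kappa>: "\<kappa> > 0" "\<And>k. \<bar>Re (z (int k)) - \<beta>\<bar> / (1 + (of_int (int k))\<^sup>2) \<ge> \<kappa>"
    using positive_lower_bound[of "\<lambda>_. True" "\<lambda>k. \<bar>Re (z (int k)) - \<beta>\<bar> / (1 + (of_int (int k))\<^sup>2)" c N] pos c big
    by auto
  have "\<kappa> * (1 + (of_int n)\<^sup>2) \<le> \<bar>Re (z n) - \<beta>\<bar>" for n
  proof -
    have "int (nat \<bar>n\<bar>) = n \<or> int (nat \<bar>n\<bar>) = - n" by linarith
    then have eq: "z (int (nat \<bar>n\<bar>)) = z n" "(of_int (int (nat \<bar>n\<bar>)) :: real)\<^sup>2 = (of_int n)\<^sup>2"
      using even by auto
    show ?thesis
      using \<kappa>(2)[of "nat \<bar>n\<bar>"] one_plus_square_pos(1)[of "of_int n"] unfolding eq by (simp only: le_divide_eq if_True)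
  qed
  with \<kappa>(1) show ?thesis by blast
qed

text \<open>The rate \<open>\<beta>\<close> lies strictly between \<open>0\<close> and the real part of the unstable eigenvalue and avoids the
real parts of all eigenvalues. Subtracting it from the matrices describes solutions of size \<open>exp (\<beta> t)\<close>
as \<open>t \<rightarrow> -\<infinity>\<close>: the forced problems are uniquely solvable mode by mode, and \<open>(h1, h2)\<close> is a bounded
solution of the homogeneous problem at mode \<open>k\<close> that comes from the unstable eigenvector.\<close>

lemma hyperbolic_solver:
  assumes l: "l > 0" and d: "d1 > 0" "d2 > 0" and r: "r > 0" and B: "B \<noteq> 0"
    and ch: "(\<mu> - of_real (A - d1 * xval l k)) * (\<mu> - of_real (- (r + d2 * xval l k))) = of_real (B * r)"
    and unstable: "Re \<mu> > 0"
  shows "\<exists>\<beta> C K1 K2 K3 K4 (h1 :: bfun) (h2 :: bfun). \<beta> > 0 \<and> C > 0 \<and>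
    (\<forall>n :: int. solves_mode (A - d1 * xval l n - \<beta>) (- (r + d2 * xval l n) - \<beta>) B r (C / (1 + (of_int n)\<^sup>2))
        (K1 n) (K2 n) (K3 n) (K4 n)) \<and>
    (\<forall>n. K1 (- n) = K1 n \<and> K2 (- n) = K2 n \<and> K3 (- n) = K3 n \<and> K4 (- n) = K4 n) \<and>
    (\<forall>t<0. (apply_bcontfun h1 has_real_derivative
          ((A - d1 * xval l k - \<beta>) * apply_bcontfun h1 t + B * apply_bcontfun h2 t)) (at t) \<and>
       (apply_bcontfun h2 has_real_derivative
          (r * apply_bcontfun h1 t + (- (r + d2 * xval l k) - \<beta>) * apply_bcontfun h2 t)) (at t)) \<and>
    apply_bcontfun h1 0 \<noteq> 0"
proof -
  define \<alpha> where "\<alpha> n = A - d1 * xval l n" for n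
  define \<gamma> where "\<gamma> n = - (r + d2 * xval l n)" for n
  have ev: "\<alpha> (- n) = \<alpha> n" "\<gamma> (- n) = \<gamma> n" for n by (simp_all add: \<alpha>_def \<gamma>_def)
  have "\<forall>k. \<exists>z1 z2 :: complex. z1 + z2 = of_real (\<alpha> (int k) + \<gamma> (int k)) \<and> z1 * z2 = of_real (\<alpha> (int k) * \<gamma> (int k) - B * r)"
    using quadratic_roots by blast
  then obtain y1 y2 :: "nat \<Rightarrow> complex" where y: "\<And>k. y1 k + y2 k = of_real (\<alpha> (int k) + \<gamma> (int k))"
      "\<And>k. y1 k * y2 k = of_real (\<alpha> (int k) * \<gamma> (int k) - B * r)" by metis
  define z1 where "z1 n = y1 (nat \<bar>n\<bar>)" for n :: int
  define z2 where "z2 n = y2 (nat \<bar>n\<bar>)" for n :: int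
  have abs: "\<alpha> (int (nat \<bar>n\<bar>)) = \<alpha> n" "\<gamma> (int (nat \<bar>n\<bar>)) = \<gamma> n" for n
    by (simp_all add: \<alpha>_def \<gamma>_def xval_def)
  have z: "z1 n + z2 n = of_real (\<alpha> n + \<gamma> n)" "z1 n * z2 n = of_real (\<alpha> n * \<gamma> n - B * r)" for n
    using y[of "nat \<bar>n\<bar>"] unfolding abs by (simp_all add: z1_def z2_def)
  have zev: "z1 (- n) = z1 n" "z2 (- n) = z2 n" for n by (simp_all add: z1_def z2_def)
  have ch1: "(z1 n - of_real (\<alpha> n)) * (z1 n - of_real (\<gamma> n)) = of_real (B * r)" for n
    by (rule root_char[OF z])
  have ch2: "(z2 n - of_real (\<alpha> n)) * (z2 n - of_real (\<gamma> n)) = of_real (B * r)" for n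
    by (rule root_char[of _ "z1 n"]) (use z[of n] in \<open>simp_all add: add.commute mult.commute\<close>)
  \<comment> \<open>a growth rate below \<open>\<mu>\<close> that avoids the countably many real parts\<close>
  have "countable (range (\<lambda>n. Re (z1 n)) \<union> range (\<lambda>n. Re (z2 n)))" by simp
  then have "\<not> {0<..<Re \<mu>} \<subseteq> range (\<lambda>n. Re (z1 n)) \<union> range (\<lambda>n. Re (z2 n))"
    using uncountable_open_interval[of 0 "Re \<mu>"] unstable countable_subset by blast
  then obtain \<beta> where "\<beta> \<in> {0<..<Re \<mu>}" and r12: "\<beta> \<notin> range (\<lambda>n. Re (z1 n))" "\<beta> \<notin> range (\<lambda>n. Re (z2 n))"
    by blast
  then have \<beta>: "0 < \<beta>" "\<beta> < Re \<mu>" by auto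
  have ne: "Re (z1 n) \<noteq> \<beta>" "Re (z2 n) \<noteq> \<beta>" for n using r12 by (metis rangeI)+
  obtain c1 where c1: "c1 > 0" "\<And>n. \<bar>Re (z1 n) - \<beta>\<bar> \<ge> c1 * (1 + (of_int n)\<^sup>2)"
    using spectral_gap[OF l d r ch1[unfolded \<alpha>_def \<gamma>_def] zev(1) \<beta>(1) ne(1)] by blast
  obtain c2 where c2: "c2 > 0" "\<And>n. \<bar>Re (z2 n) - \<beta>\<bar> \<ge> c2 * (1 + (of_int n)\<^sup>2)"
    using spectral_gap[OF l d r ch2[unfolded \<alpha>_def \<gamma>_def] zev(2) \<beta>(1) ne(2)] by blast
  define c where "c = min c1 c2"
  have c: "c > 0" using c1 c2 by (simp add: c_def)
  define \<nu> where "\<nu> = 2 * \<bar>A\<bar> + 2 * r + (d1 + d2) / l\<^sup>2 + \<bar>B * r\<bar> + 1 + \<beta> + \<bar>B\<bar>"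
  have \<nu>: "\<bar>\<alpha> n\<bar> + \<bar>\<gamma> n\<bar> + \<bar>B * r\<bar> + 1 + \<beta> + \<bar>B\<bar> + r \<le> \<nu> * (1 + (of_int n)\<^sup>2)" for n
  proof -
    let ?w = "1 + (of_int n :: real)\<^sup>2" and ?c = "2 * \<bar>A\<bar> + 2 * r + \<bar>B * r\<bar> + 1 + \<beta> + \<bar>B\<bar>"
    have "?c * 1 \<le> ?c * ?w" using r \<beta> by (intro mult_left_mono) auto
    moreover have "d1 * xval l n \<le> d1 * (1 / l\<^sup>2 * ?w)" "d2 * xval l n \<le> d2 * (1 / l\<^sup>2 * ?w)"
      using d by (intro mult_left_mono xval_bounds l; simp)+
    moreover have "\<nu> * ?w = ?c * ?w + d1 * (1 / l\<^sup>2 * ?w) + d2 * (1 / l\<^sup>2 * ?w)"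
    proof -
      have "(x + y + (d1 + d2) * k + u + 1 + \<beta> + v) * w = (x + y + u + 1 + \<beta> + v) * w + d1 * (k * w) + d2 * (k * w)"
        for x y k u v w :: real by (simp add: algebra_simps)
      from this[of _ _ "1 / l\<^sup>2"] show ?thesis unfolding \<nu>_def by simp
    qed
    moreover have "0 \<le> d1 * xval l n" "0 \<le> d2 * xval l n" using d xval_bounds(1)[OF l] by auto
    then have "\<bar>\<alpha> n\<bar> \<le> \<bar>A\<bar> + d1 * xval l n" "\<bar>\<gamma> n\<bar> \<le> r + d2 * xval l n"
      unfolding \<alpha>_def \<gamma>_def using r by linarith+
    moreover have "x1 + y1 + v + 1 + \<beta> + b + r \<le> N"
      if "(2 * a + 2 * r + v + 1 + \<beta> + b) * 1 \<le> cw" "X \<le> X'" "Y \<le> Y'" "N = cw + X' + Y'" "x1 \<le> a + X" "y1 \<le> r + Y" "0 \<le> a"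
      for x1 y1 v b a cw X X' Y Y' N :: real using that unfolding mult_1_right by linarith
    ultimately show ?thesis using abs_ge_zero[of A] by blast
  qed
  define C where "C = 2 * \<nu> / c\<^sup>2 + 1 / c"
  have "\<nu> > 0" unfolding \<nu>_def using r d l \<beta> by (intro add_pos_nonneg add_nonneg_pos) auto
  then have C: "C > 0" using c by (simp add: C_def add_pos_pos)
  have ex: "\<exists>K1 K2 K3 K4. solves_mode (\<alpha> n - \<beta>) (\<gamma> n - \<beta>) B r (C / (1 + (of_int n)\<^sup>2)) K1 K2 K3 K4" for n
  proof -
    let ?w = "1 + (of_int n :: real)\<^sup>2"
    have w: "?w > 0" by (rule one_plus_square_pos)
    have Ceq: "2 * (\<nu> * ?w) / (c * ?w)\<^sup>2 + 1 / (c * ?w) = C / ?w"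
      using w c by (simp add: C_def power2_eq_square add_divide_distrib)
    have cw: "c * ?w \<le> c1 * ?w" "c * ?w \<le> c2 * ?w" using w by (auto simp: c_def intro: mult_right_mono)
    have "c * ?w > 0" using c w by simp
    moreover have "\<bar>Re (z1 n - of_real \<beta>)\<bar> \<ge> c * ?w" "\<bar>Re (z2 n - of_real \<beta>)\<bar> \<ge> c * ?w"
      using c1(2)[of n] c2(2)[of n] cw by auto
    moreover have "(z1 n - of_real \<beta>) + (z2 n - of_real \<beta>) = of_real ((\<alpha> n - \<beta>) + (\<gamma> n - \<beta>))"
      using z(1)[of n] by (simp add: algebra_simps)
    moreover have "(z1 n - of_real \<beta>) * (z2 n - of_real \<beta>) = of_real ((\<alpha> n - \<beta>) * (\<gamma> n - \<beta>) - B * r)"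
    proof -
      have "(z1 n - of_real \<beta>) * (z2 n - of_real \<beta>) = z1 n * z2 n - of_real \<beta> * (z1 n + z2 n) + of_real \<beta> * of_real \<beta>"
        by (simp add: algebra_simps)
      then show ?thesis unfolding z by (simp add: algebra_simps)
    qed
    moreover have "norm (z1 n - of_real \<beta>) \<le> \<nu> * ?w"
      using norm_triangle_ineq4[of "z1 n" "of_real \<beta>"] root_norm_le[OF ch1[of n]] \<nu>[of n] \<beta> r by simp
    moreover have "\<bar>\<alpha> n - \<beta>\<bar> \<le> \<nu> * ?w" "\<bar>\<gamma> n - \<beta>\<bar> \<le> \<nu> * ?w" "\<bar>B\<bar> \<le> \<nu> * ?w" "\<bar>r\<bar> \<le> \<nu> * ?w"
      using \<nu>[of n] \<beta> r abs_ge_zero[of "B * r"] abs_ge_zero[of B] by linarith+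
    ultimately show ?thesis unfolding Ceq[symmetric] by (rule mode_solver)
  qed
  then have "\<forall>k::nat. \<exists>K1 K2 K3 K4. solves_mode (\<alpha> (int k) - \<beta>) (\<gamma> (int k) - \<beta>) B r
      (C / (1 + (of_int (int k))\<^sup>2)) K1 K2 K3 K4"
    by blast
  then obtain L1 L2 L3 L4 where "\<forall>k::nat. solves_mode (\<alpha> (int k) - \<beta>) (\<gamma> (int k) - \<beta>) B r
      (C / (1 + (of_int (int k))\<^sup>2)) (L1 k) (L2 k) (L3 k) (L4 k)"
    unfolding choice_iff by blast
  then have L: "solves_mode (\<alpha> (int k) - \<beta>) (\<gamma> (int k) - \<beta>) B r
      (C / (1 + (of_int (int k))\<^sup>2)) (L1 k) (L2 k) (L3 k) (L4 k)" for k by blast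
  define K1 where "K1 n = L1 (nat \<bar>n\<bar>)" for n :: int
  define K2 where "K2 n = L2 (nat \<bar>n\<bar>)" for n :: int
  define K3 where "K3 n = L3 (nat \<bar>n\<bar>)" for n :: int
  define K4 where "K4 n = L4 (nat \<bar>n\<bar>)" for n :: int
  have sq: "(of_int (int (nat \<bar>n\<bar>)) :: real)\<^sup>2 = (of_int n)\<^sup>2" for n by simp
  note Ln = L[of "nat \<bar>n\<bar>" for n, unfolded abs sq, folded K1_def K2_def K3_def K4_def]
  define \<zeta> where "\<zeta> = \<mu> - of_real \<beta>"
  have \<zeta>: "Re \<zeta> > 0" using \<beta> by (simp add: \<zeta>_def)
  have \<zeta>c: "(\<zeta> - of_real (\<alpha> k - \<beta>)) * (\<zeta> - of_real (\<gamma> k - \<beta>)) = of_real (B * r)"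
  proof -
    have "\<zeta> - of_real (\<alpha> k - \<beta>) = \<mu> - of_real (\<alpha> k)" "\<zeta> - of_real (\<gamma> k - \<beta>) = \<mu> - of_real (\<gamma> k)"
      by (simp_all add: \<zeta>_def)
    then show ?thesis using ch by (simp only: \<alpha>_def \<gamma>_def)
  qed
  define E where "E a t = Re (a * exp (of_real (min t 0) * \<zeta>))" for a t
  have E_bc: "E a \<in> bcontfun" for a
  proof (rule bcontfun_normI)
    show "continuous_on UNIV (E a)" unfolding E_def by (intro continuous_intros)
    fix t
    have "norm (E a t) \<le> norm a * exp (min t 0 * Re \<zeta>)"
      unfolding E_def real_norm_def by (rule order_trans[OF abs_Re_le_cmod]) (simp add: norm_mult)
    also have "\<dots> \<le> norm a * 1"
      using \<zeta> by (intro mult_left_mono) (auto simp: mult_nonpos_nonneg)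
    finally show "norm (E a t) \<le> norm a" by simp
  qed
  have E_der: "(E a has_real_derivative E (a * \<zeta>) t) (at t)" if "t < 0" for a t
  proof -
    have "((\<lambda>t. Re (a * exp (t *\<^sub>R \<zeta>))) has_vector_derivative Re (a * (\<zeta> * exp (t *\<^sub>R \<zeta>)))) (at t)"
      by (rule bounded_linear.has_vector_derivative[OF bounded_linear_Re
          has_vector_derivative_mult_right[OF exp_scaleR_has_vector_derivative_left]])
    then have "((\<lambda>t. Re (a * exp (t *\<^sub>R \<zeta>))) has_real_derivative Re (a * (\<zeta> * exp (t *\<^sub>R \<zeta>)))) (at t)"
      by (simp only: has_real_derivative_iff_has_vector_derivative)
    then have "(E a has_real_derivative Re (a * (\<zeta> * exp (t *\<^sub>R \<zeta>)))) (at t)"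
      by (rule has_field_derivative_transform_within_open[of _ _ _ "{..<0}"])
         (use that in \<open>auto simp: E_def scaleR_conv_of_real min_def\<close>)
    moreover have "Re (a * (\<zeta> * exp (t *\<^sub>R \<zeta>))) = E (a * \<zeta>) t"
      using that by (simp add: E_def scaleR_conv_of_real min_def mult.assoc)
    ultimately show ?thesis by simp
  qed
  define h1 where "h1 = Bcontfun (E (of_real B))"
  define h2 where "h2 = Bcontfun (E (\<zeta> - of_real (\<alpha> k - \<beta>)))"
  have h: "apply_bcontfun h1 = E (of_real B)" "apply_bcontfun h2 = E (\<zeta> - of_real (\<alpha> k - \<beta>))"
    by (simp_all add: h1_def h2_def Bcontfun_inverse E_bc)
  have E_lin: "c * E a t + c' * E a' t = E (of_real c * a + of_real c' * a') t" for c c' a a' t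
  proof -
    have "c * Re X + c' * Re Y = Re (of_real c * X + of_real c' * Y)" for X Y by simp
    then show ?thesis unfolding E_def by (simp only: distrib_right mult.assoc)
  qed
  have hd: "(apply_bcontfun h1 has_real_derivative
          ((\<alpha> k - \<beta>) * apply_bcontfun h1 t + B * apply_bcontfun h2 t)) (at t) \<and>
       (apply_bcontfun h2 has_real_derivative
          (r * apply_bcontfun h1 t + (\<gamma> k - \<beta>) * apply_bcontfun h2 t)) (at t)" if "t < 0" for t
  proof -
    have e1: "of_real B * \<zeta> = of_real (\<alpha> k - \<beta>) * of_real B + of_real B * (\<zeta> - of_real (\<alpha> k - \<beta>))"
      by (simp add: algebra_simps)
    have "(\<zeta> - of_real (\<alpha> k - \<beta>)) * \<zeta> = (\<zeta> - of_real (\<alpha> k - \<beta>)) * (\<zeta> - of_real (\<gamma> k - \<beta>)) + of_real (\<gamma> k - \<beta>) * (\<zeta> - of_real (\<alpha> k - \<beta>))"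
      by (simp only: right_diff_distrib mult.commute) simp
    then have e2: "(\<zeta> - of_real (\<alpha> k - \<beta>)) * \<zeta> = of_real r * of_real B + of_real (\<gamma> k - \<beta>) * (\<zeta> - of_real (\<alpha> k - \<beta>))"
      unfolding \<zeta>c by (simp add: mult.commute)
    show ?thesis
      unfolding h E_lin e1[symmetric] e2[symmetric] using E_der[OF that] by blast
  qed
  have h0: "apply_bcontfun h1 0 \<noteq> 0" using B by (simp add: h E_def)
  show ?thesis
    by (rule exI[of _ \<beta>], rule exI[of _ C], rule exI[of _ K1], rule exI[of _ K2], rule exI[of _ K3], rule exI[of _ K4],
        rule exI[of _ h1], rule exI[of _ h2], intro conjI \<beta>(1) C h0 allI impI Ln[unfolded \<alpha>_def \<gamma>_def]
        hd[unfolded \<alpha>_def \<gamma>_def, THEN conjunct1] hd[unfolded \<alpha>_def \<gamma>_def, THEN conjunct2])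
       (simp_all add: K1_def K2_def K3_def K4_def)
qed

section \<open>Solutions leaving an unstable steady state\<close>

lemma freeze_eq_0:
  fixes f :: "bfun wiener"
  assumes l: "l > 0" and "\<And>x. x \<in> {0..l * pi} \<Longrightarrow> apply_bcontfun (weval f (x / l)) t = 0"
  shows "apply_bcontfun (coef f n) t = 0"
proof -
  have "freeze t f = 0"
    by (rule weval_injective[OF l]) (simp add: weval_freeze assms(2))
  then have "coef (freeze t f) n = 0" by simp
  then show ?thesis by (simp add: coef_freeze)
qed

lemma continuous_zero_left:
  fixes f :: "bfun"
  assumes "\<And>t. t < 0 \<Longrightarrow> apply_bcontfun f t = 0"
  shows "apply_bcontfun f 0 = 0"
proof -
  have "continuous (at 0) (apply_bcontfun f)"
    using continuous_on_apply_bcontfun[of UNIV f] by (metis continuous_on_eq_continuous_at open_UNIV UNIV_I)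
  then have "continuous (at_left 0) (apply_bcontfun f)" by (rule continuous_at_imp_continuous_at_within)
  then have "(apply_bcontfun f \<longlongrightarrow> apply_bcontfun f 0) (at_left 0)"
    by (simp add: continuous_within)
  moreover have "(apply_bcontfun f \<longlongrightarrow> 0) (at_left 0)"
    by (rule tendsto_eventually) (auto simp: eventually_at_filter assms)
  ultimately show ?thesis by (rule tendsto_unique[rotated]) simp
qed

text \<open>If the constant state has an unstable eigenvalue at \<open>r0\<close>, then no steady state close to it with \<open>r\<close> close to
\<open>r0\<close> is stable. A perturbation \<open>exp (\<beta> t) (y, z)\<close> that exists for all negative times is constructed by
the Lyapunov-Perron method. The linear operator is that of the constant state at \<open>r0\<close>; the dependence of the linearization on the
given steady state and the difference \<open>r - r0\<close> are put into the forcing, where they have a small Lipschitz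
constant, so that no eigenvalue of the perturbed operator has to be followed. The perturbation tends to zero
as \<open>t \<rightarrow> -\<infinity>\<close> and is not identically zero; shifting time makes the initial deviation arbitrarily small
while a fixed deviation is still reached.\<close>

lemma lyapunov_perron:
  fixes k :: int
  assumes b: "0 < b" and a: "0 < a" and d: "0 < d1" "0 < d2" and l: "0 < l" and r0: "0 < r0"
    and ch: "(\<mu> - of_real (HT_A0 a b - d1 * xval l k)) * (\<mu> - of_real (- (r0 + d2 * xval l k)))
        = of_real (HT_B0 a b * r0)"
    and unstable: "Re \<mu> > 0"
  shows "\<exists>\<epsilon>>0. \<forall>r U V. HT_bif_solution a b d1 d2 l r0 \<epsilon> r U V \<longrightarrow> \<not> HT_stable a b d1 d2 r l U V"
proof -
  let ?u = "HT_u0 a b" and ?A = "HT_A0 a b" and ?B = "HT_B0 a b"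
  have u: "?u > 0" using HT_u0_root[OF b] by blast
  have B: "?B \<noteq> 0" using HT_B0_neg[OF b a] by simp
  obtain \<beta> CK K1 K2 K3 K4 and h1 h2 :: "bfun" where solver: "\<beta> > 0 \<and> CK > 0 \<and>
    (\<forall>n :: int. solves_mode (?A - d1 * xval l n - \<beta>) (- (r0 + d2 * xval l n) - \<beta>) ?B r0 (CK / (1 + (of_int n)\<^sup>2))
        (K1 n) (K2 n) (K3 n) (K4 n)) \<and>
    (\<forall>n. K1 (- n) = K1 n \<and> K2 (- n) = K2 n \<and> K3 (- n) = K3 n \<and> K4 (- n) = K4 n) \<and>
    (\<forall>t<0. (apply_bcontfun h1 has_real_derivative
          ((?A - d1 * xval l k - \<beta>) * apply_bcontfun h1 t + ?B * apply_bcontfun h2 t)) (at t) \<and>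
       (apply_bcontfun h2 has_real_derivative
          (r0 * apply_bcontfun h1 t + (- (r0 + d2 * xval l k) - \<beta>) * apply_bcontfun h2 t)) (at t)) \<and>
    apply_bcontfun h1 0 \<noteq> 0"
    using hyperbolic_solver[OF l d r0 B ch unstable] by (elim exE) (rule that)
  note \<beta> = solver[THEN conjunct1] and CK = solver[THEN conjunct2, THEN conjunct1]
    and sm = solver[THEN conjunct2, THEN conjunct2, THEN conjunct1, rule_format]
    and Kev = solver[THEN conjunct2, THEN conjunct2, THEN conjunct2, THEN conjunct1]
    and hd = solver[THEN conjunct2, THEN conjunct2, THEN conjunct2, THEN conjunct2, THEN conjunct1]
    and h0 = solver[THEN conjunct2, THEN conjunct2, THEN conjunct2, THEN conjunct2, THEN conjunct2]
  have ode: "(apply_bcontfun (K1 n f + K2 n g) has_real_derivative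
          ((?A - d1 * xval l n - \<beta>) * apply_bcontfun (K1 n f + K2 n g) t
            + ?B * apply_bcontfun (K3 n f + K4 n g) t + apply_bcontfun f t)) (at t) \<and>
       (apply_bcontfun (K3 n f + K4 n g) has_real_derivative
          (r0 * apply_bcontfun (K1 n f + K2 n g) t
            + (- (r0 + d2 * xval l n) - \<beta>) * apply_bcontfun (K3 n f + K4 n g) t + apply_bcontfun g t)) (at t)"
    if "t < 0" for n t and f g :: "bfun"
    using sm[of n] that unfolding solves_mode_def by blast
  have Ke: "K (- n) = K n" and Kn: "norm (K n f) \<le> CK / (1 + (of_int n)\<^sup>2) * norm f"
    and Kl: "K n (f - g) = K n f - K n g" and Kz: "(\<forall>t\<le>0. apply_bcontfun f t = 0) \<Longrightarrow> K n f = 0"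
    if "K \<in> {K1, K2, K3, K4}" for K n and f g :: "bfun"
  proof -
    have "K n \<in> {K1 n, K2 n, K3 n, K4 n}" using that by auto
    then show "norm (K n f) \<le> CK / (1 + (of_int n)\<^sup>2) * norm f" "K n (f - g) = K n f - K n g"
      "(\<forall>t\<le>0. apply_bcontfun f t = 0) \<Longrightarrow> K n f = 0"
      using sm[of n] unfolding solves_mode_def by blast+
    show "K (- n) = K n" using that Kev by auto
  qed
  have W: "coef (wmult K f) n = K n (coef f n)" "norm (wmult K f) \<le> CK * norm f" "C2coef (wmult K f)"
    and WD: "wmult K (f - g) = wmult K f - wmult K g"
    if K: "K \<in> {K1, K2, K3, K4}" for K n and f g :: "bfun wiener"
    using wmult(1-3)[of K CK, OF Kn[OF K] Ke[OF K]] wmult_diff[of K CK, OF Kn[OF K] Ke[OF K] Kl[OF K]] by blast+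
  obtain C \<eta>0 where C: "C > 0" and \<eta>0: "\<eta>0 > 0" "2 * \<eta>0 \<le> ?u / 2" and lip:
    "\<And>\<eta> (e :: bfun wiener) p q y z y' z'. \<eta> \<le> \<eta>0 \<Longrightarrow> norm p \<le> \<eta> \<Longrightarrow> norm q \<le> \<eta> \<Longrightarrow>
       norm e * norm y \<le> \<eta> \<Longrightarrow> norm e * norm z \<le> \<eta> \<Longrightarrow> norm e * norm y' \<le> \<eta> \<Longrightarrow> norm e * norm z' \<le> \<eta> \<Longrightarrow>
       norm (HT_F a b e p q y z - HT_F a b e p q y' z') \<le> C * \<eta> * (norm (y - y') + norm (z - z')) \<and>
       norm (HT_G a b e p q y z - HT_G a b e p q y' z') \<le> C * \<eta> * (norm (y - y') + norm (z - z'))"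
    using HT_FG_lipschitz[OF b, of a] by blast
  define Kl where "Kl = inverse_square_sum * (1 + l\<^sup>2)"
  obtain \<eta>1 where \<eta>1: "\<eta>1 > 0" "\<And>s. 0 < s \<Longrightarrow> s \<le> \<eta>1 \<Longrightarrow> s * (4 * CK * C * (r0 + 2)) \<le> 1 / 4"
    using small_factor[of "1/4" "4 * CK * C * (r0 + 2)"] by auto
  define \<eta> where "\<eta> = min \<eta>0 \<eta>1"
  have \<eta>: "0 < \<eta>" "\<eta> \<le> \<eta>0" "\<eta> * (4 * CK * C * (r0 + 2)) \<le> 1 / 4" using \<eta>0 \<eta>1 by (auto simp: \<eta>_def)
  obtain \<epsilon>1 where \<epsilon>1: "\<epsilon>1 > 0" "\<And>s. 0 < s \<Longrightarrow> s \<le> \<epsilon>1 \<Longrightarrow> s * Kl \<le> \<eta>"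
    using small_factor[OF \<eta>(1), of Kl] by blast
  obtain \<epsilon>2 where \<epsilon>2: "\<epsilon>2 > 0" "\<And>s. 0 < s \<Longrightarrow> s \<le> \<epsilon>2 \<Longrightarrow> s * (4 * CK) \<le> 1 / 4"
    using small_factor[of "1/4" "4 * CK"] by auto
  define \<epsilon> where "\<epsilon> = min 1 (min \<epsilon>1 \<epsilon>2)"
  have \<epsilon>: "0 < \<epsilon>" "\<epsilon> \<le> 1" "\<epsilon> * Kl \<le> \<eta>" "\<epsilon> * (4 * CK) \<le> 1 / 4"
    using \<epsilon>1 \<epsilon>2 by (auto simp: \<epsilon>_def)
  have "\<not> HT_stable a b d1 d2 r l U V" if bif: "HT_bif_solution a b d1 d2 l r0 \<epsilon> r U V" for r U V
  proof
    assume stable: "HT_stable a b d1 d2 r l U V"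
    have r: "r > 0" "\<bar>r - r0\<bar> < \<epsilon>" and steady: "HT_steady_state a b d1 d2 r l U V"
      and near: "C2_near l \<epsilon> U ?u" "C2_near l \<epsilon> V ?u"
      using bif by (auto simp: HT_bif_solution_def HT_v0_def)
    have UV: "neumann_C2 l U" "neumann_C2 l V" using steady by (auto simp: HT_steady_state_def)
    have K\<eta>: "inverse_square_sum * (1 + l\<^sup>2) * \<epsilon> \<le> \<eta>" using \<epsilon>(3) by (simp only: Kl_def mult_ac)
    obtain P where P0: "norm P \<le> inverse_square_sum * (1 + l\<^sup>2) * \<epsilon>" and P1: "\<forall>x\<in>{0..l * pi}. U x = ?u + weval P (x / l)"
      using C2_near_weval[OF l UV(1) near(1)] by blast
    obtain Q where Q0: "norm Q \<le> inverse_square_sum * (1 + l\<^sup>2) * \<epsilon>" and Q1: "\<forall>x\<in>{0..l * pi}. V x = ?u + weval Q (x / l)"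
      using C2_near_weval[OF l UV(2) near(2)] by blast
    have P: "norm P \<le> \<eta>" "x \<in> {0..l * pi} \<Longrightarrow> U x = ?u + weval P (x / l)"
      and Q: "norm Q \<le> \<eta>" "x \<in> {0..l * pi} \<Longrightarrow> V x = ?u + weval Q (x / l)" for x
      using order_trans[OF P0 K\<eta>] order_trans[OF Q0 K\<eta>] P1 Q1 by blast+
    define p where "p = steady_lift P"
    define q where "q = steady_lift Q"
    have pq: "norm p \<le> \<eta>" "norm q \<le> \<eta>" "apply_bcontfun (weval p x) t = weval P x" "apply_bcontfun (weval q x) t = weval Q x" for x t
      using steady_lift(2)[of P] steady_lift(2)[of Q] P Q by (auto simp: p_def q_def steady_lift(1))
    \<comment> \<open>the weight \<open>exp (\<beta> t)\<close>, held at the value \<open>1\<close> for positive times to stay bounded; as an element \<open>e\<close> of the algebra it does not depend on \<open>x\<close>\<close>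
    define E where "E = Bcontfun (\<lambda>t. exp (\<beta> * min t 0))"
    have E_le: "norm (exp (\<beta> * min t 0)) \<le> 1" for t using \<beta> by (simp add: mult_nonneg_nonpos)
    have E: "apply_bcontfun E t = exp (\<beta> * min t 0)" for t
      unfolding E_def
      by (subst Bcontfun_inverse[OF bcontfun_normI[OF _ E_le]]) (auto intro!: continuous_intros)
    define e where "e = wmode 0 E"
    have e1: "norm e \<le> 1"
      using wmode_0(2)[of E] norm_bound[of E 1] E_le by (simp add: e_def E)
    have ev: "apply_bcontfun (weval e x) t = exp (\<beta> * t)" if "t \<le> 0" for x t
      using that by (simp add: e_def wmode_0 E min_def)
    define F where "F y z = HT_F a b e p q y z" for y z
    define G where "G y z = r *\<^sub>R HT_G a b e p q y z + (r - r0) *\<^sub>R (y - z)" for y z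
    have ball: "norm e * norm y \<le> \<eta>" if "norm y \<le> \<eta>" for y :: "bfun wiener"
      using mult_mono[OF e1 that] by simp
    have rr: "\<bar>r\<bar> \<le> r0 + 1" using r \<epsilon> by linarith
    have FG: "norm (F y z - F y' z') \<le> C * \<eta> * (norm (y - y') + norm (z - z'))"
      "norm (G y z - G y' z') \<le> ((r0 + 1) * (C * \<eta>) + \<epsilon>) * (norm (y - y') + norm (z - z'))"
      if yz: "norm y \<le> \<eta>" "norm z \<le> \<eta>" "norm y' \<le> \<eta>" "norm z' \<le> \<eta>" for y z y' z'
    proof -
      let ?d = "norm (y - y') + norm (z - z')"
      note L = lip[OF \<eta>(2) pq(1,2) ball[OF yz(1)] ball[OF yz(2)] ball[OF yz(3)] ball[OF yz(4)]]
      show "norm (F y z - F y' z') \<le> C * \<eta> * ?d" using L by (simp add: F_def)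
      have "G y z - G y' z' = r *\<^sub>R (HT_G a b e p q y z - HT_G a b e p q y' z') + (r - r0) *\<^sub>R ((y - y') - (z - z'))"
        by (simp add: G_def algebra_simps)
      also have "norm \<dots> \<le> \<bar>r\<bar> * norm (HT_G a b e p q y z - HT_G a b e p q y' z') + \<bar>r - r0\<bar> * norm ((y - y') - (z - z'))"
        by (intro norm_triangle_mono) simp_all
      also have "\<dots> \<le> (r0 + 1) * (C * \<eta> * ?d) + \<epsilon> * ?d"
        using L rr r r0 \<epsilon> by (intro add_mono mult_mono norm_triangle_ineq4) auto
      finally show "norm (G y z - G y' z') \<le> ((r0 + 1) * (C * \<eta>) + \<epsilon>) * ?d" by (simp add: algebra_simps)
    qed
    define hn where "hn = 2 * norm h1 + 2 * norm h2"
    obtain \<xi> where \<xi>: "\<xi> > 0" "\<xi> * hn \<le> \<eta> / 2"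
      using small_factor[of "\<eta> / 2" hn] \<eta>(1) by (auto intro: that[OF _ ])
    \<comment> \<open>a small multiple of the unstable homogeneous solution drives the fixed point problem\<close>
    define y0 where "y0 = \<xi> *\<^sub>R wmode k h1"
    define z0 where "z0 = \<xi> *\<^sub>R wmode k h2"
    define \<Psi> where "\<Psi> X = (case X of (y, z) \<Rightarrow>
       (y0 + (wmult K1 (F y z) + wmult K2 (G y z)), z0 + (wmult K3 (F y z) + wmult K4 (G y z))))" for X
    have "\<exists>X. norm X \<le> \<eta> \<and> \<Psi> X = X"
    proof (rule contraction_fixed_point)
      show "0 \<le> \<eta>" using \<eta> by simp
      fix X X' :: "bfun wiener \<times> bfun wiener"
      assume X: "norm X \<le> \<eta>" and X': "norm X' \<le> \<eta>"
      obtain y z where Xe: "X = (y, z)" by (cases X) auto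
      obtain y' z' where Xe': "X' = (y', z')" by (cases X') auto
      have bd: "norm y \<le> \<eta>" "norm z \<le> \<eta>" "norm y' \<le> \<eta>" "norm z' \<le> \<eta>"
        using X X' norm_fst_le[of y z] norm_snd_le[of z y] norm_fst_le[of y' z'] norm_snd_le[of z' y']
        by (auto simp: Xe Xe')
      define N where "N = norm (X - X')"
      have dN: "norm (y - y') + norm (z - z') \<le> 2 * N"
        using norm_fst_le[of "y - y'" "z - z'"] norm_snd_le[of "z - z'" "y - y'"] by (simp add: N_def Xe Xe')
      have N: "0 \<le> N" by (simp add: N_def)
      let ?f = "F y z - F y' z'" and ?g = "G y z - G y' z'"
      have "\<Psi> X - \<Psi> X' = (wmult K1 ?f + wmult K2 ?g, wmult K3 ?f + wmult K4 ?g)"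
        by (simp add: \<Psi>_def Xe Xe' WD)
      then have "norm (\<Psi> X - \<Psi> X') \<le> norm (wmult K1 ?f + wmult K2 ?g) + norm (wmult K3 ?f + wmult K4 ?g)"
        by (simp only: norm_Pair_le)
      also have "\<dots> \<le> (norm (wmult K1 ?f) + norm (wmult K2 ?g)) + (norm (wmult K3 ?f) + norm (wmult K4 ?g))"
        by (intro add_mono norm_triangle_ineq)
      also have "\<dots> \<le> (CK * norm ?f + CK * norm ?g) + (CK * norm ?f + CK * norm ?g)"
        by (intro add_mono W(2)) auto
      also have "\<dots> = 2 * CK * (norm ?f + norm ?g)" by (simp add: algebra_simps)
      also have "\<dots> \<le> 2 * CK * (C * \<eta> * (2 * N) + ((r0 + 1) * (C * \<eta>) + \<epsilon>) * (2 * N))"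
      proof -
        have "C * \<eta> * (norm (y - y') + norm (z - z')) \<le> C * \<eta> * (2 * N)"
          using C \<eta> dN by (intro mult_left_mono) auto
        moreover have "((r0 + 1) * (C * \<eta>) + \<epsilon>) * (norm (y - y') + norm (z - z')) \<le> ((r0 + 1) * (C * \<eta>) + \<epsilon>) * (2 * N)"
          using C \<eta> r0 \<epsilon> dN by (intro mult_left_mono) auto
        ultimately have "norm ?f + norm ?g \<le> C * \<eta> * (2 * N) + ((r0 + 1) * (C * \<eta>) + \<epsilon>) * (2 * N)"
          using FG[OF bd] by linarith
        then show ?thesis using CK by (intro mult_left_mono) auto
      qed
      also have "\<dots> = (\<eta> * (4 * CK * C * (r0 + 2)) + \<epsilon> * (4 * CK)) * N" by (simp add: algebra_simps)
      also have "\<dots> \<le> (1 / 4 + 1 / 4) * N" using \<eta> \<epsilon> N by (intro mult_right_mono add_mono) auto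
      finally show "norm (\<Psi> X - \<Psi> X') \<le> 1/2 * norm (X - X')" by (simp add: N_def)
    next
      have "F 0 0 = 0" "G 0 0 = 0" by (simp_all add: F_def G_def)
      moreover have w0: "wmult K 0 = 0" if "K \<in> {K1, K2, K3, K4}" for K
        using W(2)[OF that, of 0] by simp
      ultimately have "\<Psi> 0 = (y0, z0)" by (simp add: \<Psi>_def zero_prod_def)
      then have "norm (\<Psi> 0) \<le> norm y0 + norm z0" by (simp add: norm_Pair_le)
      also have "\<dots> \<le> \<xi> * (2 * norm h1) + \<xi> * (2 * norm h2)"
        unfolding y0_def z0_def norm_scaleR using \<xi>(1)
        by (intro add_mono mult_mono norm_wmode) auto
      also have "\<dots> = \<xi> * hn" by (simp add: hn_def algebra_simps)
      also have "\<dots> \<le> \<eta> / 2" by (rule \<xi>)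
      finally show "norm (\<Psi> 0) \<le> \<eta> / 2" .
    qed
    then obtain y z where X: "norm (y, z) \<le> \<eta>" and fp: "\<Psi> (y, z) = (y, z)" by (metis surj_pair)
    have bd: "norm y \<le> \<eta>" "norm z \<le> \<eta>"
      using X norm_fst_le[of y z] norm_snd_le[of z y] by auto
    define f where "f = F y z"
    define g where "g = G y z"
    have ye: "y = y0 + (wmult K1 f + wmult K2 g)" and ze: "z = z0 + (wmult K3 f + wmult K4 g)"
      using fp by (auto simp: \<Psi>_def f_def g_def)
    have C2: "C2coef y" "C2coef z"
      unfolding ye ze y0_def z0_def by (intro C2coef_add C2coef_scaleR C2coef_wmode W(3); simp)+
    have cy: "coef y n = (if n = k \<or> n = - k then \<xi> *\<^sub>R h1 else 0) + (K1 n (coef f n) + K2 n (coef g n))"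
      and cz: "coef z n = (if n = k \<or> n = - k then \<xi> *\<^sub>R h2 else 0) + (K3 n (coef f n) + K4 n (coef g n))" for n
      unfolding ye ze y0_def z0_def by (simp_all add: coef_wmode W(1))
    define dy where "dy = (d1 / l\<^sup>2) *\<^sub>R laplace y + (?A - \<beta>) *\<^sub>R y + ?B *\<^sub>R z + f"
    define dz where "dz = (d2 / l\<^sup>2) *\<^sub>R laplace z + r0 *\<^sub>R y - (r0 + \<beta>) *\<^sub>R z + g"
    have cdy: "coef dy n = (?A - d1 * xval l n - \<beta>) *\<^sub>R coef y n + ?B *\<^sub>R coef z n + coef f n"
      and cdz: "coef dz n = r0 *\<^sub>R coef y n + (- (r0 + d2 * xval l n) - \<beta>) *\<^sub>R coef z n + coef g n" for n
      by (simp_all add: dy_def dz_def coef_laplace C2 xval_def algebra_simps)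
    have ode_n: "(apply_bcontfun (coef y n) has_real_derivative apply_bcontfun (coef dy n) t) (at t)"
       "(apply_bcontfun (coef z n) has_real_derivative apply_bcontfun (coef dz n) t) (at t)" if t: "t < 0" for n t
    proof -
      note o = ode[OF t, of n "coef f n" "coef g n"]
      have xk: "xval l n = xval l k" if "n = k \<or> n = - k" using that by auto
      have ap: "apply_bcontfun (X + Y) = (\<lambda>t. apply_bcontfun X t + apply_bcontfun Y t)" for X Y :: "bfun"
        by auto
      let ?h1 = "if n = k \<or> n = - k then \<xi> *\<^sub>R h1 else 0" and ?h2 = "if n = k \<or> n = - k then \<xi> *\<^sub>R h2 else 0"
      have H: "(apply_bcontfun ?h1 has_real_derivative
          ((?A - d1 * xval l n - \<beta>) * apply_bcontfun ?h1 t + ?B * apply_bcontfun ?h2 t)) (at t)"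
        "(apply_bcontfun ?h2 has_real_derivative
          (r0 * apply_bcontfun ?h1 t + (- (r0 + d2 * xval l n) - \<beta>) * apply_bcontfun ?h2 t)) (at t)"
      proof -
        have s: "apply_bcontfun (\<xi> *\<^sub>R h) = (\<lambda>t. \<xi> * apply_bcontfun h t)" for h :: "bfun" by auto
        have zz: "apply_bcontfun (0 :: bfun) = (\<lambda>t. 0)" by auto
        have "(apply_bcontfun (\<xi> *\<^sub>R h1) has_real_derivative
          ((?A - d1 * xval l k - \<beta>) * apply_bcontfun (\<xi> *\<^sub>R h1) t + ?B * apply_bcontfun (\<xi> *\<^sub>R h2) t)) (at t)"
          "(apply_bcontfun (\<xi> *\<^sub>R h2) has_real_derivative
          (r0 * apply_bcontfun (\<xi> *\<^sub>R h1) t + (- (r0 + d2 * xval l k) - \<beta>) * apply_bcontfun (\<xi> *\<^sub>R h2) t)) (at t)"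
          unfolding s using hd[rule_format, OF t]
          by (auto intro!: derivative_eq_intros simp: algebra_simps)
        then show "(apply_bcontfun ?h1 has_real_derivative
          ((?A - d1 * xval l n - \<beta>) * apply_bcontfun ?h1 t + ?B * apply_bcontfun ?h2 t)) (at t)"
        "(apply_bcontfun ?h2 has_real_derivative
          (r0 * apply_bcontfun ?h1 t + (- (r0 + d2 * xval l n) - \<beta>) * apply_bcontfun ?h2 t)) (at t)"
          using xk by (auto simp: zz)
      qed
      have "apply_bcontfun (coef dy n) t = ((?A - d1 * xval l n - \<beta>) * apply_bcontfun ?h1 t + ?B * apply_bcontfun ?h2 t)
         + ((?A - d1 * xval l n - \<beta>) * apply_bcontfun (K1 n (coef f n) + K2 n (coef g n)) t
            + ?B * apply_bcontfun (K3 n (coef f n) + K4 n (coef g n)) t + apply_bcontfun (coef f n) t)"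
        unfolding cdy cy cz plus_bcontfun.rep_eq scaleR_bcontfun.rep_eq real_scaleR_def ring_distribs by linarith
      then show "(apply_bcontfun (coef y n) has_real_derivative apply_bcontfun (coef dy n) t) (at t)"
        unfolding cy using DERIV_add[OF H(1) conjunct1[OF o]] by (subst ap) (simp only:)
      have "apply_bcontfun (coef dz n) t = (r0 * apply_bcontfun ?h1 t + (- (r0 + d2 * xval l n) - \<beta>) * apply_bcontfun ?h2 t)
         + (r0 * apply_bcontfun (K1 n (coef f n) + K2 n (coef g n)) t
            + (- (r0 + d2 * xval l n) - \<beta>) * apply_bcontfun (K3 n (coef f n) + K4 n (coef g n)) t + apply_bcontfun (coef g n) t)"
        unfolding cdz cy cz plus_bcontfun.rep_eq scaleR_bcontfun.rep_eq real_scaleR_def ring_distribs by linarith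
      then show "(apply_bcontfun (coef z n) has_real_derivative apply_bcontfun (coef dz n) t) (at t)"
        unfolding cz using DERIV_add[OF H(2) conjunct2[OF o]] by (subst ap) (simp only:)
    qed
    define Y where "Y x t = apply_bcontfun (weval y (x / l)) t" for x t
    define Z where "Z x t = apply_bcontfun (weval z (x / l)) t" for x t
    note hom = freeze_hom
    have uq: "norm p \<le> ?u / 2" "norm (p + e * y) \<le> ?u / 2"
    proof -
      show "norm p \<le> ?u / 2" using pq(1) \<eta> \<eta>0 by linarith
      have "norm (p + e * y) \<le> norm p + norm e * norm y"
        by (rule order_trans[OF norm_triangle_ineq add_left_mono[OF norm_mult_ineq]])
      then show "norm (p + e * y) \<le> ?u / 2" using pq(1) ball[OF bd(1)] \<eta> \<eta>0 by linarith
    qed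
    have kin: "HT_f a b (U x + exp (\<beta> * t) * Y x t) (V x + exp (\<beta> * t) * Z x t) - HT_f a b (U x) (V x)
        = exp (\<beta> * t) * (?A * Y x t + ?B * Z x t + apply_bcontfun (weval f (x / l)) t)"
      "HT_g r (U x + exp (\<beta> * t) * Y x t) (V x + exp (\<beta> * t) * Z x t) - HT_g r (U x) (V x)
        = exp (\<beta> * t) * (r0 * (Y x t - Z x t) + apply_bcontfun (weval g (x / l)) t)"
      if x: "x \<in> {0..l * pi}" and t: "t \<le> 0" for x t
    proof -
      note H = HT_FG_hom[OF hom[of "x / l" t] b uq, where q = q and z = z]
      have h: "apply_bcontfun (weval (e * y) (x / l)) t = exp (\<beta> * t) * Y x t"
              "apply_bcontfun (weval (e * z) (x / l)) t = exp (\<beta> * t) * Z x t"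
        by (simp_all add: weval_mult apply_bcontfun_mult ev[OF t] Y_def Z_def)
      have arg: "?u + apply_bcontfun (weval (p + e * y) (x / l)) t = U x + exp (\<beta> * t) * Y x t"
         "?u + apply_bcontfun (weval (q + e * z) (x / l)) t = V x + exp (\<beta> * t) * Z x t"
         "?u + apply_bcontfun (weval p (x / l)) t = U x" "?u + apply_bcontfun (weval q (x / l)) t = V x"
        using h P(2)[OF x] Q(2)[OF x] by (simp_all add: weval_add pq)
      show "HT_f a b (U x + exp (\<beta> * t) * Y x t) (V x + exp (\<beta> * t) * Z x t) - HT_f a b (U x) (V x)
        = exp (\<beta> * t) * (?A * Y x t + ?B * Z x t + apply_bcontfun (weval f (x / l)) t)"
        using H(1)[unfolded arg h ev[OF t]] by (simp add: f_def F_def algebra_simps)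
      have gx: "apply_bcontfun (weval g (x / l)) t = r * apply_bcontfun (weval (HT_G a b e p q y z) (x / l)) t + (r - r0) * (Y x t - Z x t)"
        by (simp add: g_def G_def weval_add weval_scaleR weval_diff Y_def Z_def)
      show "HT_g r (U x + exp (\<beta> * t) * Y x t) (V x + exp (\<beta> * t) * Z x t) - HT_g r (U x) (V x)
        = exp (\<beta> * t) * (r0 * (Y x t - Z x t) + apply_bcontfun (weval g (x / l)) t)"
        using H(2)[where r = r, unfolded arg h ev[OF t]] unfolding gx by (simp add: algebra_simps)
    qed
    \<comment> \<open>a perturbation that vanishes at all negative times has vanishing forcing there, hence equals the homogeneous solution, which is not zero at time \<open>0\<close>\<close>
    have "\<exists>x1 t1. x1 \<in> {0..l * pi} \<and> t1 < 0 \<and> (Y x1 t1 \<noteq> 0 \<or> Z x1 t1 \<noteq> 0)"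
    proof (rule ccontr)
      assume "\<not> ?thesis"
      then have "Y x t = 0 \<and> Z x t = 0" if "x \<in> {0..l * pi}" "t < 0" for x t using that by blast
      then have z0: "Y x t = 0" "Z x t = 0" if "x \<in> {0..l * pi}" "t \<le> 0" for x t
        using that continuous_zero_left[of "weval y (x / l)"] continuous_zero_left[of "weval z (x / l)"]
        unfolding Y_def Z_def by (metis order_le_less)+
      have fg0: "apply_bcontfun (weval f (x / l)) t = 0" "apply_bcontfun (weval g (x / l)) t = 0" if "x \<in> {0..l * pi}" "t \<le> 0" for x t
        using kin[OF that] z0[OF that] by simp_all
      have "apply_bcontfun (coef f n) t = 0" "apply_bcontfun (coef g n) t = 0" "apply_bcontfun (coef y n) t = 0" if "t \<le> 0" for n t
        using fg0(1)[OF _ that] fg0(2)[OF _ that] z0(1)[OF _ that] freeze_eq_0[OF l] unfolding Y_def by blast+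
      then have "K1 k (coef f k) = 0" "K2 k (coef g k) = 0" "apply_bcontfun (coef y k) 0 = 0"
        using Kz[where K = K1 and n = k and f = "coef f k"] Kz[where K = K2 and n = k and f = "coef g k"] by simp_all
      then have "\<xi> * apply_bcontfun h1 0 = 0" unfolding cy by simp
      with \<xi> h0 show False by simp
    qed
    then obtain x1 t1 where x1: "x1 \<in> {0..l * pi}" "t1 < 0" and nz: "Y x1 t1 \<noteq> 0 \<or> Z x1 t1 \<noteq> 0" by blast
    \<comment> \<open>the perturbation shifted in time by \<open>T\<close>, restricted to the interval from \<open>-T\<close> to \<open>0\<close>\<close>
    have sol: "HT_solution a b d1 d2 r l T (\<lambda>x t. U x + exp (\<beta> * (t - T)) * Y x (t - T)) (\<lambda>x t. V x + exp (\<beta> * (t - T)) * Z x (t - T))"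
      if T: "T > 0" for T
    proof -
      have cUV: "continuous_on {0..l * pi} U" "continuous_on {0..l * pi} V"
        using UV by (auto simp: neumann_C2_def differentiable_imp_continuous_on)
      have cUV2: "continuous_on {0..l * pi} (ddx l (ddx l U))" "continuous_on {0..l * pi} (ddx l (ddx l V))"
        using UV by (auto simp: neumann_C2_def)
      have cxt: "continuous_on ({0..l * pi} \<times> S) (\<lambda>(x, t). W x + exp (\<beta> * (t - T)) * (apply_bcontfun (weval w (x / l)) (t - T) * c))"
        if W: "continuous_on {0..l * pi} W" for W S c and w :: "bfun wiener"
      proof -
        have 1: "continuous_on ({0..l * pi} \<times> S) (\<lambda>z. W (fst z))"
          by (rule continuous_on_compose2[OF W]) (auto intro!: continuous_intros)
        have 2: "continuous_on ({0..l * pi} \<times> S) (\<lambda>z. (\<lambda>(x, t). apply_bcontfun (weval w (x / l)) t) (fst z, snd z - T))"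
          by (rule continuous_on_compose2[OF continuous_on_apply_weval[of UNIV w l]]) (auto intro!: continuous_intros)
        then have 3: "continuous_on ({0..l * pi} \<times> S) (\<lambda>z. apply_bcontfun (weval w (fst z / l)) (snd z - T))" by simp
        show ?thesis unfolding case_prod_unfold by (intro continuous_intros 1 3)
      qed
      have nb: "\<bar>apply_bcontfun (weval w x) t\<bar> \<le> norm w" for w :: "bfun wiener" and x t
        using abs_apply_le[of "weval w x" t] norm_weval_le[of w x] by linarith
      have pos: "W x + exp (\<beta> * s) * apply_bcontfun (weval w (x / l)) s > 0"
        if "norm R \<le> \<eta>" "W x = ?u + weval R (x / l)" "s \<le> 0" "norm w \<le> \<eta>"
        for W R x s and w :: "bfun wiener"
      proof -
        have "\<bar>weval R (x / l)\<bar> \<le> \<eta>" using norm_weval_le[of R "x / l"] that by simp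
        moreover have "exp (\<beta> * s) * \<bar>apply_bcontfun (weval w (x / l)) s\<bar> \<le> 1 * \<eta>"
          using nb[of w "x / l" s] that \<beta> by (intro mult_mono) (auto simp: mult_nonneg_nonpos)
        then have "\<bar>exp (\<beta> * s) * apply_bcontfun (weval w (x / l)) s\<bar> \<le> \<eta>" by (simp add: abs_mult)
        ultimately show ?thesis using \<eta> \<eta>0 that(2) by linarith
      qed
      have sp: "neumann_C2 l (\<lambda>x. W x + exp (\<beta> * s) * apply_bcontfun (weval w (x / l)) s)"
        "\<And>x. x \<in> {0..l * pi} \<Longrightarrow> ddx l (ddx l (\<lambda>x. W x + exp (\<beta> * s) * apply_bcontfun (weval w (x / l)) s)) x
           = ddx l (ddx l W) x + exp (\<beta> * s) * (apply_bcontfun (weval (laplace w) (x / l)) s * (1 / l\<^sup>2))"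
        if W: "neumann_C2 l W" and w: "C2coef w" for W s and w :: "bfun wiener"
      proof -
        have fw: "C2coef (exp (\<beta> * s) *\<^sub>R freeze s w)" by (intro C2coef_scaleR C2coef_freeze w)
        have eq: "(\<lambda>x. exp (\<beta> * s) * apply_bcontfun (weval w (x / l)) s) = (\<lambda>x. weval (exp (\<beta> * s) *\<^sub>R freeze s w) (x / l))"
          by (simp add: weval_scaleR weval_freeze)
        note A = neumann_C2_add[OF l W neumann_C2_weval(1)[OF l fw]]
        show "neumann_C2 l (\<lambda>x. W x + exp (\<beta> * s) * apply_bcontfun (weval w (x / l)) s)"
          using A(1) by (simp add: weval_scaleR weval_freeze)
        show "ddx l (ddx l (\<lambda>x. W x + exp (\<beta> * s) * apply_bcontfun (weval w (x / l)) s)) x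
           = ddx l (ddx l W) x + exp (\<beta> * s) * (apply_bcontfun (weval (laplace w) (x / l)) s * (1 / l\<^sup>2))"
          if x: "x \<in> {0..l * pi}" for x
          using A(3)[OF x] neumann_C2_weval(3)[OF l fw x]
          by (simp add: weval_scaleR weval_freeze laplace_scaleR C2coef_freeze w)
      qed
      note spU = sp[OF UV(1) C2(1), folded Y_def] and spV = sp[OF UV(2) C2(2), folded Z_def]
      have lap_cont: "continuous_on ({0..l * pi} \<times> S) (\<lambda>(x, t). ddx l (ddx l (\<lambda>x. W x + exp (\<beta> * (t - T)) * apply_bcontfun (weval w (x / l)) (t - T))) x)"
        if W: "neumann_C2 l W" and w: "C2coef w" for W S and w :: "bfun wiener"
      proof -
        have "continuous_on {0..l * pi} (ddx l (ddx l W))" using W by (simp add: neumann_C2_def)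
        from cxt[OF this, where w = "laplace w" and c = "1 / l\<^sup>2"] show ?thesis
          by (rule continuous_on_eq) (use sp(2)[OF W w] in auto)
      qed
      have der: "((\<lambda>s. W + exp (\<beta> * (s - T)) * apply_bcontfun (weval w x) (s - T)) has_real_derivative
           exp (\<beta> * (t - T)) * (\<beta> * apply_bcontfun (weval w x) (t - T) + apply_bcontfun (weval dw x) (t - T))) (at t)"
        if t: "t < T" and dw: "\<And>n t. t < 0 \<Longrightarrow> (apply_bcontfun (coef w n) has_real_derivative apply_bcontfun (coef dw n) t) (at t)"
        for W x t and w dw :: "bfun wiener"
      proof -
        have "(apply_bcontfun (weval w x) has_real_derivative apply_bcontfun (weval dw x) (t - T)) (at (t - T))"
          by (rule weval_time_derivative) (use t dw in auto)
        then have 1: "((\<lambda>s. apply_bcontfun (weval w x) (s - T)) has_real_derivative apply_bcontfun (weval dw x) (t - T)) (at t)"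
          by (rule DERIV_chain2[THEN DERIV_cong]) (auto intro!: derivative_eq_intros)
        show ?thesis by (rule derivative_eq_intros 1 refl | simp)+ (simp add: algebra_simps)
      qed
      show ?thesis
        unfolding HT_solution_def
      proof (intro conjI ballI)
        show "continuous_on ({0..l * pi} \<times> {0..<T}) (\<lambda>(x, t). U x + exp (\<beta> * (t - T)) * Y x (t - T))"
          using cxt[OF cUV(1), of _ y 1] by (simp add: Y_def)
        show "continuous_on ({0..l * pi} \<times> {0..<T}) (\<lambda>(x, t). V x + exp (\<beta> * (t - T)) * Z x (t - T))"
          using cxt[OF cUV(2), of _ z 1] by (simp add: Z_def)
        show "continuous_on ({0..l * pi} \<times> {0<..<T}) (\<lambda>(x, t). ddx l (ddx l (\<lambda>x. U x + exp (\<beta> * (t - T)) * Y x (t - T))) x)"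
          unfolding Y_def by (rule lap_cont[OF UV(1) C2(1)])
        show "continuous_on ({0..l * pi} \<times> {0<..<T}) (\<lambda>(x, t). ddx l (ddx l (\<lambda>x. V x + exp (\<beta> * (t - T)) * Z x (t - T))) x)"
          unfolding Z_def by (rule lap_cont[OF UV(2) C2(2)])
      next
        fix x t assume x: "x \<in> {0..l * pi}" and t: "t \<in> {0..<T}"
        show "0 < U x + exp (\<beta> * (t - T)) * Y x (t - T)" "0 < V x + exp (\<beta> * (t - T)) * Z x (t - T)"
          unfolding Y_def Z_def using t
          by (intro pos[where W = U and R = P and x = x and w = y, OF P(1) P(2)[OF x] _ bd(1)]
            pos[where W = V and R = Q and x = x and w = z, OF Q(1) Q(2)[OF x] _ bd(2)]; simp)+
      next
        fix t assume "t \<in> {0<..<T}"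
        show "neumann_C2 l (\<lambda>x. U x + exp (\<beta> * (t - T)) * Y x (t - T))" "neumann_C2 l (\<lambda>x. V x + exp (\<beta> * (t - T)) * Z x (t - T))"
          by (rule spU(1) spV(1))+
      next
        fix x t assume xo: "x \<in> {0<..<l * pi}" and t: "t \<in> {0<..<T}"
        then have x: "x \<in> {0..l * pi}" and tT: "t < T" "t - T \<le> 0" by auto
        have st: "d1 * ddx l (ddx l U) x + HT_f a b (U x) (V x) = 0" "d2 * ddx l (ddx l V) x + HT_g r (U x) (V x) = 0"
          using steady xo by (auto simp: HT_steady_state_def)
        let ?e = "exp (\<beta> * (t - T))" and ?s = "t - T"
        have vy: "apply_bcontfun (weval dy (x / l)) ?s = d1 / l\<^sup>2 * apply_bcontfun (weval (laplace y) (x / l)) ?s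
            + (?A - \<beta>) * Y x ?s + ?B * Z x ?s + apply_bcontfun (weval f (x / l)) ?s"
          by (simp add: dy_def weval_add weval_scaleR Y_def Z_def)
        have vz: "apply_bcontfun (weval dz (x / l)) ?s = d2 / l\<^sup>2 * apply_bcontfun (weval (laplace z) (x / l)) ?s
            + r0 * Y x ?s - (r0 + \<beta>) * Z x ?s + apply_bcontfun (weval g (x / l)) ?s"
          by (simp add: dz_def weval_add weval_diff weval_scaleR Y_def Z_def)
        have "d1 * ddx l (ddx l (\<lambda>y. U y + ?e * Y y ?s)) x + HT_f a b (U x + ?e * Y x ?s) (V x + ?e * Z x ?s)
           = ?e * (\<beta> * Y x ?s + apply_bcontfun (weval dy (x / l)) ?s)"
          using kin(1)[OF x tT(2)] st(1) unfolding spU(2)[OF x] vy by (simp add: algebra_simps)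
        then show "((\<lambda>s. U x + exp (\<beta> * (s - T)) * Y x (s - T)) has_real_derivative
            (d1 * ddx l (ddx l (\<lambda>y. U y + ?e * Y y ?s)) x + HT_f a b (U x + ?e * Y x ?s) (V x + ?e * Z x ?s))) (at t)"
          using der[OF tT(1) ode_n(1), of "U x" "x / l"] by (simp add: Y_def)
        have "d2 * ddx l (ddx l (\<lambda>y. V y + ?e * Z y ?s)) x + HT_g r (U x + ?e * Y x ?s) (V x + ?e * Z x ?s)
           = ?e * (\<beta> * Z x ?s + apply_bcontfun (weval dz (x / l)) ?s)"
          using kin(2)[OF x tT(2)] st(2) unfolding spV(2)[OF x] vz by (simp add: algebra_simps)
        then show "((\<lambda>s. V x + exp (\<beta> * (s - T)) * Z x (s - T)) has_real_derivative
            (d2 * ddx l (ddx l (\<lambda>y. V y + ?e * Z y ?s)) x + HT_g r (U x + ?e * Y x ?s) (V x + ?e * Z x ?s))) (at t)"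
          using der[OF tT(1) ode_n(2), of "V x" "x / l"] by (simp add: Z_def)
      qed
    qed
    define w where "w = exp (\<beta> * t1) * max \<bar>Y x1 t1\<bar> \<bar>Z x1 t1\<bar>"
    have w: "w > 0" using nz by (auto simp: w_def)
    obtain \<delta> where \<delta>: "\<delta> > 0" and st: "\<forall>T>0. \<forall>u v. HT_solution a b d1 d2 r l T u v \<longrightarrow>
        (\<forall>x\<in>{0..l * pi}. \<bar>u x 0 - U x\<bar> < \<delta> \<and> \<bar>v x 0 - V x\<bar> < \<delta>) \<longrightarrow>
        (\<forall>t\<in>{0..<T}. \<forall>x\<in>{0..l * pi}. \<bar>u x t - U x\<bar> < w \<and> \<bar>v x t - V x\<bar> < w)"
      using stable[unfolded HT_stable_def, THEN spec[of _ w], THEN mp, OF w] by (elim exE conjE) (rule that)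
    \<comment> \<open>start so early that the initial deviation is below \<open>\<delta>\<close>\<close>
    have "((\<lambda>T. exp (- \<beta> * T) * (\<eta> + 1)) \<longlongrightarrow> 0 * (\<eta> + 1)) at_top"
    proof (intro tendsto_mult tendsto_const)
      have "filterlim (\<lambda>T. - \<beta> * T) at_bot at_top"
        using \<beta> by (intro filterlim_tendsto_neg_mult_at_bot[OF tendsto_const _ filterlim_ident]) auto
      then show "((\<lambda>T. exp (- \<beta> * T)) \<longlongrightarrow> 0) at_top"
        by (rule filterlim_compose[OF exp_at_bot])
    qed
    then have "\<forall>\<^sub>F T in at_top. exp (- \<beta> * T) * (\<eta> + 1) < \<delta>" using \<delta> by (auto dest: order_tendstoD(2))
    moreover have "\<forall>\<^sub>F T in at_top. T > max 0 (- t1)" by (rule eventually_gt_at_top)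
    ultimately have "\<forall>\<^sub>F T in at_top. exp (- \<beta> * T) * (\<eta> + 1) < \<delta> \<and> T > max 0 (- t1)" by (rule eventually_conj)
    then obtain T where T: "exp (- \<beta> * T) * (\<eta> + 1) < \<delta>" "T > max 0 (- t1)"
      using eventually_happens[of _ at_top] by (metis (mono_tags, lifting) trivial_limit_at_top_linorder)
    have small: "\<bar>exp (\<beta> * (0 - T)) * apply_bcontfun (weval v x) (0 - T)\<bar> < \<delta>" if "norm v \<le> \<eta>"
      for v :: "bfun wiener" and x
    proof -
      have "\<bar>apply_bcontfun (weval v x) (0 - T)\<bar> \<le> \<eta> + 1"
        using abs_apply_le[of "weval v x" "0 - T"] norm_weval_le[of v x] that by linarith
      then have "exp (- \<beta> * T) * \<bar>apply_bcontfun (weval v x) (0 - T)\<bar> \<le> exp (- \<beta> * T) * (\<eta> + 1)"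
        by (intro mult_left_mono) auto
      from this T(1) have "exp (- \<beta> * T) * \<bar>apply_bcontfun (weval v x) (0 - T)\<bar> < \<delta>" by (rule le_less_trans)
      then show ?thesis by (simp add: abs_mult)
    qed
    have "T > 0" using T by simp
    have "\<forall>t\<in>{0..<T}. \<forall>x\<in>{0..l * pi}. \<bar>(U x + exp (\<beta> * (t - T)) * Y x (t - T)) - U x\<bar> < w
        \<and> \<bar>(V x + exp (\<beta> * (t - T)) * Z x (t - T)) - V x\<bar> < w"
      by (rule st[THEN spec, THEN mp, OF \<open>T > 0\<close>, THEN spec, THEN spec, THEN mp, OF sol[OF \<open>T > 0\<close>], THEN mp]) (use small[OF bd(1)] small[OF bd(2)] in \<open>auto simp: Y_def Z_def\<close>)
    moreover have "t1 + T \<in> {0..<T}" using T(2) x1(2) by auto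
    ultimately have "\<bar>exp (\<beta> * t1) * Y x1 t1\<bar> < w" "\<bar>exp (\<beta> * t1) * Z x1 t1\<bar> < w"
      using x1(1) by force+
    then show False by (auto simp: w_def abs_mult max_def split: if_splits)
  qed
  with \<epsilon>(1) show ?thesis by blast
qed

section \<open>The parameter conditions\<close>

lemma upper_index:
  fixes s l :: real
  assumes s: "s > 0" and l: "l > 0"
  defines "N \<equiv> THE N :: nat. real N * s < l \<and> l \<le> real (N + 1) * s"
  shows "real N * s < l" and "l \<le> real (N + 1) * s"
proof -
  have "real (nat (\<lceil>l / s\<rceil> - 1)) * s < l \<and> l \<le> real (nat (\<lceil>l / s\<rceil> - 1) + 1) * s"
  proof -
    have "\<lceil>l / s\<rceil> \<ge> 1" using s l by (simp add: one_le_ceiling)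
    then have N: "real (nat (\<lceil>l / s\<rceil> - 1)) = of_int \<lceil>l / s\<rceil> - 1" "real (nat (\<lceil>l / s\<rceil> - 1) + 1) = of_int \<lceil>l / s\<rceil>"
      by simp_all
    have "of_int \<lceil>l / s\<rceil> - 1 < l / s" "l / s \<le> of_int \<lceil>l / s\<rceil>" by linarith+
    then show ?thesis unfolding N using s by (simp only: pos_less_divide_eq pos_divide_le_eq)
  qed
  moreover have "M = N'" if "real M * s < l \<and> l \<le> real (M + 1) * s" "real N' * s < l \<and> l \<le> real (N' + 1) * s" for M N' :: nat
  proof -
    have "real M < real (N' + 1)" "real N' < real (M + 1)"
      using that s by (meson le_less_trans less_le_trans mult_less_cancel_right_pos)+
    then show ?thesis by linarith
  qed
  ultimately have "\<exists>!N :: nat. real N * s < l \<and> l \<le> real (N + 1) * s" by blast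
  from theI'[OF this] show "real N * s < l" "l \<le> real (N + 1) * s" by (simp_all add: N_def)
qed

lemma lower_index:
  fixes s l :: real
  assumes s: "s > 0" and l: "l > 0"
  defines "M \<equiv> THE M :: nat. real (M - 1) * s \<le> l \<and> l < real M * s"
  shows "real (M - 1) * s \<le> l" and "l < real M * s"
proof -
  have "real (nat \<lfloor>l / s\<rfloor> + 1 - 1) * s \<le> l \<and> l < real (nat \<lfloor>l / s\<rfloor> + 1) * s"
  proof -
    have "\<lfloor>l / s\<rfloor> \<ge> 0" using s l by simp
    then have N: "real (nat \<lfloor>l / s\<rfloor> + 1 - 1) = of_int \<lfloor>l / s\<rfloor>" "real (nat \<lfloor>l / s\<rfloor> + 1) = of_int \<lfloor>l / s\<rfloor> + 1"
      by simp_all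
    have "of_int \<lfloor>l / s\<rfloor> \<le> l / s" "l / s < of_int \<lfloor>l / s\<rfloor> + 1" by linarith+
    then show ?thesis unfolding N using s by (simp only: pos_le_divide_eq pos_divide_less_eq)
  qed
  moreover have "K = K'" if K: "real (K - 1) * s \<le> l \<and> l < real K * s" "real (K' - 1) * s \<le> l \<and> l < real K' * s" for K K' :: nat
  proof -
    have "real (K - 1) < real K'" "real (K' - 1) < real K"
      using K s by (meson le_less_trans mult_less_cancel_right_pos)+
    moreover have "K \<noteq> 0" using K(1) l by (cases K) auto
    moreover have "K' \<noteq> 0" using K(2) l by (cases K') auto
    ultimately show ?thesis by linarith
  qed
  ultimately have "\<exists>!M :: nat. real (M - 1) * s \<le> l \<and> l < real M * s" by blast
  from theI'[OF this] show "real (M - 1) * s \<le> l" "l < real M * s" by (simp_all add: M_def)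
qed

text \<open>The real parts of the two roots add up to the trace; if the determinant is negative, the roots are real
with opposite signs.\<close>

lemma unstable_root:
  fixes \<alpha> \<gamma> c :: real
  assumes "\<alpha> + \<gamma> > 0 \<or> \<alpha> * \<gamma> - c < 0"
  shows "\<exists>\<mu> :: complex. (\<mu> - of_real \<alpha>) * (\<mu> - of_real \<gamma>) = of_real c \<and> Re \<mu> > 0"
  using assms
proof
  assume T: "\<alpha> + \<gamma> > 0"
  obtain z1 z2 :: complex where z: "z1 + z2 = of_real (\<alpha> + \<gamma>)" "z1 * z2 = of_real (\<alpha> * \<gamma> - c)"
    using quadratic_roots by blast
  have "Re z1 + Re z2 > 0" using T arg_cong[OF z(1), of Re] by simp
  then have "Re z1 > 0 \<or> Re z2 > 0" by linarith
  moreover have "(z2 - of_real \<alpha>) * (z2 - of_real \<gamma>) = of_real c"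
    by (rule root_char[of _ z1]) (use z in \<open>simp_all add: add.commute mult.commute\<close>)
  ultimately show ?thesis using root_char[OF z] by blast
next
  assume D: "\<alpha> * \<gamma> - c < 0"
  define q where "q = sqrt ((\<alpha> + \<gamma>)\<^sup>2 - 4 * (\<alpha> * \<gamma> - c))"
  have q2: "q * q = (\<alpha> + \<gamma>)\<^sup>2 - 4 * (\<alpha> * \<gamma> - c)" 
  proof -
    have "4 * (\<alpha> * \<gamma> - c) \<le> 0" using D by simp
    then have "0 \<le> (\<alpha> + \<gamma>)\<^sup>2 - 4 * (\<alpha> * \<gamma> - c)" using zero_le_power2[of "\<alpha> + \<gamma>"] by linarith
    then show ?thesis by (simp only: q_def real_sqrt_mult_self abs_of_nonneg)
  qed
  have "\<bar>\<alpha> + \<gamma>\<bar> < q" unfolding q_def using D by (intro real_less_rsqrt) simp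
  then have pos: "(\<alpha> + \<gamma> + q) / 2 > 0" by simp
  have "((\<alpha> + \<gamma> + q) / 2 - \<alpha>) * ((\<alpha> + \<gamma> + q) / 2 - \<gamma>) = (q * q - (\<alpha> - \<gamma>)\<^sup>2) / 4"
    by (simp add: field_simps power2_eq_square)
  also have "\<dots> = c" unfolding q2 by (simp add: field_simps power2_eq_square)
  finally have "(complex_of_real ((\<alpha> + \<gamma> + q) / 2) - of_real \<alpha>) * (complex_of_real ((\<alpha> + \<gamma> + q) / 2) - of_real \<gamma>) = of_real c"
    unfolding of_real_diff[symmetric] of_real_mult[symmetric] by simp
  with pos show ?thesis by (intro exI[of _ "complex_of_real ((\<alpha> + \<gamma> + q) / 2)"]) simp
qed

text \<open>At \<open>x = n\<^sup>2/l\<^sup>2\<close> the left hand side is the determinant of the \<open>n\<close>-th mode, and the value subtracted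
from \<open>r\<close> is \<open>r_n^T\<close>.\<close>

lemma turing_determinant:
  fixes x :: real
  assumes "d1 * x - A - B \<noteq> 0"
  shows "(A - d1 * x) * (- (r + d2 * x)) - B * r
    = (d1 * x - A - B) * (r - - (d2 * x * (d1 * x - A) / (d1 * x - A - B)))"
proof -
  have "(d1 * x - A - B) * (d2 * x * (d1 * x - A) / (d1 * x - A - B)) = d2 * x * (d1 * x - A)"
    using assms by simp
  then have "(d1 * x - A - B) * (r - - (d2 * x * (d1 * x - A) / (d1 * x - A - B)))
      = (d1 * x - A - B) * r + d2 * x * (d1 * x - A)"
    unfolding diff_minus_eq_add distrib_left by simp
  then show ?thesis by (simp add: algebra_simps)
qed

text \<open>The difference of the two critical values has the sign of a quadratic polynomial that is negative at \<open>0\<close> and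
vanishes at \<open>X\<close>. Multiplying it by \<open>X\<close> allows the factor \<open>x - X\<close> to be split off.\<close>

lemma hopf_above_turing:
  fixes x X :: real
  assumes d: "d1 > 0" "d2 > 0" and A: "A > 0" "A + B < 0" and x: "0 \<le> x" "x < X"
    and X: "d1\<^sup>2 * X\<^sup>2 - (2 * d1 * A + (d1 + d2) * B) * X + A * (A + B) = 0"
  shows "- (d2 * x * (d1 * x - A) / (d1 * x - A - B)) < A - (d1 + d2) * x"
proof -
  let ?q = "\<lambda>x. d1\<^sup>2 * x\<^sup>2 - (2 * d1 * A + (d1 + d2) * B) * x + A * (A + B)"
  have "X > 0" using x by simp
  have "X * ?q x = (x - X) * (d1\<^sup>2 * x * X - A * (A + B)) + x * ?q X"
    by (simp add: algebra_simps power2_eq_square)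
  also have "\<dots> < 0"
  proof -
    have "0 \<le> d1\<^sup>2 * x * X" using x by simp
    moreover have "A * (A + B) < 0" using A by (simp add: mult_pos_neg)
    ultimately have "0 < d1\<^sup>2 * x * X - A * (A + B)" by linarith
    then show ?thesis unfolding X using x by (simp add: mult_neg_pos)
  qed
  finally have q: "?q x < 0" using \<open>X > 0\<close> by (simp add: mult_less_0_iff)
  have den: "d1 * x - A - B > 0"
  proof -
    have "0 \<le> d1 * x" using d x by simp
    then show ?thesis using A by linarith
  qed
  have "- (d2 * x * (d1 * x - A)) < (A - (d1 + d2) * x) * (d1 * x - A - B)"
    using q by (simp add: algebra_simps power2_eq_square)
  then have "- (d2 * x * (d1 * x - A)) / (d1 * x - A - B) < A - (d1 + d2) * x"
    using den by (simp only: pos_divide_less_eq)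
  then show ?thesis by simp
qed

lemma xbar_root:
  fixes A B d1 d2 :: real
  assumes d: "d1 > 0" "d2 > 0" and A: "A > 0" "A + B < 0"
  defines "X \<equiv> 1 / (2 * d1^2) * (2 * d1 * A + (d1 + d2) * B + sqrt ((d1 + d2)^2 * B^2 + 4 * d1 * d2 * A * B))"
  shows "X > 0" and "d1\<^sup>2 * X\<^sup>2 - (2 * d1 * A + (d1 + d2) * B) * X + A * (A + B) = 0"
proof -
  let ?p = "2 * d1 * A + (d1 + d2) * B" and ?D = "(d1 + d2)^2 * B^2 + 4 * d1 * d2 * A * B"
  have D: "?D = ?p\<^sup>2 - 4 * d1\<^sup>2 * (A * (A + B))" by (simp add: algebra_simps power2_eq_square)
  have neg: "d1\<^sup>2 * (A * (A + B)) < 0" using d A by (simp add: mult_pos_neg)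
  moreover have "4 * d1\<^sup>2 * (A * (A + B)) = 4 * (d1\<^sup>2 * (A * (A + B)))" by (simp only: mult.assoc)
  ultimately have neg4: "4 * d1\<^sup>2 * (A * (A + B)) < 0" by linarith
  have "\<bar>?p\<bar> < sqrt ?D"
  proof (rule real_less_rsqrt)
    show "\<bar>?p\<bar>\<^sup>2 < ?D" unfolding D power2_abs using neg4 by linarith
  qed
  then have "?p + sqrt ?D > 0" by linarith
  then show "X > 0" unfolding X_def using d by simp
  have "0 \<le> ?D" unfolding D using neg4 zero_le_power2[of ?p] by linarith
  then have sD: "sqrt ?D * sqrt ?D = ?D" by (simp only: real_sqrt_mult_self abs_of_nonneg)
  have eq: "2 * d1\<^sup>2 * X = ?p + sqrt ?D" unfolding X_def using d by simp
  have "4 * d1\<^sup>2 * (d1\<^sup>2 * X\<^sup>2 - ?p * X + A * (A + B))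
      = (2 * d1\<^sup>2 * X) * (2 * d1\<^sup>2 * X) - 2 * ?p * (2 * d1\<^sup>2 * X) + 4 * d1\<^sup>2 * (A * (A + B))"
    by (simp add: algebra_simps power2_eq_square)
  also have "\<dots> = sqrt ?D * sqrt ?D - ?p\<^sup>2 + 4 * d1\<^sup>2 * (A * (A + B))"
    unfolding eq by (simp add: algebra_simps power2_eq_square)
  also have "\<dots> = 0" unfolding sD unfolding D by simp
  finally show "d1\<^sup>2 * X\<^sup>2 - ?p * X + A * (A + B) = 0" using d by simp
qed

text \<open>The inequality \<open>A0 < r_n^T\<close> says that a quadratic polynomial in \<open>x = n\<^sup>2/l\<^sup>2\<close> with positive value at
\<open>0\<close> is negative at \<open>x\<close>. This forces \<open>d1 < d2\<close>, a positive discriminant, and \<open>x_- < x < x_+\<close>; the last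
condition is \<open>M1 \<le> M2\<close>. Written in terms of \<open>u0\<close>, the positive discriminant is again a quadratic
inequality, \<open>(s + m) u0\<^sup>2 - m (1 - b) u0 + (s - m) b < 0\<close> with \<open>s = (d1 + d2)\<^sup>2\<close> and
\<open>m = (d1 - d2)\<^sup>2\<close>. Its solvability is the bound on \<open>b\<close>, and since
\<open>a = 1 - b - u0 + b / u0\<close> decreases in \<open>u0\<close>, its two roots correspond to \<open>a_+\<close> and \<open>a_-\<close>.\<close>

lemma A6_from_mode:
  assumes d: "d1 > 0" "d2 > 0" and b: "0 < b" "b < 1" and a: "0 < a" and A: "HT_A0 a b > 0" and l: "l > 0"
    and n: "n \<ge> 1" and x: "x = (real n)\<^sup>2 / l\<^sup>2"
    and above: "HT_A0 a b < - (d2 * x * (d1 * x - HT_A0 a b) / (d1 * x - HT_A0 a b - HT_B0 a b))"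
  shows "HT_A6'' a b d1 d2 l"
proof -
  define A where "A = HT_A0 a b"
  define B where "B = HT_B0 a b"
  define u where "u = HT_u0 a b"
  have u: "u > 0" "a * u = (1 - u) * (u + b)" "u < 1"
    using HT_u0_root[OF b(1), of a] HT_u0_less_1[OF b(1) a] by (auto simp: u_def)
  have Ap: "A > 0" and AB: "A + B < 0" using A HT_A0_B0_neg[OF b(1), of a] by (auto simp: A_def B_def)
  have xp: "x > 0" using n l by (simp add: x)
  have den: "d1 * x - A - B > 0"
  proof -
    have "0 \<le> d1 * x" using d xp by simp
    then show ?thesis using AB by linarith
  qed
  have "A < - (d2 * x * (d1 * x - A)) / (d1 * x - A - B)" using above by (simp add: A_def B_def)
  then have "A * (d1 * x - A - B) < - (d2 * x * (d1 * x - A))" using den by (simp only: pos_less_divide_eq)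
  then have p: "d1 * d2 * x\<^sup>2 - (d2 - d1) * A * x - A * (A + B) < 0"
    by (simp add: algebra_simps power2_eq_square)
  have nAB: "A * (A + B) < 0" using Ap AB by (simp add: mult_pos_neg)
  have d12: "d2 > d1"
  proof (rule ccontr)
    assume "\<not> d2 > d1"
    then have "(d2 - d1) * A * x \<le> 0" using Ap xp by (simp add: mult_nonpos_nonneg)
    moreover have "0 \<le> d1 * d2 * x\<^sup>2" using d by simp
    ultimately show False using p nAB by linarith
  qed
  define \<Delta> where "\<Delta> = (d1 + d2)\<^sup>2 * A\<^sup>2 + 4 * d1 * d2 * A * B"
  have \<Delta>: "\<Delta> = ((d2 - d1) * A)\<^sup>2 + 4 * d1 * d2 * (A * (A + B))"
    by (simp add: \<Delta>_def algebra_simps power2_eq_square)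
  have sq: "(2 * d1 * d2 * x - (d2 - d1) * A)\<^sup>2 < \<Delta>"
  proof -
    have "(2 * d1 * d2 * x - (d2 - d1) * A)\<^sup>2 = \<Delta> + 4 * (d1 * d2) * (d1 * d2 * x\<^sup>2 - (d2 - d1) * A * x - A * (A + B))"
      unfolding \<Delta> by (simp add: algebra_simps power2_eq_square)
    moreover have "4 * (d1 * d2) * (d1 * d2 * x\<^sup>2 - (d2 - d1) * A * x - A * (A + B)) < 0"
      using d p by (intro mult_pos_neg) auto
    ultimately show ?thesis by linarith
  qed
  then have \<Delta>p: "\<Delta> > 0" using zero_le_power2 le_less_trans by blast
  have absx: "\<bar>2 * d1 * d2 * x - (d2 - d1) * A\<bar> < sqrt \<Delta>" using sq by (intro real_less_rsqrt) simp
  define xm where "xm = HT_xpm (- 1) a b d1 d2"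
  define xq where "xq = HT_xpm 1 a b d1 d2"
  have xpm: "2 * d1 * d2 * xm = (d2 - d1) * A - sqrt \<Delta>" "2 * d1 * d2 * xq = (d2 - d1) * A + sqrt \<Delta>"
    using d by (simp_all add: xm_def xq_def HT_xpm_def A_def B_def \<Delta>_def)
  have dd: "2 * d1 * d2 > 0" using d by simp
  have "2 * d1 * d2 * xm < 2 * d1 * d2 * x" "2 * d1 * d2 * x < 2 * d1 * d2 * xq"
    using absx unfolding xpm by linarith+
  then have xx: "xm < x" "x < xq" using dd by (simp_all only: mult_less_cancel_left_pos)
  have xm0: "xm > 0"
  proof -
    have "d1 * d2 * (A * (A + B)) < 0" by (rule mult_pos_neg[OF mult_pos_pos[OF d] nAB])
    then have "\<Delta> < ((d2 - d1) * A)\<^sup>2" unfolding \<Delta> by linarith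
    then have "sqrt \<Delta> < (d2 - d1) * A" using d12 Ap by (intro real_less_lsqrt) auto
    then have "0 < 2 * d1 * d2 * xm" unfolding xpm by linarith
    then show ?thesis using zero_less_mult_pos dd by blast
  qed
  \<comment> \<open>translation of the positive discriminant into conditions on \<open>a\<close> and \<open>b\<close>\<close>
  define s where "s = (d1 + d2)\<^sup>2"
  define m where "m = (d1 - d2)\<^sup>2"
  have s4: "(d1 + d2)^4 = s\<^sup>2" "(d1 - d2)^4 = m\<^sup>2" by (simp_all add: s_def m_def)
  have sm: "s - m = 4 * d1 * d2" by (simp add: s_def m_def algebra_simps power2_eq_square)
  have m0: "m > 0" using d12 by (simp add: m_def)
  have "s - m > 0" unfolding sm using d by simp
  then have s_m: "s > m" by simp
  have s0: "s > 0" using s_m m0 by linarith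
  have w: "(s + m) * u\<^sup>2 - m * (1 - b) * u + (s - m) * b < 0"
  proof -
    have "A * (s * A + (s - m) * B) > 0" using \<Delta>p unfolding sm by (simp add: \<Delta>_def s_def algebra_simps power2_eq_square)
    then have "s * A + (s - m) * B > 0" using Ap by (simp add: zero_less_mult_iff)
    then have "(b + u) * (s * A + (s - m) * B) > 0" using b u by simp
    moreover have "(b + u) * (s * A + (s - m) * B) = s * (u * (1 - b - 2 * u)) - (s - m) * (a * u)"
    proof -
      have "b + u \<noteq> 0" using b u by simp
      then have "(b + u) * A = u * (1 - b - 2 * u)" "(b + u) * B = - (a * u)"
        unfolding A_def B_def HT_A0_def HT_B0_def u_def[symmetric] by simp_all
      moreover have "(b + u) * (s * A + (s - m) * B) = s * ((b + u) * A) + (s - m) * ((b + u) * B)"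
        by (simp add: algebra_simps)
      ultimately show ?thesis by simp
    qed
    moreover have "s * (u * (1 - b - 2 * u)) - (s - m) * (a * u) = - ((s + m) * u\<^sup>2 - m * (1 - b) * u + (s - m) * b)"
      unfolding u(2) by (simp add: algebra_simps power2_eq_square)
    ultimately show ?thesis by linarith
  qed
  define disc where "disc = (b + 1)\<^sup>2 * m\<^sup>2 - 4 * b * s\<^sup>2"
  have sq2: "(2 * (s + m) * u - m * (1 - b))\<^sup>2 < disc"
  proof -
    have "(2 * (s + m) * u - m * (1 - b))\<^sup>2 = disc + 4 * (s + m) * ((s + m) * u\<^sup>2 - m * (1 - b) * u + (s - m) * b)"
      by (simp add: disc_def algebra_simps power2_eq_square)
    moreover have "4 * (s + m) * ((s + m) * u\<^sup>2 - m * (1 - b) * u + (s - m) * b) < 0"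
      using s0 m0 w by (intro mult_pos_neg) auto
    ultimately show ?thesis by linarith
  qed
  then have disc0: "disc > 0" using zero_le_power2 le_less_trans by blast
  define R where "R = sqrt disc"
  have R: "R > 0" "R\<^sup>2 = disc" using disc0 by (auto simp: R_def)
  have absu: "\<bar>2 * (s + m) * u - m * (1 - b)\<bar> < R" unfolding R_def using sq2 by (intro real_less_rsqrt) simp
  have bb: "b < HT_bstar d1 d2"
  proof -
    define t where "t = sqrt b"
    define Q where "Q = sqrt (s\<^sup>2 - m\<^sup>2)"
    have t: "t > 0" "t < 1" "t\<^sup>2 = b" using b by (auto simp: t_def)
    have sm2: "s\<^sup>2 - m\<^sup>2 > 0" using s_m m0 by (simp add: power_strict_mono)
    then have Q: "Q > 0" "Q\<^sup>2 = s\<^sup>2 - m\<^sup>2" by (auto simp: Q_def)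
    have "Q < s" using Q m0 s0 by (intro power_less_imp_less_base[of Q 2 s]) auto
    have lt: "2 * t * s < m * (1 + b)"
    proof (rule power_less_imp_less_base[of _ 2])
      have "(2 * t * s)\<^sup>2 = 4 * b * s\<^sup>2" using t by (simp add: power_mult_distrib)
      also have "\<dots> < (b + 1)\<^sup>2 * m\<^sup>2" using disc0 by (simp add: disc_def)
      also have "\<dots> = (m * (1 + b))\<^sup>2" by (simp add: power_mult_distrib add.commute)
      finally show "(2 * t * s)\<^sup>2 < (m * (1 + b))\<^sup>2" .
      show "0 \<le> m * (1 + b)" using m0 b by simp
    qed
    have "m * t < s - Q"
    proof (rule ccontr)
      assume "\<not> m * t < s - Q"
      then have "0 \<le> m * t - (s - Q)" by simp
      moreover have "m * t - (s + Q) \<le> 0"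
      proof -
        have "m * t \<le> m * 1" using m0 t by (intro mult_left_mono) auto
        then show ?thesis using s_m Q by linarith
      qed
      ultimately have "(m * t - (s - Q)) * (m * t - (s + Q)) \<le> 0" by (rule mult_nonneg_nonpos)
      moreover have "(m * t - (s - Q)) * (m * t - (s + Q)) = m * (m * t\<^sup>2 - 2 * t * s) + (s\<^sup>2 - Q\<^sup>2)"
        by (simp add: algebra_simps power2_eq_square)
      moreover have "\<dots> = m * (m * (1 + b) - 2 * t * s)" unfolding Q(2) t(3) by (simp add: algebra_simps power2_eq_square)
      moreover have "m * (m * (1 + b) - 2 * t * s) > 0" using m0 lt by simp
      ultimately show False by linarith
    qed
    then have "(m * t)\<^sup>2 < (s - Q)\<^sup>2" using m0 t by (intro power_strict_mono) auto
    then have "b * m\<^sup>2 < (s - Q)\<^sup>2" using t by (simp add: power_mult_distrib mult.commute)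
    then have "b < (s - Q)\<^sup>2 / m\<^sup>2" using m0 by (simp add: pos_less_divide_eq)
    then show ?thesis unfolding HT_bstar_def s4 s_def[symmetric] Q_def .
  qed
  define up where "up = (m * (1 - b) + R) / (2 * (s + m))"
  define um where "um = (m * (1 - b) - R) / (2 * (s + m))"
  have smp: "2 * (s + m) > 0" using s0 m0 by simp
  have uu: "um < u" "u < up"
    using absu smp unfolding up_def um_def by (simp_all add: pos_divide_less_eq pos_less_divide_eq abs_less_iff mult.commute)
  have prod: "(s + m) * (um * up) = (s - m) * b"
  proof -
    have "4 * (s + m) * ((s + m) * (um * up)) = (2 * (s + m) * um) * (2 * (s + m) * up)" by (simp add: algebra_simps)
    also have "\<dots> = (m * (1 - b) - R) * (m * (1 - b) + R)" unfolding um_def up_def using smp by simp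
    also have "\<dots> = (m * (1 - b))\<^sup>2 - disc" unfolding R(2)[symmetric] by (simp add: algebra_simps power2_eq_square)
    also have "\<dots> = 4 * (s + m) * ((s - m) * b)" by (simp add: disc_def algebra_simps power2_eq_square)
    finally show ?thesis using smp by simp
  qed
  have up0: "up > 0" using uu u by linarith
  have "(s + m) * (um * up) > 0" unfolding prod using s_m b by simp
  then have um0: "um > 0" using up0 smp by (simp add: zero_less_mult_iff)
  have aeq: "a = 1 - b - u + b / u" using u(1,2) by (simp add: field_simps)
  have dec: "1 - b - v' + b / v' < 1 - b - v + b / v" if "0 < v" "v < v'" for v v'
    using that b by (smt (verit) divide_strict_left_mono mult_pos_pos)
  have kap: "1 - b - up + b / up = HT_apm (- 1) b d1 d2" "1 - b - um + b / um = HT_apm 1 b d1 d2"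
  proof -
    have den: "s\<^sup>2 - m\<^sup>2 = (s + m) * (s - m)" by (simp add: algebra_simps power2_eq_square)
    have bu: "b / up = (s + m) * um / (s - m)" "b / um = (s + m) * up / (s - m)"
      using prod up0 um0 s_m by (simp_all add: field_simps)
    have e: "1 - b - up + b / up = ((1 - b) * s\<^sup>2 - s * R) / (s\<^sup>2 - m\<^sup>2)"
            "1 - b - um + b / um = ((1 - b) * s\<^sup>2 + s * R) / (s\<^sup>2 - m\<^sup>2)"
    proof -
      have k: "2 * (s + m) * up = m * (1 - b) + R" "2 * (s + m) * um = m * (1 - b) - R"
        unfolding up_def um_def using smp by simp_all
      have sm': "s - m > 0" "s + m > 0" using s_m smp by auto
      have "2 * ((s + m) * (s - m)) * (1 - b - up + (s + m) * um / (s - m))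
          = 2 * (s + m) * (s - m) * (1 - b) - (s - m) * (2 * (s + m) * up) + (s + m) * (2 * (s + m) * um)"
        using sm' by (simp add: field_simps)
      also have "\<dots> = 2 * ((1 - b) * s\<^sup>2 - s * R)" unfolding k by (simp add: algebra_simps power2_eq_square)
      finally show "1 - b - up + b / up = ((1 - b) * s\<^sup>2 - s * R) / (s\<^sup>2 - m\<^sup>2)"
        unfolding bu den using sm' by (simp add: eq_divide_eq mult.commute)
      have "2 * ((s + m) * (s - m)) * (1 - b - um + (s + m) * up / (s - m))
          = 2 * (s + m) * (s - m) * (1 - b) - (s - m) * (2 * (s + m) * um) + (s + m) * (2 * (s + m) * up)"
        using sm' by (simp add: field_simps)
      also have "\<dots> = 2 * ((1 - b) * s\<^sup>2 + s * R)" unfolding k by (simp add: algebra_simps power2_eq_square)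
      finally show "1 - b - um + b / um = ((1 - b) * s\<^sup>2 + s * R) / (s\<^sup>2 - m\<^sup>2)"
        unfolding bu den using sm' by (simp add: eq_divide_eq mult.commute)
    qed
    show "1 - b - up + b / up = HT_apm (- 1) b d1 d2" "1 - b - um + b / um = HT_apm 1 b d1 d2"
      unfolding e HT_apm_def s4 s_def[symmetric] R_def disc_def by simp_all
  qed
  have ab: "HT_apm (- 1) b d1 d2 < a" "a < HT_apm 1 b d1 d2"
    unfolding kap[symmetric] using dec[OF u(1) uu(2)] dec[OF um0 uu(1)] aeq by simp_all
  have M: "HT_M1 a b d1 d2 l \<le> HT_M2 a b d1 d2 l"
  proof -
    have xq0: "xq > 0" using xx xp by linarith
    have rn: "real n = l * sqrt x" using l by (simp add: x real_sqrt_divide)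
    have "HT_M2 a b d1 d2 l = (THE M. real M * (1 / sqrt xq) < l \<and> l \<le> real (M + 1) * (1 / sqrt xq))"
      unfolding HT_M2_def HT_lpm_def xq_def by simp
    then have M2: "l \<le> real (HT_M2 a b d1 d2 l + 1) * (1 / sqrt xq)"
      using upper_index(2)[of "1 / sqrt xq" l] xq0 l by simp
    have "HT_M1 a b d1 d2 l = (THE M. real (M - 1) * (1 / sqrt xm) \<le> l \<and> l < real M * (1 / sqrt xm))"
      unfolding HT_M1_def HT_lpm_def xm_def by simp
    then have M1: "real (HT_M1 a b d1 d2 l - 1) * (1 / sqrt xm) \<le> l"
      using lower_index(1)[of "1 / sqrt xm" l] xm0 l by simp
    have "real (HT_M1 a b d1 d2 l - 1) \<le> l * sqrt xm" using M1 xm0 by (simp add: field_simps)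
    also have "\<dots> < real n" unfolding rn using l xx by simp
    finally have 1: "HT_M1 a b d1 d2 l - 1 < n" by simp
    have "real n < l * sqrt xq" unfolding rn using l xx by simp
    also have "\<dots> \<le> real (HT_M2 a b d1 d2 l + 1)" using M2 xq0 by (simp add: field_simps)
    finally have "n < HT_M2 a b d1 d2 l + 1" by linarith
    with 1 show ?thesis by linarith
  qed
  show ?thesis unfolding HT_A6''_def using d12 b bb ab M by blast
qed

theorem theorem2p5:
  fixes a b d1 d2 l :: real
  assumes "d1 > 0" and "d2 > 0"
    and "0 < b" and "b < 1"
    and "a > (b + 1)^2 / (2 * (1 - b))"
    and "l > sqrt (d1 / HT_A0 a b)"
    and "l \<notin> HT_LTT a b d1 d2 \<union> HT_LTH a b d1 d2"
  shows "\<forall>n\<in>{1..HT_N2 a b d1 l}.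
           HT_steady_state_bifurcation a b d1 d2 l (HT_rT a b d1 d2 n l) \<and>
           (HT_stable_bif_solutions a b d1 d2 l (HT_rT a b d1 d2 n l) \<longrightarrow>
              HT_A6'' a b d1 d2 l \<and> HT_rT a b d1 d2 n l = HT_rstar a b d1 d2 l)"
proof
  fix n assume n: "n \<in> {1..HT_N2 a b d1 l}"
  define A where "A = HT_A0 a b"
  define B where "B = HT_B0 a b"
  define N2 where "N2 = HT_N2 a b d1 l"
  define N1 where "N1 = HT_N1 a b d1 d2 l"
  define \<rho> where "\<rho> = (\<lambda>n. HT_rT a b d1 d2 n l)"
  have a: "0 < a" and A: "A > 0" using HT_A0_pos[OF assms(3-5)] by (auto simp: A_def)
  have AB: "A + B < 0" using HT_A0_B0_neg[OF assms(3), of a] by (simp add: A_def B_def)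
  have s: "sqrt (d1 / A) > 0" using A assms(1) by simp
  have l: "l > 0" using assms(6) s unfolding A_def by linarith
  have lT: "HT_lT a b d1 k = real k * sqrt (d1 / A)" for k by (simp add: HT_lT_def A_def)
  have N2: "HT_lT a b d1 N2 < l" "l \<le> HT_lT a b d1 (N2 + 1)"
    using upper_index[OF s l] unfolding N2_def HT_N2_def lT by blast+
  \<comment> \<open>the modes up to \<open>N2\<close> are those with positive critical value\<close>
  have below: "d1 * xval l (int k) < A \<longleftrightarrow> k \<le> N2" for k
  proof -
    have "d1 * xval l (int k) < A \<longleftrightarrow> (real k)\<^sup>2 * (d1 / A) < l\<^sup>2"
    proof -
      have "d1 * xval l (int k) < A \<longleftrightarrow> (real k)\<^sup>2 * d1 / l\<^sup>2 < A" by (simp add: xval_def mult.commute)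
      also have "\<dots> \<longleftrightarrow> (real k)\<^sup>2 * d1 < A * l\<^sup>2" using l by (intro pos_divide_less_eq) simp
      also have "\<dots> \<longleftrightarrow> (real k)\<^sup>2 * d1 / A < l\<^sup>2" using A by (simp only: pos_divide_less_eq mult.commute[of A])
      finally show ?thesis by simp
    qed
    also have "(real k)\<^sup>2 * (d1 / A) = (real k * sqrt (d1 / A))\<^sup>2"
      using A assms(1) by (simp add: power_mult_distrib)
    also have "(real k * sqrt (d1 / A))\<^sup>2 < l\<^sup>2 \<longleftrightarrow> real k * sqrt (d1 / A) < l"
    proof
      show "real k * sqrt (d1 / A) < l" if "(real k * sqrt (d1 / A))\<^sup>2 < l\<^sup>2"
        using that less_imp_le[OF l] by (rule power2_less_imp_less)
      show "(real k * sqrt (d1 / A))\<^sup>2 < l\<^sup>2" if "real k * sqrt (d1 / A) < l"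
        by (rule power_strict_mono[OF that]) (use less_imp_le[OF s] in simp_all)
    qed
    also have "\<dots> \<longleftrightarrow> k \<le> N2"
    proof
      assume "real k * sqrt (d1 / A) < l"
      then have "real k * sqrt (d1 / A) < real (N2 + 1) * sqrt (d1 / A)" using N2(2) unfolding lT by linarith
      then have "real k < real (N2 + 1)" using s by (simp only: mult_less_cancel_right_pos)
      then show "k \<le> N2" by linarith
    next
      assume "k \<le> N2"
      then have "real k * sqrt (d1 / A) \<le> real N2 * sqrt (d1 / A)" using s by (intro mult_right_mono) auto
      then show "real k * sqrt (d1 / A) < l" using N2(1) unfolding lT by linarith
    qed
    finally show ?thesis .
  qed
  have \<rho>: "\<rho> k = - (d2 * xval l (int k) * (d1 * xval l (int k) - A) / (d1 * xval l (int k) - A - B))" for k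
    by (simp add: \<rho>_def HT_rT_def xval_def A_def B_def)
  have den: "d1 * xval l i - A - B > 0" for i
  proof -
    have "0 \<le> d1 * xval l i" using assms(1) xval_bounds(1)[OF l] by simp
    then show ?thesis using AB by linarith
  qed
  have det: "(A - d1 * xval l (int k)) * (- (r + d2 * xval l (int k))) - B * r = (d1 * xval l (int k) - A - B) * (r - \<rho> k)" for k r
    unfolding \<rho> using den[of "int k"] by (intro turing_determinant) simp
  have n1: "n \<ge> 1" "n \<le> N2" using n by (auto simp: N2_def)
  have \<rho>pos: "\<rho> k > 0" if "1 \<le> k" "k \<le> N2" for k
  proof -
    have "xval l (int k) > 0" using that l by (simp add: xval_def)
    moreover have "d1 * xval l (int k) - A < 0" using below[of k] that by simp
    ultimately have "d2 * xval l (int k) * (d1 * xval l (int k) - A) < 0"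
      using assms(2) by (intro mult_pos_neg) auto
    then show ?thesis unfolding \<rho> using den[of "int k"] by (simp add: divide_neg_pos)
  qed
  define r0 where "r0 = \<rho> n"
  have r0: "r0 > 0" using \<rho>pos n1 by (simp add: r0_def)
  have distinct: "\<rho> i \<noteq> \<rho> j" if "1 \<le> i" "i < j" "j \<le> N2" for i j
  proof
    assume eq: "\<rho> i = \<rho> j"
    have "l \<in> HT_LTT a b d1 d2"
      unfolding HT_LTT_def mem_Collect_eq N2_def[symmetric]
      using that N2 n1 eq[unfolded \<rho>_def] by (intro conjI exI[of _ i] exI[of _ j]) auto
    with assms(7) show False by blast
  qed
  have bif: "HT_steady_state_bifurcation a b d1 d2 l (\<rho> n)"
    unfolding HT_steady_state_bifurcation_def r0_def[symmetric]
  proof (intro conjI allI impI)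
    show "r0 > 0" by (rule r0)
    show "HT_steady_state a b d1 d2 r l (\<lambda>_. HT_u0 a b) (\<lambda>_. HT_v0 a b)" for r
      by (rule HT_constant_steady_state[OF l assms(3)])
    fix \<epsilon> :: real assume \<epsilon>: "\<epsilon> > 0"
    show "\<exists>r U V. HT_bif_solution a b d1 d2 l r0 \<epsilon> r U V"
    proof (rule turing_branch[where m = "int n", OF assms(3) a assms(1,2) l r0 _ refl refl _ _ _ \<epsilon>])
      show "0 < int n" using n1 by simp
      show "(HT_A0 a b - d1 * xval l (int n)) * - (r0 + d2 * xval l (int n)) - HT_B0 a b * r0 = 0"
        using det[of n r0] by (simp add: A_def B_def r0_def)
      show "HT_A0 a b - d1 * xval l (int n) + HT_B0 a b < 0"
        using den[of "int n"] by (simp add: A_def B_def)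
      fix i :: int assume i: "\<bar>i\<bar> \<noteq> int n"
      define k where "k = nat \<bar>i\<bar>"
      have xk: "xval l i = xval l (int k)" by (simp add: xval_def k_def)
      have kn: "k \<noteq> n" using i by (auto simp: k_def)
      have "r0 - \<rho> k \<noteq> 0"
      proof (cases "1 \<le> k \<and> k \<le> N2")
        case True
        then show ?thesis using distinct[of k n] distinct[of n k] kn n1 by (cases "k < n") (auto simp: r0_def)
      next
        case False
        have "\<rho> k \<le> 0"
        proof (cases "k = 0")
          case True
          then show ?thesis unfolding \<rho> by (simp add: xval_def)
        next
          case False
          then have "d1 * xval l (int k) - A \<ge> 0" using below[of k] \<open>\<not> (1 \<le> k \<and> k \<le> N2)\<close> by simp
          then have "0 \<le> d2 * xval l (int k) * (d1 * xval l (int k) - A)"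
            using assms(2) xval_bounds(1)[OF l] by (intro mult_nonneg_nonneg) auto
          then show ?thesis unfolding \<rho> using den[of "int k"] by simp
        qed
        then show ?thesis using r0 by simp
      qed
      then show "(HT_A0 a b - d1 * xval l i) * - (r0 + d2 * xval l i) - HT_B0 a b * r0 \<noteq> 0"
        using det[of k r0] den[of "int k"] unfolding xk A_def[symmetric] B_def[symmetric] by auto
    qed
  qed
  have no_unstable: False
    if st: "HT_stable_bif_solutions a b d1 d2 l r0"
      and un: "(A - d1 * xval l k) + (- (r0 + d2 * xval l k)) > 0 \<or> (A - d1 * xval l k) * (- (r0 + d2 * xval l k)) - B * r0 < 0" for k
  proof -
    obtain \<mu> :: complex where "(\<mu> - of_real (A - d1 * xval l k)) * (\<mu> - of_real (- (r0 + d2 * xval l k))) = of_real (B * r0)"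
      and "Re \<mu> > 0"
      using unstable_root[OF un] by blast
    then obtain \<epsilon> where \<epsilon>: "\<epsilon> > 0" and "\<And>r U V. HT_bif_solution a b d1 d2 l r0 \<epsilon> r U V \<Longrightarrow> \<not> HT_stable a b d1 d2 r l U V"
      using lyapunov_perron[OF assms(3) a assms(1,2) l r0] unfolding A_def B_def by blast
    with st show False unfolding HT_stable_bif_solutions_def by blast
  qed
  have "HT_A6'' a b d1 d2 l \<and> \<rho> n = HT_rstar a b d1 d2 l" if st: "HT_stable_bif_solutions a b d1 d2 l (\<rho> n)"
  proof
    note st' = st[folded r0_def]
    \<comment> \<open>a larger critical value means a negative determinant at \<open>r0\<close>\<close>
    have max: "\<rho> k \<le> r0" if "k \<in> {1..N2}" for k
    proof (rule ccontr)
      assume "\<not> \<rho> k \<le> r0"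
      then have "(d1 * xval l (int k) - A - B) * (r0 - \<rho> k) < 0" using den by (intro mult_pos_neg) auto
      then show False using no_unstable[OF st', of "int k"] unfolding det by blast
    qed
    have "Max (\<rho> ` {1..N2}) = r0"
      by (rule Max_eqI) (use max n1 in \<open>auto simp: r0_def\<close>)
    then show "\<rho> n = HT_rstar a b d1 d2 l" by (simp add: HT_rstar_def \<rho>_def N2_def r0_def)
    \<comment> \<open>otherwise the homogeneous mode has positive trace\<close>
    have "r0 \<ge> A"
    proof (rule ccontr)
      assume "\<not> A \<le> r0"
      then show False using no_unstable[OF st', of 0] by (simp add: xval_def)
    qed
    moreover have "r0 \<noteq> A"
    proof
      assume r0A: "r0 = A"
      define X where "X = HT_xbar a b d1 d2"
      have X: "X > 0" "d1\<^sup>2 * X\<^sup>2 - (2 * d1 * A + (d1 + d2) * B) * X + A * (A + B) = 0"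
        using xbar_root[OF assms(1,2) A AB] unfolding X_def HT_xbar_def A_def B_def by blast+
      have lH: "HT_lH a b d1 d2 k = real k * (1 / sqrt X)" for k by (simp add: HT_lH_def X_def)
      have N1: "HT_lH a b d1 d2 N1 < l" "l \<le> HT_lH a b d1 d2 (N1 + 1)"
        using upper_index[of "1 / sqrt X" l] X l unfolding N1_def HT_N1_def lH by auto
      \<comment> \<open>for \<open>n \<le> N1\<close> the Turing value lies below the Hopf value of the same mode, which is at most \<open>A0\<close>\<close>
      have "N1 < n"
      proof (rule ccontr)
        assume "\<not> N1 < n"
        then have "real n * (1 / sqrt X) \<le> real N1 * (1 / sqrt X)" using X by (intro mult_right_mono) auto
        then have "real n * (1 / sqrt X) < l" using N1(1) unfolding lH by linarith
        then have "real n < l * sqrt X" using X by (simp add: field_simps)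
        then have "(real n)\<^sup>2 < (l * sqrt X)\<^sup>2" by (intro power_strict_mono) auto
        then have "xval l (int n) < X" using X l by (simp add: xval_def power_mult_distrib field_simps)
        from hopf_above_turing[OF assms(1,2) A AB xval_bounds(1)[OF l] this X(2)]
        have "r0 < A - (d1 + d2) * xval l (int n)" unfolding r0_def \<rho> .
        moreover have "0 \<le> (d1 + d2) * xval l (int n)" using assms(1,2) xval_bounds(1)[OF l] by simp
        ultimately show False using r0A by linarith
      qed
      moreover have "HT_rH a b d1 d2 0 l = HT_rT a b d1 d2 n l"
        using r0A by (simp add: HT_rH_def A_def r0_def \<rho>_def)
      ultimately have "l \<in> HT_LTH a b d1 d2"
        unfolding HT_LTH_def mem_Collect_eq N1_def[symmetric] N2_def[symmetric]
        using N1 N2 n1 by (intro conjI exI[of _ 0] exI[of _ n]) auto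
      with assms(7) show False by simp
    qed
    ultimately have "r0 > A" by simp
    then show "HT_A6'' a b d1 d2 l"
      by (intro A6_from_mode[OF assms(1-4) a _ l n1(1) refl])
         (use A in \<open>simp_all add: A_def B_def r0_def \<rho> xval_def\<close>)
  qed
  with bif show "HT_steady_state_bifurcation a b d1 d2 l (HT_rT a b d1 d2 n l) \<and>
           (HT_stable_bif_solutions a b d1 d2 l (HT_rT a b d1 d2 n l) \<longrightarrow>
              HT_A6'' a b d1 d2 l \<and> HT_rT a b d1 d2 n l = HT_rstar a b d1 d2 l)"
    by (simp add: \<rho>_def)
qed

end
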